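(* Let $\Omega$ be a smooth bounded domain contained in $\mathbb{R}^n$. Let $a\in C^1(\Omega)$ be a nonnegative function, $u\in C^\infty(\Omega)$ be a positive function, $b\in L^1_{\mathrm{loc}}(\Omega)$ and $\beta\in L^1_{\mathrm{loc}}(\partial\Omega)$ be such that $$-\nabla\cdot\left(a(x)|\nabla u|^{p-2}\nabla u\right)\ge b(x)u^{p-1}\quad\text{a.e. in }\Omega$$ and $$a(x)|\nabla u|^{p-2}\partial_\nu u=\beta(x)u^{p-1}\quad\text{a.e. at }\partial\Omega.$$ There exists a positive constant $c_p=c(p)$ such that: (i) if $p\ge 2$, then $$\int_\Omega a(x)|\nabla\phi|^p\,dx\ \ge\ \int_\Omega b(x)|\phi|^p\,dx+c_p\int_\Omega a(x)\left|\nabla\left(\frac{\phi}{u}\right)\right|^p u^p\,dx+\int_{\partial\Omega}\beta(x)|\phi|^p\,d\nu$$ holds for all $\phi\in C^\infty(\Omega)$; (ii) if $1<p<2$, then $$\int_\Omega a(x)|\nabla\phi|^p\,dx\ \ge\ \int_\Omega b(x)|\phi|^p\,dx+c_p\int_\Omega a(x)\frac{\left|\nabla\left(\frac{\phi}{u}\right)\right|^2u^2}{\left(\left|\frac{\phi}{u}\nabla u\right|+\left|\nabla\left(\frac{\phi}{u}\right)\right|u\right)^{2-p}}\,dx+\int_{\partial\Omega}\beta(x)|\phi|^p\,d\nu$$ holds for all $\phi\in C^\infty(\Omega)$.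
   Context: $\partial_\nu u$ denotes the exterior normal derivative of $u$ at the boundary of $\Omega$, and $d\nu$ is the surface measure on $\partial\Omega$. The notation $c_p=c(p)$ means that the constant depends only on $p$.
   Formalization: The functions a, u and φ are taken regular up to the boundary (so that the boundary condition and boundary integral make sense), and u is assumed positive on the closure of Ω; if u may vanish on ∂Ω, β is unconstrained there and the inequality can fail. *)

theory Defs
  imports "HOL-Analysis.Analysis"
begin

text \<open>
  The dimension \<open>n\<close> has to be quantified inside the main statement (the constant there depends on
  \<open>p\<close> only, hence not on \<open>n\<close>), so the \<open>n\<close>-dimensional space is the library's
  \<^const>\<open>Euclidean_space\<close> \<open>n\<close>, whose points are the \<open>x :: nat \<Rightarrow> real\<close> with \<open>x i = 0\<close> for all
  \<open>i \<ge> n\<close>. Functions on it are total functions on \<open>nat \<Rightarrow> real\<close>; their values off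
  the relevant sets are never used.
\<close>

section \<open>Lebesgue measure\<close>

text \<open>
  Lebesgue--Borel measure of the coordinate subspace spanned by the coordinates in the finite set
  \<open>J\<close>, as a measure on all of \<open>nat \<Rightarrow> real\<close> (for \<open>J = {}\<close>: the unit mass at the origin).
\<close>

definition lborel_coords :: "nat set \<Rightarrow> (nat \<Rightarrow> real) measure" where
  "lborel_coords J =
     distr (Pi\<^sub>M J (\<lambda>_. lborel)) borel (\<lambda>y i. if i \<in> J then y i else 0)"

lemma measurable_coords_embedding:
  "(\<lambda>y i. if i \<in> J then y i else 0) \<in> measurable (Pi\<^sub>M J (\<lambda>_. lborel)) (borel :: (nat \<Rightarrow> real) measure)"
proof (rule measurable_coordinatewise_then_product)
  show "(\<lambda>y. if i \<in> J then y i else 0) \<in> borel_measurable (Pi\<^sub>M J (\<lambda>_. lborel :: real measure))" for i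
    by (cases "i \<in> J") auto
qed

definition lebesgue_space :: "nat \<Rightarrow> (nat \<Rightarrow> real) measure" where
  "lebesgue_space n = completion (lborel_coords {..<n})"

text \<open>
  Integral over \<open>S\<close> as an extended real, for functions such that the positive or the negative part
  has finite integral. Unlike the Bochner integral, it is \<open>-\<infinity>\<close> (and not \<open>0\<close>) if only the negative
  part has infinite integral.
\<close>

definition ext_integral :: "'a measure \<Rightarrow> 'a set \<Rightarrow> ('a \<Rightarrow> real) \<Rightarrow> ereal" where
  "ext_integral M S f =
     enn2ereal (\<integral>\<^sup>+x\<in>S. ennreal (f x) \<partial>M) - enn2ereal (\<integral>\<^sup>+x\<in>S. ennreal (- f x) \<partial>M)"

definition locally_integrable ::
    "nat \<Rightarrow> (nat \<Rightarrow> real) measure \<Rightarrow> (nat \<Rightarrow> real) set \<Rightarrow> ((nat \<Rightarrow> real) \<Rightarrow> real) \<Rightarrow> bool" where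
  "locally_integrable n M S f \<longleftrightarrow>
     (\<forall>K. compactin (Euclidean_space n) K \<and> K \<subseteq> S \<longrightarrow> set_integrable M K f)"

section \<open>Differential operators and smoothness\<close>

definition has_partial :: "nat \<Rightarrow> ((nat \<Rightarrow> real) \<Rightarrow> real) \<Rightarrow> (nat \<Rightarrow> real) \<Rightarrow> bool" where
  "has_partial i f x \<longleftrightarrow> (\<lambda>t. f (x(i := t))) field_differentiable (at (x i))"

definition partial :: "nat \<Rightarrow> ((nat \<Rightarrow> real) \<Rightarrow> real) \<Rightarrow> (nat \<Rightarrow> real) \<Rightarrow> real" where
  "partial i f x = deriv (\<lambda>t. f (x(i := t))) (x i)"

definition grad_norm :: "nat \<Rightarrow> ((nat \<Rightarrow> real) \<Rightarrow> real) \<Rightarrow> (nat \<Rightarrow> real) \<Rightarrow> real" where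
  "grad_norm n f x = L2_set (\<lambda>i. partial i f x) {..<n}"

definition divergence :: "nat \<Rightarrow> (nat \<Rightarrow> (nat \<Rightarrow> real) \<Rightarrow> real) \<Rightarrow> (nat \<Rightarrow> real) \<Rightarrow> real" where
  "divergence n F x = (\<Sum>i<n. partial i (F i) x)"

text \<open>
  The \<open>i\<close>-th component of \<open>a |\<nabla>u|\<^sup>p\<^sup>-\<^sup>2 \<nabla>u\<close>. It is \<open>0\<close> where \<open>\<nabla>u = 0\<close>, which for \<open>p > 1\<close> is the
  continuous extension.
\<close>

definition p_flux :: "real \<Rightarrow> nat \<Rightarrow> ((nat \<Rightarrow> real) \<Rightarrow> real) \<Rightarrow> ((nat \<Rightarrow> real) \<Rightarrow> real) \<Rightarrow>
    nat \<Rightarrow> (nat \<Rightarrow> real) \<Rightarrow> real" where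
  "p_flux p n a u i x = a x * grad_norm n u x powr (p - 2) * partial i u x"

text \<open>\<open>Ck_on n k U f\<close>: \<open>f\<close> is of class \<open>C\<^sup>k\<close> on the open subset \<open>U\<close> of \<open>Euclidean_space n\<close>.\<close>

primrec Ck_on :: "nat \<Rightarrow> nat \<Rightarrow> (nat \<Rightarrow> real) set \<Rightarrow> ((nat \<Rightarrow> real) \<Rightarrow> real) \<Rightarrow> bool" where
  "Ck_on n 0 U f \<longleftrightarrow> continuous_map (subtopology (Euclidean_space n) U) euclideanreal f"
| "Ck_on n (Suc k) U f \<longleftrightarrow> continuous_map (subtopology (Euclidean_space n) U) euclideanreal f \<and>
     (\<forall>i<n. (\<forall>x\<in>U. has_partial i f x) \<and> Ck_on n k U (partial i f))"

definition smooth_on :: "nat \<Rightarrow> (nat \<Rightarrow> real) set \<Rightarrow> ((nat \<Rightarrow> real) \<Rightarrow> real) \<Rightarrow> bool" where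
  "smooth_on n U f \<longleftrightarrow> (\<forall>k. Ck_on n k U f)"

text \<open>Regularity up to the boundary: \<open>f\<close> is regular on a neighbourhood of the closure of \<open>\<Omega>\<close>.\<close>

definition C1_up_to_boundary ::
    "nat \<Rightarrow> (nat \<Rightarrow> real) set \<Rightarrow> ((nat \<Rightarrow> real) \<Rightarrow> real) \<Rightarrow> bool" where
  "C1_up_to_boundary n \<Omega> f \<longleftrightarrow>
     (\<exists>U. openin (Euclidean_space n) U \<and> Euclidean_space n closure_of \<Omega> \<subseteq> U \<and> Ck_on n 1 U f)"

definition smooth_up_to_boundary ::
    "nat \<Rightarrow> (nat \<Rightarrow> real) set \<Rightarrow> ((nat \<Rightarrow> real) \<Rightarrow> real) \<Rightarrow> bool" where
  "smooth_up_to_boundary n \<Omega> f \<longleftrightarrow>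
     (\<exists>U. openin (Euclidean_space n) U \<and> Euclidean_space n closure_of \<Omega> \<subseteq> U \<and> smooth_on n U f)"

section \<open>Smooth bounded domains, exterior normal and surface measure\<close>

text \<open>
  Within the open set \<open>U\<close>, \<open>\<Omega>\<close> is the part above (\<open>s = 1\<close>) or below (\<open>s = -1\<close>) the graph
  \<open>x\<^sub>i = g(x)\<close>, where \<open>g\<close> is smooth and does not depend on the coordinate \<open>x\<^sub>i\<close>.
\<close>

definition boundary_chart :: "nat \<Rightarrow> (nat \<Rightarrow> real) set \<Rightarrow>
    (nat \<Rightarrow> real) set \<Rightarrow> nat \<Rightarrow> real \<Rightarrow> ((nat \<Rightarrow> real) \<Rightarrow> real) \<Rightarrow> bool" where
  "boundary_chart n \<Omega> U i s g \<longleftrightarrow>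
     openin (Euclidean_space n) U \<and> i < n \<and> s \<in> {-1, 1} \<and>
     smooth_on n (topspace (Euclidean_space n)) g \<and>
     (\<forall>x\<in>topspace (Euclidean_space n). \<forall>t. g (x(i := t)) = g x) \<and>
     \<Omega> \<inter> U = {x\<in>U. s * (x i - g x) > 0}"

definition smooth_bounded_domain :: "nat \<Rightarrow> (nat \<Rightarrow> real) set \<Rightarrow> bool" where
  "smooth_bounded_domain n \<Omega> \<longleftrightarrow>
     \<Omega> \<noteq> {} \<and> openin (Euclidean_space n) \<Omega> \<and> connectedin (Euclidean_space n) \<Omega> \<and>
     (\<exists>R. \<forall>x\<in>\<Omega>. L2_set x {..<n} \<le> R) \<and>
     (\<forall>x\<in>Euclidean_space n frontier_of \<Omega>. \<exists>U i s g. x \<in> U \<and> boundary_chart n \<Omega> U i s g)"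

text \<open>
  The exterior unit normal at \<open>x\<close> is the unit vector \<open>v\<close> such that all directions making an obtuse
  (acute) angle with \<open>v\<close> point from \<open>x\<close> into (out of) \<open>\<Omega>\<close>.
\<close>

definition is_exterior_normal ::
    "nat \<Rightarrow> (nat \<Rightarrow> real) set \<Rightarrow> (nat \<Rightarrow> real) \<Rightarrow> (nat \<Rightarrow> real) \<Rightarrow> bool" where
  "is_exterior_normal n \<Omega> x v \<longleftrightarrow>
     v \<in> topspace (Euclidean_space n) \<and> L2_set v {..<n} = 1 \<and>
     (\<forall>w\<in>topspace (Euclidean_space n).
        ((\<Sum>i<n. v i * w i) < 0 \<longrightarrow> (\<forall>\<^sub>F t in at_right 0. (\<lambda>i. x i + t * w i) \<in> \<Omega>)) \<and>
        ((\<Sum>i<n. v i * w i) > 0 \<longrightarrow> (\<forall>\<^sub>F t in at_right 0. (\<lambda>i. x i + t * w i) \<notin> \<Omega>)))"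

definition exterior_normal :: "nat \<Rightarrow> (nat \<Rightarrow> real) set \<Rightarrow> (nat \<Rightarrow> real) \<Rightarrow> nat \<Rightarrow> real" where
  "exterior_normal n \<Omega> x = (THE v. is_exterior_normal n \<Omega> x v)"

definition normal_derivative ::
    "nat \<Rightarrow> (nat \<Rightarrow> real) set \<Rightarrow> ((nat \<Rightarrow> real) \<Rightarrow> real) \<Rightarrow> (nat \<Rightarrow> real) \<Rightarrow> real" where
  "normal_derivative n \<Omega> f x = (\<Sum>i<n. partial i f x * exterior_normal n \<Omega> x i)"

text \<open>
  The surface measure is the Borel measure concentrated on the boundary that in every chart is given
  by the area element \<open>sqrt (1 + |\<nabla>g|\<^sup>2) dy\<close>, \<open>y\<close> ranging over the coordinate hyperplane
  \<open>x\<^sub>i = 0\<close>; the point of the graph over \<open>y\<close> is \<open>y(i := g y)\<close>. Since countably many charts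
  cover the boundary, this determines the measure uniquely. (For \<open>n = 1\<close> it is the counting measure.)
\<close>

definition is_surface_measure :: "nat \<Rightarrow> (nat \<Rightarrow> real) set \<Rightarrow> (nat \<Rightarrow> real) measure \<Rightarrow> bool" where
  "is_surface_measure n \<Omega> \<sigma> \<longleftrightarrow>
     sets \<sigma> = sets borel \<and> emeasure \<sigma> (- (Euclidean_space n frontier_of \<Omega>)) = 0 \<and>
     (\<forall>U i s g A. boundary_chart n \<Omega> U i s g \<and> A \<in> sets borel \<and>
          A \<subseteq> U \<inter> Euclidean_space n frontier_of \<Omega> \<longrightarrow>
        emeasure \<sigma> A =
          (\<integral>\<^sup>+y. ennreal (sqrt (1 + (grad_norm n g y)\<^sup>2)) * indicator A (y(i := g y))
             \<partial>lborel_coords ({..<n} - {i})))"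

end

(*
  Write psi = phi/u and test the differential inequality with Psi = |phi|^p / u^(p-1). Pointwise,
  grad phi = A + B with A = psi grad u and B = u grad psi, and
  |A + B|^p >= |A|^p + p |A|^(p-2) A.B + c_p * (remainder), where
  |A|^p + p |A|^(p-2) A.B = |grad u|^(p-2) grad u . grad Psi. So everything follows from integrating
  the flux a |grad u|^(p-2) grad u by parts against Psi.

  For p < 2 the flux is only Hoelder continuous where grad u = 0, while its divergence is known
  only as an a.e. classical derivative. One therefore applies the divergence theorem to
  a (|grad u|^2 + e)^((p-2)/2) grad u and lets e tend to 0. The limit of the divergences is
  dominated because |d_j w| |w|^(p-2) is integrable for every smooth w: a function of one
  variable with bounded k-th derivative satisfies, for small s, that the integral of |f'| over
  {|f| <= s} is O(s^(1-1/k)), and k is arbitrary. Where w = 0, almost every point is a limit point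
  of {w = 0} in the direction of each coordinate, so that the derivatives there vanish.

  For the divergence theorem itself one localises by a partition of unity and, near the boundary,
  flattens the graph by a shear.
*)

theory Submission
  imports Defs
begin


section \<open>Inequalities for powers\<close>

text \<open>An almost everywhere derivative of a merely Hoelder continuous flux need not account for
  its boundary integral, since a singular part could be missed; hence an integrable majorant for the
  regularised divergences is the heart of the matter. With w a partial derivative of u, the layer
  |w| ~ s contributes s^(p-2) times O(s^(1-1/k)), and over dyadic s these contributions are summable
  once k (p-1) > 1. The estimate lives on single coordinate lines with a constant uniform over the
  lines, and Fubini carries it to \<Omega>. On the zero set of the gradient the limit point argument
  is also applied to the flux itself: its classical derivative, wherever it exists, is 0 almost
  everywhere, in agreement with the limit of the regularised divergences. The pointwise inequality
  involves A and B only through the numbers |A|, |B| and A.B, so c_p is independent of n. As b is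
  only locally integrable, the integral of b |\<phi>|^p may be minus infinity; the divergence term
  is an integrable upper bound, so its positive part stays finite.\<close>

lemma powr_above_tangent:
  fixes x y q :: real
  assumes "x \<ge> 0" "y > 0" "q \<ge> 1"
  shows "x powr q \<ge> y powr q + q * y powr (q - 1) * (x - y)"
proof (cases "x = 0")
  case True
  \<comment> \<open>The point 0 lies outside of the open half line on which convexity is used; there
    the claim amounts to \<open>y powr q \<le> q * y powr q\<close>.\<close>
  have "q * y powr (q - 1) * y = q * y powr q" "1 * y powr q \<le> q * y powr q"
    using assms by (simp_all add: powr_diff)
  with True assms show ?thesis
    by (simp add: mult.assoc)
next
  case False
  have "q * y powr (q - 1) * (x - y) \<le> x powr q - y powr q"
    using assms False
    by (intro convex_on_imp_above_tangent[where A = "{0<..}"] powr_convex)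
       (auto intro!: derivative_eq_intros simp: interior_open)
  then show ?thesis by simp
qed

lemma power2_powr_half: "x \<ge> 0 \<Longrightarrow> (x\<^sup>2) powr (r / 2) = x powr (r :: real)" for x :: real
  by (cases "x = 0") (auto simp: powr_def ln_realpow)

text \<open>Here \<alpha>, \<beta>, \<gamma> play the roles of |A|, |B| and A.B. If \<beta> is at
  most C \<alpha>, convexity of t^(p/2) at \<alpha>^2 leaves the surplus p/2 \<alpha>^(p-2)
  \<beta>^2, which controls \<beta>^p because \<alpha> is at least \<beta>/C. If \<beta> exceeds C
  \<alpha>, then \<beta>^p dominates and all other terms together cost at most half of it.\<close>

lemma powr_inequality_ge_2:
  fixes \<alpha> \<beta> \<gamma> p :: real
  assumes p: "p \<ge> 2" and \<alpha>: "\<alpha> \<ge> 0" and \<beta>: "\<beta> \<ge> 0" and \<gamma>: "\<bar>\<gamma>\<bar> \<le> \<alpha> * \<beta>"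
  shows "(\<alpha>\<^sup>2 + 2 * \<gamma> + \<beta>\<^sup>2) powr (p / 2)
    \<ge> \<alpha> powr p + p * \<alpha> powr (p - 2) * \<gamma> + min (1 / 2) (p / 2 * (4 * p + 2) powr (2 - p)) * \<beta> powr p"
proof -
  \<comment> \<open>Chosen so that (2 p + 1) / C = 1/2, the total loss in the case \<beta> > C
    \<alpha>.\<close>
  define C where "C = 4 * p + 2"
  define c where "c = min (1 / 2) (p / 2 * (4 * p + 2) powr (2 - p))"
  have C: "C \<ge> 10" using p by (simp add: C_def)
  have c: "c \<le> 1 / 2" "c \<le> p / 2 * C powr (2 - p)" "c \<ge> 0"
    using p by (auto simp: c_def C_def)
  have square: "(\<beta> - \<alpha>)\<^sup>2 \<le> \<alpha>\<^sup>2 + 2 * \<gamma> + \<beta>\<^sup>2"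
    using \<gamma> by (simp add: power2_eq_square algebra_simps)
  then have N: "0 \<le> \<alpha>\<^sup>2 + 2 * \<gamma> + \<beta>\<^sup>2"
    by (meson order_trans zero_le_power2)
  show ?thesis
  proof (cases "\<alpha> = 0")
    case True
    with \<gamma> have "\<gamma> = 0" by simp
    with True show ?thesis
      unfolding c_def[symmetric] using c \<beta> by (simp add: power2_powr_half mult_left_le_one_le)
  next
    case False
    with \<alpha> have \<alpha>0: "\<alpha> > 0" by simp
    show ?thesis
    proof (cases "\<beta> \<le> C * \<alpha>")
      case True
      have "(\<alpha>\<^sup>2) powr (p / 2 - 1) = \<alpha> powr (p - 2)"
        using power2_powr_half[of \<alpha> "p - 2"] \<alpha> by (simp add: diff_divide_distrib)
      then have "(\<alpha>\<^sup>2 + 2 * \<gamma> + \<beta>\<^sup>2) powr (p / 2) \<ge> \<alpha> powr p + p / 2 * \<alpha> powr (p - 2) * (2 * \<gamma> + \<beta>\<^sup>2)"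
        using powr_above_tangent[of "\<alpha>\<^sup>2 + 2 * \<gamma> + \<beta>\<^sup>2" "\<alpha>\<^sup>2" "p / 2"] N p \<alpha>0 power2_powr_half[of \<alpha> p] by simp
      moreover have "c * \<beta> powr p \<le> p / 2 * \<alpha> powr (p - 2) * \<beta>\<^sup>2"
      proof -
        have "C powr (2 - p) * \<beta> powr (p - 2) \<le> C powr (2 - p) * (C * \<alpha>) powr (p - 2)"
          using True p \<beta> C by (intro mult_left_mono powr_mono2) auto
        also have "\<dots> = \<alpha> powr (p - 2)"
          using C \<alpha>0 by (simp add: powr_mult powr_minus_divide[of C "p - 2", simplified])
        finally have "C powr (2 - p) * \<beta> powr (p - 2) \<le> \<alpha> powr (p - 2)" .
        then have "p / 2 * (C powr (2 - p) * \<beta> powr (p - 2)) * \<beta>\<^sup>2 \<le> p / 2 * \<alpha> powr (p - 2) * \<beta>\<^sup>2"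
          using p by (intro mult_right_mono mult_left_mono) auto
        moreover have "\<beta> powr p = \<beta> powr (p - 2) * \<beta>\<^sup>2"
          using \<beta> by (cases "\<beta> = 0") (simp_all add: powr_diff)
        moreover have "c * \<beta> powr p \<le> p / 2 * C powr (2 - p) * \<beta> powr p"
          using c by (intro mult_right_mono) auto
        ultimately show ?thesis by (simp add: mult_ac)
      qed
      ultimately show ?thesis unfolding c_def[symmetric]
        by (simp add: algebra_simps add_divide_distrib)
    next
      case False
      then have "C * \<alpha> < \<beta>" by simp
      moreover have "0 < C * \<alpha>" using \<alpha>0 C by simp
      moreover have "\<alpha> \<le> C * \<alpha>" using \<alpha>0 C by simp
      ultimately have \<alpha>\<beta>: "\<alpha> / \<beta> < 1 / C" "\<beta> > 0" "\<alpha> \<le> \<beta>"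
        using C by (simp_all add: field_simps)
      \<comment> \<open>After division by \<beta>^p only r < 1/C matters: (1 - r)^p loses at most
        p/C, r^p costs at most 1/C and the linear term at most p/C.\<close>
      define r where "r = \<alpha> / \<beta>"
      have r: "r > 0" "r < 1 / C" "r \<le> 1" "\<alpha> = r * \<beta>"
        using \<alpha>\<beta> \<alpha>0 C by (auto simp: r_def field_simps)
      have pr: "p * r \<le> p / C" using mult_left_mono[of r "1 / C" p] r p by simp
      have "(\<beta> * (1 - r)) powr p = ((\<beta> - \<alpha>)\<^sup>2) powr (p / 2)"
        using power2_powr_half[of "\<beta> - \<alpha>" p] r \<alpha>\<beta> by (simp add: algebra_simps mult_le_cancel_right1)
      also have "\<dots> \<le> (\<alpha>\<^sup>2 + 2 * \<gamma> + \<beta>\<^sup>2) powr (p / 2)"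
        using square p by (intro powr_mono2) auto
      finally have 1: "\<beta> powr p * (1 - r) powr p \<le> (\<alpha>\<^sup>2 + 2 * \<gamma> + \<beta>\<^sup>2) powr (p / 2)"
        using r \<alpha>\<beta> by (simp add: powr_mult)
      have 2: "(1 - r) powr p \<ge> 1 - p / C"
        using powr_above_tangent[of "1 - r" 1 p] r p pr by simp
      have 3: "r powr p \<le> 1 / C"
        using powr_mono'[of 1 p r] r p by (simp)
      have "p * \<alpha> powr (p - 2) * \<gamma> \<le> p * \<alpha> powr (p - 2) * (\<alpha> * \<beta>)"
        using \<gamma> p by (intro mult_left_mono) auto
      also have "\<dots> = p * \<alpha> powr (p - 1) * \<beta>"
        using \<alpha>0 by (simp add: powr_diff power2_eq_square)
      also have "\<dots> = p * r powr (p - 1) * \<beta> powr p"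
        using r \<alpha>\<beta> by (simp add: powr_mult powr_diff)
      also have "\<dots> \<le> p * r * \<beta> powr p"
        using powr_mono'[of 1 "p - 1" r] r p by (intro mult_right_mono mult_left_mono) auto
      also have "\<dots> \<le> p / C * \<beta> powr p"
        using pr by (intro mult_right_mono) auto
      finally have 4: "p * \<alpha> powr (p - 2) * \<gamma> \<le> p / C * \<beta> powr p" .
      have "(2 * p + 1) / C = 1 / 2"
        using p by (simp add: C_def field_simps)
      then have "1 / 2 = 1 - p / C - 1 / C - p / C"
        by (simp add: add_divide_distrib)
      then have "r powr p + p / C + c \<le> (1 - r) powr p"
        using 2 3 c by linarith
      then have "\<beta> powr p * (r powr p + p / C + c) \<le> \<beta> powr p * (1 - r) powr p"
        by (intro mult_left_mono) auto
      with 1 4 r \<alpha>\<beta> show ?thesis unfolding c_def[symmetric]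
        by (simp add: powr_mult algebra_simps)
    qed
  qed
qed

text \<open>
  Second order Taylor expansion of \<open>t \<mapsto> (\<alpha>\<^sup>2 + 2 t \<gamma> + t\<^sup>2 \<beta>\<^sup>2)\<^sup>p\<^sup>/\<^sup>2\<close>. The strict inequality keeps
  the base away from \<open>0\<close>.
\<close>

lemma powr_inequality_less_2_strict:
  fixes \<alpha> \<beta> \<gamma> p :: real
  assumes p: "1 < p" "p < 2" and \<alpha>: "\<alpha> > 0" and \<beta>: "\<beta> \<ge> 0" and \<gamma>: "\<gamma>\<^sup>2 < \<alpha>\<^sup>2 * \<beta>\<^sup>2 \<or> \<beta> = 0 \<and> \<gamma> = 0"
  shows "(\<alpha>\<^sup>2 + 2 * \<gamma> + \<beta>\<^sup>2) powr (p / 2)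
    \<ge> \<alpha> powr p + p * \<alpha> powr (p - 2) * \<gamma> + p * (p - 1) / 2 * (\<beta>\<^sup>2 / (\<alpha> + \<beta>) powr (2 - p))"
proof -
  define N where "N t = \<alpha>\<^sup>2 + 2 * t * \<gamma> + t\<^sup>2 * \<beta>\<^sup>2" for t
  have Npos: "N t > 0" for t
  proof (cases "\<beta> = 0")
    case False
    then have b: "\<beta>\<^sup>2 > 0" by simp
    have "N t * \<beta>\<^sup>2 = (\<gamma> + t * \<beta>\<^sup>2)\<^sup>2 + (\<alpha>\<^sup>2 * \<beta>\<^sup>2 - \<gamma>\<^sup>2)"
      by (simp add: N_def power2_eq_square algebra_simps)
    also have "\<dots> > 0" using \<gamma> False by (intro add_nonneg_pos) auto
    finally show ?thesis using b by (metis zero_less_mult_pos2)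
  qed (use \<gamma> \<alpha> in \<open>auto simp: N_def\<close>)
  define f where "f t = N t powr (p / 2)" for t
  define f' where "f' t = p * N t powr (p / 2 - 1) * (\<gamma> + t * \<beta>\<^sup>2)" for t
  define f'' where "f'' t = p * (p - 2) * N t powr (p / 2 - 2) * (\<gamma> + t * \<beta>\<^sup>2)\<^sup>2 + p * N t powr (p / 2 - 1) * \<beta>\<^sup>2" for t
  have dN: "(N has_real_derivative 2 * (\<gamma> + t * \<beta>\<^sup>2)) (at t)" for t
    unfolding N_def by (auto intro!: derivative_eq_intros simp: algebra_simps)
  have df: "(f has_real_derivative f' t) (at t)" for t
    unfolding f_def using Npos[of t]
    by (auto intro!: derivative_eq_intros dN simp: f'_def)
  have df': "(f' has_real_derivative f'' t) (at t)" for t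
    unfolding f'_def using Npos[of t]
    by (auto intro!: derivative_eq_intros dN simp: f''_def power2_eq_square algebra_simps add_divide_distrib)
  have "\<exists>t. 0 < t \<and> t < 1 \<and>
      f 1 = (\<Sum>m<2. (if m = 0 then f else if m = 1 then f' else f'') 0 / fact m * (1 - 0) ^ m) +
        (if (2::nat) = 0 then f else if (2::nat) = 1 then f' else f'') t / fact 2 * (1 - 0) ^ 2"
    by (rule Taylor_up[of 2 "\<lambda>m::nat. if m = 0 then f else if m = 1 then f' else f''" f 0 1 0])
      (auto simp: less_2_cases_iff df df')
  then obtain t where t: "0 < t" "t < 1" and T: "f 1 = f 0 + f' 0 + f'' t / 2"
    by (auto simp: numeral_2_eq_2)
  have "\<gamma> \<le> \<alpha> * \<beta>"
    using \<gamma> \<alpha> \<beta> by (auto simp: power_mult_distrib[symmetric] intro: power2_le_imp_le)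
  then have "t * \<gamma> \<le> t * (\<alpha> * \<beta>)" using t by simp
  then have "N t \<le> (\<alpha> + t * \<beta>)\<^sup>2"
    by (simp add: N_def power2_eq_square algebra_simps)
  also have "\<dots> \<le> (\<alpha> + \<beta>)\<^sup>2"
    using t \<alpha> \<beta> by (intro power_mono) (auto simp: mult_left_le_one_le)
  finally have Nle: "N t \<le> (\<alpha> + \<beta>)\<^sup>2" .
  have N2: "N t powr (p / 2 - 2) * N t = N t powr (p / 2 - 1)"
    using Npos[of t] by (simp add: powr_diff power2_eq_square)
  \<comment> \<open>The Cauchy-Schwarz condition in disguise. The summand of \<open>f'' t\<close>
    with the negative factor p (p - 2) thus takes away at most the fraction 2 - p of the other one,
    and p (p - 1) remains of the factor p.\<close>
  have "(\<gamma> + t * \<beta>\<^sup>2)\<^sup>2 \<le> \<beta>\<^sup>2 * N t"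
    using \<gamma> by (auto simp: N_def power2_eq_square algebra_simps)
  then have "N t powr (p / 2 - 2) * (\<gamma> + t * \<beta>\<^sup>2)\<^sup>2 \<le> N t powr (p / 2 - 2) * (\<beta>\<^sup>2 * N t)"
    by (intro mult_left_mono) auto
  also have "\<dots> = N t powr (p / 2 - 1) * \<beta>\<^sup>2" using N2 by (simp add: mult_ac)
  finally have "p * (2 - p) * (N t powr (p / 2 - 2) * (\<gamma> + t * \<beta>\<^sup>2)\<^sup>2) \<le> p * (2 - p) * (N t powr (p / 2 - 1) * \<beta>\<^sup>2)"
    using p by (intro mult_left_mono) auto
  then have "f'' t \<ge> p * (p - 1) * (\<beta>\<^sup>2 * N t powr (p / 2 - 1))"
    by (simp add: f''_def algebra_simps)
  \<comment> \<open>The exponent p/2 - 1 is negative, so the upper bound for \<open>N t\<close>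
    turns into a lower bound here.\<close>
  moreover have "N t powr (p / 2 - 1) \<ge> ((\<alpha> + \<beta>)\<^sup>2) powr (p / 2 - 1)"
    using Nle Npos[of t] p by (intro powr_mono2') auto
  moreover have "((\<alpha> + \<beta>)\<^sup>2) powr (p / 2 - 1) = 1 / (\<alpha> + \<beta>) powr (2 - p)"
    using \<alpha> \<beta> by (simp add: powr_def ln_realpow exp_minus[symmetric] inverse_eq_divide[symmetric] algebra_simps diff_divide_distrib)
  ultimately have "f'' t \<ge> p * (p - 1) * (\<beta>\<^sup>2 * (1 / (\<alpha> + \<beta>) powr (2 - p)))"
    using p by (smt (verit) mult_left_mono mult_nonneg_nonneg zero_le_power2)
  moreover have "f 0 = \<alpha> powr p" "f' 0 = p * \<alpha> powr (p - 2) * \<gamma>"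
    using \<alpha> by (auto simp: f_def f'_def N_def powr_def ln_realpow algebra_simps)
  ultimately show ?thesis
    using T by (simp add: f_def N_def)
qed

text \<open>Replacing \<alpha> by \<alpha> + e makes the Cauchy-Schwarz condition strict, and both
  sides are continuous as e tends to 0. For \<alpha> = 0 the claim compares two multiples of
  \<beta>^p and holds because p (p - 1) / 2 is at most 1.\<close>

lemma powr_inequality_less_2:
  fixes \<alpha> \<beta> \<gamma> p :: real
  assumes p: "1 < p" "p < 2" and \<alpha>: "\<alpha> \<ge> 0" and \<beta>: "\<beta> \<ge> 0" and \<gamma>: "\<bar>\<gamma>\<bar> \<le> \<alpha> * \<beta>"
  shows "(\<alpha>\<^sup>2 + 2 * \<gamma> + \<beta>\<^sup>2) powr (p / 2)
    \<ge> \<alpha> powr p + p * \<alpha> powr (p - 2) * \<gamma> + p * (p - 1) / 2 * (\<beta>\<^sup>2 / (\<alpha> + \<beta>) powr (2 - p))"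
proof (cases "\<alpha> = 0")
  case True
  then have "\<gamma> = 0" using \<gamma> by simp
  have "p * (p - 1) / 2 \<le> 1" "p * (p - 1) / 2 \<ge> 0"
    using p mult_mono[of p 2 "p - 1" 1] by auto
  moreover have "\<beta>\<^sup>2 / \<beta> powr (2 - p) = \<beta> powr p"
    using \<beta> by (cases "\<beta> = 0") (simp_all add: powr_diff)
  moreover have "(\<beta>\<^sup>2) powr (p / 2) = \<beta> powr p"
    using \<beta> by (rule power2_powr_half)
  ultimately show ?thesis
    using True \<open>\<gamma> = 0\<close> mult_right_mono[of "p * (p - 1)" 2 "\<beta> powr p"]
    by (simp add: mult.commute)
next
  case False
  with \<alpha> have \<alpha>0: "\<alpha> > 0" by simp
  show ?thesis
  proof (cases "\<beta> = 0")
    case True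
    then show ?thesis using powr_inequality_less_2_strict[OF p \<alpha>0 \<beta>, of \<gamma>] \<gamma> by simp
  next
    case False
    with \<beta> have \<beta>0: "\<beta> > 0" by simp
    let ?l = "\<lambda>e. ((\<alpha> + e)\<^sup>2 + 2 * \<gamma> + \<beta>\<^sup>2) powr (p / 2)"
    let ?r = "\<lambda>e. (\<alpha> + e) powr p + p * (\<alpha> + e) powr (p - 2) * \<gamma> + p * (p - 1) / 2 * (\<beta>\<^sup>2 / (\<alpha> + e + \<beta>) powr (2 - p))"
    have "?r e \<le> ?l e" if "e > 0" for e
    proof (rule powr_inequality_less_2_strict[OF p])
      have "\<bar>\<gamma>\<bar> < (\<alpha> + e) * \<beta>" using \<gamma> \<beta>0 that by (smt (verit) mult_strict_right_mono)
      then have "\<gamma>\<^sup>2 < ((\<alpha> + e) * \<beta>)\<^sup>2"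
        by (metis abs_ge_zero power2_abs power_strict_mono zero_less_numeral)
      then show "\<gamma>\<^sup>2 < (\<alpha> + e)\<^sup>2 * \<beta>\<^sup>2 \<or> \<beta> = 0 \<and> \<gamma> = 0" by (simp add: power_mult_distrib)
    qed (use \<alpha>0 \<beta>0 that in auto)
    then have ev: "eventually (\<lambda>e. ?r e \<le> ?l e) (at_right 0)"
      by (simp add: eventually_at_filter)
    have "isCont ?r 0"
      using \<alpha>0 \<beta>0 by (intro continuous_intros) auto
    then have R: "(?r \<longlongrightarrow> ?r 0) (at_right 0)"
      unfolding isCont_def by (rule tendsto_mono[OF at_le[OF subset_UNIV]])
    have nonneg: "0 \<le> (\<alpha> + e)\<^sup>2 + 2 * \<gamma> + \<beta>\<^sup>2" if "e > 0" for e
    proof -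
      have "2 * (\<alpha> * \<beta>) \<le> 2 * ((\<alpha> + e) * \<beta>)" using that \<beta> by (simp add: algebra_simps)
      then have "(\<alpha> + e - \<beta>)\<^sup>2 \<le> (\<alpha> + e)\<^sup>2 + 2 * \<gamma> + \<beta>\<^sup>2"
        using \<gamma> unfolding power2_diff mult.assoc by linarith
      then show ?thesis by (meson order_trans zero_le_power2)
    qed
    have "(?l \<longlongrightarrow> ?l 0) (at_right 0)"
      using p nonneg
      by (intro tendsto_powr' tendsto_intros) (auto simp: eventually_at_filter)
    from tendsto_le[OF _ this R ev] show ?thesis by simp
  qed
qed

section \<open>Integrability of \<open>|f'| |f|\<^sup>\<alpha>\<^sup>-\<^sup>1\<close> for smooth functions of one variable\<close>

text \<open>A division into at most 2^m closed pieces with a weak sign on each, encoded as a binary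
  tree of splittings: passing to an antiderivative splits every leaf once and so raises m by
  one.\<close>

primrec piecewise_sign :: "nat \<Rightarrow> (real \<Rightarrow> real) \<Rightarrow> real \<Rightarrow> real \<Rightarrow> bool" where
  "piecewise_sign 0 g c d \<longleftrightarrow> (\<forall>t\<in>{c..d}. g t \<ge> 0) \<or> (\<forall>t\<in>{c..d}. g t \<le> 0)"
| "piecewise_sign (Suc m) g c d \<longleftrightarrow> (\<exists>e\<in>{c..d}. piecewise_sign m g c e \<and> piecewise_sign m g e d)"

lemma piecewise_sign_uminus: "piecewise_sign m g c d \<Longrightarrow> piecewise_sign m (\<lambda>t. - g t) c d"
  by (induction m arbitrary: c d) auto

lemma piecewise_sign_mono:
  fixes g :: "real \<Rightarrow> real"
  assumes cd: "c \<le> d" and cont: "continuous_on {c..d} g"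
    and mono: "\<And>s t. c \<le> s \<Longrightarrow> s \<le> t \<Longrightarrow> t \<le> d \<Longrightarrow> g s \<le> g t"
  shows "piecewise_sign (Suc 0) g c d"
proof -
  consider "g c \<ge> 0" | "g d \<le> 0" | "g c < 0" "g d > 0" by linarith
  then show ?thesis
  proof cases
    case 1
    then have "\<forall>t\<in>{c..d}. g t \<ge> 0" 
      using mono[of c] by (meson atLeastAtMost_iff order_refl order_trans)
    then show ?thesis using cd by (auto intro!: bexI[of _ c])
  next
    case 2
    then have "\<forall>t\<in>{c..d}. g t \<le> 0" 
      using mono[of _ d] by (meson atLeastAtMost_iff order_refl order_trans)
    then show ?thesis using cd by (auto intro!: bexI[of _ d])
  next
    case 3
    then obtain e where e: "c \<le> e" "e \<le> d" "g e = 0"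
      using IVT'[of g c 0 d] cont cd by auto
    then have "\<forall>t\<in>{c..e}. g t \<le> 0" "\<forall>t\<in>{e..d}. g t \<ge> 0"
      by (metis mono atLeastAtMost_iff order_trans)+
    then show ?thesis using e by auto
  qed
qed

text \<open>Where the derivative has a sign, \<open>g\<close> is monotone and changes its own sign
  at most once, so each piece needs at most one further cut.\<close>

lemma piecewise_sign_antiderivative:
  fixes g :: "real \<Rightarrow> real"
  assumes "c \<le> d" "\<And>t. t \<in> {c..d} \<Longrightarrow> (g has_real_derivative g' t) (at t)"
    "piecewise_sign m g' c d"
  shows "piecewise_sign (Suc m) g c d"
  using assms
proof (induction m arbitrary: c d)
  case 0
  have mono: "piecewise_sign (Suc 0) h c d"
    if h: "\<And>t. t \<in> {c..d} \<Longrightarrow> (h has_real_derivative h' t) (at t)" "\<forall>t\<in>{c..d}. h' t \<ge> 0" for h h'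
  proof (rule piecewise_sign_mono[OF 0(1)])
    show "continuous_on {c..d} h"
      using h(1) by (intro DERIV_atLeastAtMost_imp_continuous_on) fastforce
    fix s t assume st: "c \<le> s" "s \<le> t" "t \<le> d"
    show "h s \<le> h t"
    proof (rule DERIV_nonneg_imp_nondecreasing[OF st(2)])
      fix x assume "s \<le> x" "x \<le> t"
      then have "x \<in> {c..d}" using st by auto
      then show "\<exists>y. (h has_real_derivative y) (at x) \<and> y \<ge> 0" using h by blast
    qed
  qed
  from 0(3) show ?case unfolding piecewise_sign.simps(1)
  proof
    assume "\<forall>t\<in>{c..d}. g' t \<ge> 0"
    then show ?thesis using mono 0(2) by blast
  next
    assume "\<forall>t\<in>{c..d}. g' t \<le> 0"
    then have "piecewise_sign (Suc 0) (\<lambda>t. - g t) c d"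
      by (intro mono[of _ "\<lambda>t. - g' t"]) (auto intro!: derivative_eq_intros 0(2))
    from piecewise_sign_uminus[OF this] show ?thesis by simp
  qed
next
  case (Suc m)
  then obtain e where e: "e \<in> {c..d}" "piecewise_sign m g' c e" "piecewise_sign m g' e d" by auto
  have "piecewise_sign (Suc m) g c e" "piecewise_sign (Suc m) g e d"
    using e Suc.prems by (auto intro!: Suc.IH simp del: piecewise_sign.simps)
  then show ?case using e(1) by auto
qed

section \<open>Integrals of |f'| over sublevel sets of |f|\<close>

lemma borel_measurable_continuous_on_times_indicator:
  fixes f :: "'a :: topological_space \<Rightarrow> real"
  assumes "A \<in> sets borel" "continuous_on A f"
  shows "(\<lambda>x. f x * indicator A x) \<in> borel_measurable borel"
  using borel_measurable_continuous_on_indicator[OF assms] by (simp add: mult.commute)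

lemma borel_measurable_sublevel_interval:
  fixes f g :: "real \<Rightarrow> real"
  assumes "continuous_on {c..d} f" "continuous_on {c..d} g" "{a..b} \<subseteq> {c..d}"
  shows "(\<lambda>t. ennreal \<bar>g t\<bar> * indicator {t\<in>{a..b}. \<bar>f t\<bar> \<le> s} t) \<in> borel_measurable lborel"
proof -
  have [measurable]: "(\<lambda>t. h t * indicator {c..d} t) \<in> borel_measurable borel" if "h = f \<or> h = g" for h
    using that assms by (intro borel_measurable_continuous_on_times_indicator) auto
  have "(\<lambda>t. ennreal \<bar>g t * indicator {c..d} t\<bar> * indicator {t\<in>space borel. \<bar>f t * indicator {c..d} t\<bar> \<le> s} t * indicator {a..b} t)
      \<in> borel_measurable lborel" by measurable
  also have "(\<lambda>t. ennreal \<bar>g t * indicator {c..d} t\<bar> * indicator {t\<in>space borel. \<bar>f t * indicator {c..d} t\<bar> \<le> s} t * indicator {a..b} t)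
      = (\<lambda>t. ennreal \<bar>g t\<bar> * indicator {t\<in>{a..b}. \<bar>f t\<bar> \<le> s} t)"
    using assms(3) by (auto simp: fun_eq_iff subset_eq split: split_indicator)
  finally show ?thesis .
qed

text \<open>Even over the whole interval spanned by the smallest and largest point a, b of the
  sublevel set, the integral of f' is only f b - f a, and both values are at most s in modulus since
  a and b belong to the set.\<close>

lemma nn_integral_deriv_sublevel_nonneg:
  fixes f f' :: "real \<Rightarrow> real"
  assumes d: "\<And>t. t \<in> {c..d} \<Longrightarrow> (f has_real_derivative f' t) (at t)"
    and cont: "continuous_on {c..d} f'" and pos: "\<And>t. t \<in> {c..d} \<Longrightarrow> f' t \<ge> 0" and s: "s \<ge> 0"
  shows "(\<integral>\<^sup>+t. ennreal \<bar>f' t\<bar> * indicator {t\<in>{c..d}. \<bar>f t\<bar> \<le> s} t \<partial>lborel) \<le> ennreal (2 * s)"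
proof -
  define S where "S = {t\<in>{c..d}. \<bar>f t\<bar> \<le> s}"
  have contf: "continuous_on {c..d} f" using d by (intro DERIV_atLeastAtMost_imp_continuous_on) fastforce
  have "closed S" unfolding S_def
    using continuous_closed_preimage[of "{c..d}" "\<lambda>t. \<bar>f t\<bar>" "{..s}"] contf
    by (auto intro!: continuous_intros simp: vimage_def Int_def)
  moreover have "bounded S" by (rule bounded_subset[of "{c..d}"]) (auto simp: S_def)
  ultimately have comp: "compact S" by (simp add: compact_eq_bounded_closed)
  show ?thesis
  proof (cases "S = {}")
    case True
    then show ?thesis unfolding S_def[symmetric] by simp
  next
    case False
    obtain a where a: "a \<in> S" "\<And>t. t \<in> S \<Longrightarrow> a \<le> t" using compact_attains_inf[OF comp False] by auto
    obtain b where b: "b \<in> S" "\<And>t. t \<in> S \<Longrightarrow> t \<le> b" using compact_attains_sup[OF comp False] by auto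
    have sub: "{a..b} \<subseteq> {c..d}" using a(1) b(1) by (auto simp: S_def)
    have "(\<integral>\<^sup>+t. ennreal \<bar>f' t\<bar> * indicator S t \<partial>lborel) \<le> (\<integral>\<^sup>+t. ennreal (f' t) * indicator {a..b} t \<partial>lborel)"
      using a b sub pos by (intro nn_integral_mono) (auto split: split_indicator simp: subset_eq)
    also have "\<dots> = ennreal (\<integral>t. f' t * indicator {a..b} t \<partial>lborel)"
    proof -
      have "set_integrable lborel {a..b} f'"
        using cont sub by (intro borel_integrable_atLeastAtMost') (auto intro: continuous_on_subset)
      then have "integrable lborel (\<lambda>t. f' t * indicator {a..b} t)"
        by (simp add: set_integrable_def mult.commute)
      then have "(\<integral>\<^sup>+t. ennreal (f' t * indicator {a..b} t) \<partial>lborel) = ennreal (\<integral>t. f' t * indicator {a..b} t \<partial>lborel)"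
        using sub pos by (intro nn_integral_eq_integral) (auto split: split_indicator intro!: AE_I2)
      moreover have "ennreal (f' t * indicator {a..b} t) = ennreal (f' t) * indicator {a..b} t" for t
        by (simp split: split_indicator)
      ultimately show ?thesis by simp
    qed
    also have "(\<integral>t. f' t * indicator {a..b} t \<partial>lborel) = f b - f a"
    proof -
      have "(\<integral>t. indicator {a..b} t *\<^sub>R f' t \<partial>lborel) = f b - f a"
      proof (rule integral_FTC_Icc)
        show "a \<le> b" using a(2)[OF b(1)] .
        show "continuous_on {a..b} f'" using cont sub by (rule continuous_on_subset)
        show "(f has_vector_derivative f' t) (at t within {a..b})" if "a \<le> t" "t \<le> b" for t
          unfolding has_real_derivative_iff_has_vector_derivative[symmetric]
          using that sub by (intro has_field_derivative_at_within[OF d]) auto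
      qed
      then show ?thesis by (simp add: mult.commute)
    qed
    also have "f b - f a \<le> 2 * s"
      using a(1) b(1) by (auto simp: S_def)
    finally show ?thesis unfolding S_def by (simp add: ennreal_leI)
  qed
qed

lemma nn_integral_deriv_sublevel_piecewise:
  fixes f f' :: "real \<Rightarrow> real"
  assumes "\<And>t. t \<in> {c..d} \<Longrightarrow> (f has_real_derivative f' t) (at t)"
    and "continuous_on {c..d} f'" and "piecewise_sign m f' c d" and s: "s \<ge> 0"
  shows "(\<integral>\<^sup>+t. ennreal \<bar>f' t\<bar> * indicator {t\<in>{c..d}. \<bar>f t\<bar> \<le> s} t \<partial>lborel) \<le> ennreal (2 ^ Suc m * s)"
  using assms(1-3)
proof (induction m arbitrary: c d)
  case 0
  from 0(3) show ?case unfolding piecewise_sign.simps(1)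
  proof
    assume "\<forall>t\<in>{c..d}. f' t \<ge> 0"
    then show ?thesis using nn_integral_deriv_sublevel_nonneg[OF 0(1,2) _ s] by simp
  next
    assume "\<forall>t\<in>{c..d}. f' t \<le> 0"
    then show ?thesis
      using nn_integral_deriv_sublevel_nonneg[of c d "\<lambda>t. - f t" "\<lambda>t. - f' t" s] 0 s
      by (auto intro!: derivative_eq_intros continuous_intros)
  qed
next
  case (Suc m)
  then obtain e where e: "e \<in> {c..d}" "piecewise_sign m f' c e" "piecewise_sign m f' e d" by auto
  have cont: "continuous_on {c..d} f"
    using Suc.prems(1) by (intro DERIV_atLeastAtMost_imp_continuous_on) fastforce
  have "(\<integral>\<^sup>+t. ennreal \<bar>f' t\<bar> * indicator {t\<in>{c..d}. \<bar>f t\<bar> \<le> s} t \<partial>lborel)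
    \<le> (\<integral>\<^sup>+t. ennreal \<bar>f' t\<bar> * indicator {t\<in>{c..e}. \<bar>f t\<bar> \<le> s} t + ennreal \<bar>f' t\<bar> * indicator {t\<in>{e..d}. \<bar>f t\<bar> \<le> s} t \<partial>lborel)"
    by (intro nn_integral_mono) (auto split: split_indicator)
  also have "\<dots> = (\<integral>\<^sup>+t. ennreal \<bar>f' t\<bar> * indicator {t\<in>{c..e}. \<bar>f t\<bar> \<le> s} t \<partial>lborel)
      + (\<integral>\<^sup>+t. ennreal \<bar>f' t\<bar> * indicator {t\<in>{e..d}. \<bar>f t\<bar> \<le> s} t \<partial>lborel)"
    using e(1) by (intro nn_integral_add borel_measurable_sublevel_interval[OF cont Suc.prems(2)]) auto
  also have "\<dots> \<le> ennreal (2 ^ Suc m * s) + ennreal (2 ^ Suc m * s)"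
    using e Suc.prems(1,2)
    by (intro add_mono Suc.IH) (auto intro: continuous_on_subset)
  also have "\<dots> = ennreal (2 ^ Suc (Suc m) * s)"
    using s by (subst ennreal_plus[symmetric]) auto
  finally show ?case .
qed

text \<open>
  Adding \<open>M (t - c)\<^sup>k / k!\<close> makes the \<open>k\<close>-th derivative nonnegative, so that the first derivative
  changes its sign a bounded number of times.
\<close>

lemma nn_integral_deriv_sublevel_short:
  fixes D :: "nat \<Rightarrow> real \<Rightarrow> real"
  assumes k: "k \<ge> 1" and cd: "c \<le> d"
    and D: "\<And>m t. m < k \<Longrightarrow> t \<in> {c..d} \<Longrightarrow> (D m has_real_derivative D (Suc m) t) (at t)"
    and cont: "continuous_on {c..d} (D 1)"
    and M: "\<And>t. t \<in> {c..d} \<Longrightarrow> \<bar>D k t\<bar> \<le> M" and s: "s \<ge> 0"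
  shows "(\<integral>\<^sup>+t. ennreal \<bar>D 1 t\<bar> * indicator {t\<in>{c..d}. \<bar>D 0 t\<bar> \<le> s} t \<partial>lborel)
    \<le> ennreal (2 ^ Suc k * (s + M * (d - c) ^ k))"
proof -
  define P where "P m t = M * (t - c) ^ (k - m) / fact (k - m)" for m t
  define G where "G m t = D m t + P m t" for m t
  have M0: "M \<ge> 0" using M[of c] cd by auto
  have dP: "(P m has_real_derivative P (Suc m) t) (at t)" if "m < k" for m t
  proof -
    define l where "l = k - Suc m"
    have l: "k - m = Suc l" "k - Suc m = l" using that by (auto simp: l_def)
    have "((\<lambda>t. M * (t - c) ^ Suc l / fact (Suc l)) has_real_derivative M * (real (Suc l) * (t - c) ^ l) / fact (Suc l)) (at t)"
      using DERIV_power[OF DERIV_diff[OF DERIV_ident DERIV_const], where n = "Suc l"]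
      by (intro DERIV_cdivide DERIV_cmult) (simp del: power_Suc of_nat_Suc)
    also have "M * (real (Suc l) * (t - c) ^ l) / fact (Suc l) = M * (t - c) ^ l / fact l"
      by (simp del: of_nat_Suc)
    finally show ?thesis unfolding P_def l .
  qed
  have dG: "(G m has_real_derivative G (Suc m) t) (at t)" if "m < k" "t \<in> {c..d}" for m t
    unfolding G_def using that by (intro DERIV_add D dP)
  \<comment> \<open>Antiderivatives are taken downwards from the nonnegative \<open>G k\<close>;
    each order doubles the number of sign pieces, so \<open>G 1\<close> has at most 2^(k-1) of
    them.\<close>
  have "piecewise_sign m (G (k - m)) c d" if "m \<le> k" for m
    using that
  proof (induction m)
    case 0
    have "G k t \<ge> 0" if "t \<in> {c..d}" for t using M[OF that] by (simp add: G_def P_def)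
    then show ?case by simp
  next
    case (Suc m)
    then have "Suc (k - Suc m) = k - m" by simp
    then show ?case
      using Suc by (intro piecewise_sign_antiderivative[OF cd, where g' = "G (k - m)"])
        (use dG[of "k - Suc m"] in auto)
  qed
  from this[of "k - 1"] k have sgn: "piecewise_sign (k - 1) (G 1) c d" by simp
  have contG: "continuous_on {c..d} (G 1)"
    unfolding G_def P_def by (intro continuous_intros cont) auto
  have Pb: "\<bar>P m t\<bar> \<le> M * (d - c) ^ (k - m)" if "t \<in> {c..d}" for m t
  proof -
    have "M * (t - c) ^ (k - m) \<le> M * (d - c) ^ (k - m)"
      using that M0 by (intro mult_left_mono power_mono) auto
    moreover have "M * (t - c) ^ (k - m) \<ge> 0" using that M0 by auto
    moreover have "(1::real) \<le> fact (k - m)" by simp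
    ultimately have "P m t \<le> M * (d - c) ^ (k - m)" "P m t \<ge> 0"
      unfolding P_def by (auto simp: divide_le_eq intro: order_trans[OF _ mult_left_mono[of 1]] mult_left_mono)
    then show ?thesis by simp
  qed
  define h where "h = d - c"
  have h: "h \<ge> 0" using cd by (simp add: h_def)
  define S where "S = {t\<in>{c..d}. \<bar>D 0 t\<bar> \<le> s}"
  define T where "T = {t\<in>{c..d}. \<bar>G 0 t\<bar> \<le> s + M * h ^ k}"
  \<comment> \<open>The polynomial causes two errors: it raises the level by at most M h^k, and it
    changes the derivative by at most M h^(k-1), which integrates to M h^k over an interval of
    length h.\<close>
  have "(\<integral>\<^sup>+t. ennreal \<bar>D 1 t\<bar> * indicator S t \<partial>lborel)
     \<le> (\<integral>\<^sup>+t. ennreal \<bar>G 1 t\<bar> * indicator T t + ennreal (M * h ^ (k - 1)) * indicator {c..d} t \<partial>lborel)"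
  proof (intro nn_integral_mono)
    fix t
    show "ennreal \<bar>D 1 t\<bar> * indicator S t \<le> ennreal \<bar>G 1 t\<bar> * indicator T t + ennreal (M * h ^ (k - 1)) * indicator {c..d} t"
    proof (cases "t \<in> S")
      case True
      then have t: "t \<in> {c..d}" and "\<bar>D 0 t\<bar> \<le> s" by (auto simp: S_def)
      then have "t \<in> T" using Pb[OF t, of 0] by (auto simp: T_def G_def h_def)
      moreover have "\<bar>D 1 t\<bar> \<le> \<bar>G 1 t\<bar> + M * h ^ (k - 1)"
        using Pb[OF t, of 1] by (auto simp: G_def h_def)
      ultimately show ?thesis using True t M0 h
        by (auto simp flip: ennreal_plus intro: ennreal_leI)
    qed simp
  qed
  also have "\<dots> = (\<integral>\<^sup>+t. ennreal \<bar>G 1 t\<bar> * indicator T t \<partial>lborel) + (\<integral>\<^sup>+t. ennreal (M * h ^ (k - 1)) * indicator {c..d} t \<partial>lborel)"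
  proof (intro nn_integral_add)
    have "continuous_on {c..d} (G 0)"
      using dG[of 0] k by (intro DERIV_atLeastAtMost_imp_continuous_on) fastforce
    then show "(\<lambda>t. ennreal \<bar>G 1 t\<bar> * indicator T t) \<in> borel_measurable lborel"
      unfolding T_def using contG by (intro borel_measurable_sublevel_interval[of c d]) auto
  qed auto
  also have "\<dots> \<le> ennreal (2 ^ Suc (k - 1) * (s + M * h ^ k)) + ennreal (M * h ^ (k - 1) * h)"
  proof (intro add_mono)
    show "(\<integral>\<^sup>+t. ennreal \<bar>G 1 t\<bar> * indicator T t \<partial>lborel) \<le> ennreal (2 ^ Suc (k - 1) * (s + M * h ^ k))"
      unfolding T_def using dG[of 0] k s M0 h
      by (intro nn_integral_deriv_sublevel_piecewise contG sgn) auto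
    show "(\<integral>\<^sup>+t. ennreal (M * h ^ (k - 1)) * indicator {c..d} t \<partial>lborel) \<le> ennreal (M * h ^ (k - 1) * h)"
      using cd M0 h by (subst nn_integral_cmult_indicator) (auto simp: h_def ennreal_mult)
  qed
  also have "\<dots> = ennreal (2 ^ k * (s + M * h ^ k) + M * h ^ k)"
    using k s M0 h by (subst ennreal_plus[symmetric]) (auto simp: power_Suc[symmetric] mult.assoc mult.commute[of _ h] simp del: power_Suc)
  also have "\<dots> \<le> ennreal (2 ^ Suc k * (s + M * h ^ k))"
  proof (rule ennreal_leI)
    have "1 * (s + M * h ^ k) \<le> 2 ^ k * (s + M * h ^ k)"
      using s M0 h by (intro mult_right_mono) auto
    then show "2 ^ k * (s + M * h ^ k) + M * h ^ k \<le> 2 ^ Suc k * (s + M * h ^ k)"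
      using s by simp
  qed
  finally show ?thesis unfolding S_def h_def .
qed

text \<open>
  Cutting \<open>{c..d}\<close> into \<open>2\<^sup>j\<close> pieces balances the two summands of the previous bound at the level
  \<open>s = 2\<^sup>-\<^sup>k\<^sup>j\<close>.
\<close>

lemma nn_integral_deriv_sublevel_dyadic:
  fixes D :: "nat \<Rightarrow> real \<Rightarrow> real"
  assumes k: "k \<ge> 1" and cd: "c \<le> d"
    and D: "\<And>m t. m < k \<Longrightarrow> t \<in> {c..d} \<Longrightarrow> (D m has_real_derivative D (Suc m) t) (at t)"
    and cont: "continuous_on {c..d} (D 1)"
    and M: "\<And>t. t \<in> {c..d} \<Longrightarrow> \<bar>D k t\<bar> \<le> M"
  shows "(\<integral>\<^sup>+t. ennreal \<bar>D 1 t\<bar> * indicator {t\<in>{c..d}. \<bar>D 0 t\<bar> \<le> (1 / 2 ^ j) ^ k} t \<partial>lborel)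
    \<le> ennreal (2 ^ j * (2 ^ Suc k * ((1 / 2 ^ j) ^ k * (1 + M * (d - c) ^ k))))"
proof -
  define s where "s = (1 / 2 ^ j :: real) ^ k"
  have M0: "M \<ge> 0" using M[of c] cd by auto
  have *: "(\<integral>\<^sup>+t. ennreal \<bar>D 1 t\<bar> * indicator {t\<in>{c'..d'}. \<bar>D 0 t\<bar> \<le> s} t \<partial>lborel)
      \<le> ennreal (2 ^ i * (2 ^ Suc k * (s + M * ((d' - c') / 2 ^ i) ^ k)))"
    if "c \<le> c'" "c' \<le> d'" "d' \<le> d" for i c' d'
    using that
  proof (induction i arbitrary: c' d')
    case 0
    then have "continuous_on {c'..d'} (D 1)" using cont by (auto intro: continuous_on_subset)
    with 0 show ?case
      using nn_integral_deriv_sublevel_short[of k c' d' D M s] k D M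
      by (auto simp: s_def)
  next
    case (Suc i)
    define e where "e = (c' + d') / 2"
    have e: "c \<le> c'" "c' \<le> e" "e \<le> d'" "d' \<le> d" "c \<le> e" "e \<le> d" using Suc.prems by (auto simp: e_def)
    have contD: "continuous_on {c..d} (D 0)"
      using D[of 0] k by (intro DERIV_atLeastAtMost_imp_continuous_on) fastforce
    have half: "(d' - e) / 2 ^ i = (d' - c') / 2 ^ Suc i" "(e - c') / 2 ^ i = (d' - c') / 2 ^ Suc i"
      by (auto simp: e_def field_simps)
    have "(\<integral>\<^sup>+t. ennreal \<bar>D 1 t\<bar> * indicator {t\<in>{c'..d'}. \<bar>D 0 t\<bar> \<le> s} t \<partial>lborel)
      \<le> (\<integral>\<^sup>+t. ennreal \<bar>D 1 t\<bar> * indicator {t\<in>{c'..e}. \<bar>D 0 t\<bar> \<le> s} t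
           + ennreal \<bar>D 1 t\<bar> * indicator {t\<in>{e..d'}. \<bar>D 0 t\<bar> \<le> s} t \<partial>lborel)"
      by (intro nn_integral_mono) (auto split: split_indicator)
    also have "\<dots> = (\<integral>\<^sup>+t. ennreal \<bar>D 1 t\<bar> * indicator {t\<in>{c'..e}. \<bar>D 0 t\<bar> \<le> s} t \<partial>lborel)
        + (\<integral>\<^sup>+t. ennreal \<bar>D 1 t\<bar> * indicator {t\<in>{e..d'}. \<bar>D 0 t\<bar> \<le> s} t \<partial>lborel)"
      using e by (intro nn_integral_add borel_measurable_sublevel_interval[OF contD cont]) auto
    also have "\<dots> \<le> ennreal (2 ^ i * (2 ^ Suc k * (s + M * ((d' - c') / 2 ^ Suc i) ^ k)))
        + ennreal (2 ^ i * (2 ^ Suc k * (s + M * ((d' - c') / 2 ^ Suc i) ^ k)))"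
      using Suc.IH[of c' e] Suc.IH[of e d'] e unfolding half by (intro add_mono) auto
    also have "\<dots> = ennreal (2 ^ Suc i * (2 ^ Suc k * (s + M * ((d' - c') / 2 ^ Suc i) ^ k)))"
      using M0 e by (subst ennreal_plus[symmetric]) (auto simp: s_def)
    finally show ?case .
  qed
  have "s + M * ((d - c) / 2 ^ j) ^ k = s * (1 + M * (d - c) ^ k)"
    by (simp add: s_def power_divide field_simps)
  then show ?thesis using *[of c d j] cd by (simp only: s_def order_refl)
qed

text \<open>The interval is split according to the size of |D 0| into layers between 2^(-k(j+1)) and
  2^(-kj). The dyadic sublevel estimate is O(2^j 2^(-kj)) on such a layer and the weight is at most
  2^(k(j+1)(1-\<alpha>)), so the products form a geometric series of ratio 2^(1 - k \<alpha>) < 1.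
  The constant is fixed before the functions \<open>D\<close>, which makes it uniform over all
  coordinate lines later on.\<close>

lemma nn_integral_deriv_powr_bound:
  fixes \<alpha> :: real
  assumes \<alpha>: "0 < \<alpha>" "\<alpha> < 1" and k: "real k * \<alpha> > 1" and M: "M \<ge> 0" and L: "L \<ge> 0"
  shows "\<exists>C\<ge>0. \<forall>(D :: nat \<Rightarrow> real \<Rightarrow> real) c d. c \<le> d \<longrightarrow> d - c \<le> L \<longrightarrow>
      (\<forall>m<k. \<forall>t\<in>{c..d}. (D m has_real_derivative D (Suc m) t) (at t)) \<longrightarrow>
      continuous_on {c..d} (D 1) \<longrightarrow> (\<forall>t\<in>{c..d}. \<bar>D k t\<bar> \<le> M \<and> \<bar>D 1 t\<bar> \<le> M) \<longrightarrow>
      (\<integral>\<^sup>+t. ennreal (\<bar>D 1 t\<bar> * \<bar>D 0 t\<bar> powr (\<alpha> - 1)) * indicator {c..d} t \<partial>lborel) \<le> ennreal C"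
proof -
  have k1: "k \<ge> 1" using k by (cases k) auto
  define r where "r = 2 powr (1 - real k * \<alpha>)"
  have r: "0 < r" "r < 1" using k powr_less_mono[of "1 - real k * \<alpha>" 0 2] by (auto simp: r_def)
  define B where "B = 2 powr (real k * (1 - \<alpha>)) * (2 ^ Suc k * (1 + M * L ^ k))"
  have B: "B \<ge> 0" using M L by (auto simp: B_def)
  define C where "C = M * L + B / (1 - r)"
  define s where "s j = (1 / 2 ^ j :: real) ^ k" for j :: nat
  have s_powr: "s j = 2 powr (- (real j * real k))" for j
  proof -
    have "s j = inverse (2 ^ (j * k))" by (simp add: s_def power_one_over power_mult divide_inverse power_inverse)
    also have "\<dots> = 2 powr (- real (j * k))" by (simp only: powr_minus powr_realpow zero_less_numeral)
    finally show ?thesis by simp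
  qed
  show ?thesis
  proof (intro exI[of _ C] conjI allI impI)
    show "C \<ge> 0" using B r M L by (auto simp: C_def)
    fix D :: "nat \<Rightarrow> real \<Rightarrow> real" and c d :: real
    assume cd: "c \<le> d" and dL: "d - c \<le> L"
      and D': "\<forall>m<k. \<forall>t\<in>{c..d}. (D m has_real_derivative D (Suc m) t) (at t)"
      and cont: "continuous_on {c..d} (D 1)" and M': "\<forall>t\<in>{c..d}. \<bar>D k t\<bar> \<le> M \<and> \<bar>D 1 t\<bar> \<le> M"
    have D: "(D m has_real_derivative D (Suc m) t) (at t)" if "m < k" "t \<in> {c..d}" for m t using D' that by blast
    have Mk: "\<bar>D k t\<bar> \<le> M" and M1: "\<bar>D 1 t\<bar> \<le> M" if "t \<in> {c..d}" for t using M' that by blast+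
    \<comment> \<open>This is \<open>s (Suc j) powr (\<alpha> - 1)\<close>, an upper bound for the
      weight on the layer between \<open>s (Suc j)\<close> and \<open>s j\<close>, as the exponent
      is negative.\<close>
    define w where "w j = 2 powr (real (Suc j) * real k * (1 - \<alpha>))" for j
    define h where "h j t = ennreal (w j) * (ennreal \<bar>D 1 t\<bar> * indicator {t\<in>{c..d}. \<bar>D 0 t\<bar> \<le> s j} t)" for j t
    have pointwise: "ennreal (\<bar>D 1 t\<bar> * \<bar>D 0 t\<bar> powr (\<alpha> - 1)) * indicator {c..d} t \<le> ennreal M * indicator {c..d} t + (\<Sum>j. h j t)" for t
    \<comment> \<open>At zeros of \<open>D 0\<close> the integrand is 0 because 0 raised by
      \<open>powr\<close> to any exponent is 0.\<close>
    proof (cases "t \<in> {c..d} \<and> D 0 t \<noteq> 0")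
      case True
      then have t: "t \<in> {c..d}" and nz: "\<bar>D 0 t\<bar> > 0" by auto
      show ?thesis
      proof (cases "\<bar>D 0 t\<bar> \<ge> 1")
        case True
        then have "\<bar>D 0 t\<bar> powr (\<alpha> - 1) \<le> 1" using \<alpha> powr_mono[of "\<alpha> - 1" 0 "\<bar>D 0 t\<bar>"] by (simp split: if_splits)
        then have "\<bar>D 1 t\<bar> * \<bar>D 0 t\<bar> powr (\<alpha> - 1) \<le> M * 1"
          using M1[OF t] M by (intro mult_mono) auto
        then have "ennreal (\<bar>D 1 t\<bar> * \<bar>D 0 t\<bar> powr (\<alpha> - 1)) \<le> ennreal M" by (simp add: ennreal_leI)
        then show ?thesis using t by (simp add: add_increasing2)
      next
        case False
        have "\<exists>j. s j < \<bar>D 0 t\<bar>"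
        proof -
          have "((1/2::real) ^ k) < 1" using k1 by (simp add: power_less_one_iff)
          then obtain j where "((1/2::real) ^ k) ^ j < \<bar>D 0 t\<bar>" using real_arch_pow_inv[OF nz] by blast
          then show ?thesis by (auto simp: s_def power_one_over power_mult[symmetric] mult.commute)
        qed
        \<comment> \<open>The first level below |D 0 t|. It is not the level number 0, which equals
          1, so its predecessor exists and lies at or above |D 0 t|.\<close>
        define j where "j = (LEAST j. s j < \<bar>D 0 t\<bar>)"
        have j: "s j < \<bar>D 0 t\<bar>" unfolding j_def by (rule LeastI_ex) fact
        have "j \<noteq> 0" using j False by (auto simp: s_def intro!: Nat.gr0I)
        then obtain i where i: "j = Suc i" by (cases j) auto
        have "\<not> s i < \<bar>D 0 t\<bar>" using not_less_Least[of i "\<lambda>j. s j < \<bar>D 0 t\<bar>"] i by (simp add: j_def)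
        then have ti: "\<bar>D 0 t\<bar> \<le> s i" by simp
        have "\<bar>D 0 t\<bar> powr (\<alpha> - 1) \<le> s j powr (\<alpha> - 1)"
          using j \<alpha> by (intro powr_mono2') (auto simp: s_powr)
        also have "\<dots> = w i" by (simp add: s_powr powr_powr w_def i algebra_simps)
        finally have "ennreal (\<bar>D 1 t\<bar> * \<bar>D 0 t\<bar> powr (\<alpha> - 1)) \<le> h i t"
          unfolding h_def using t ti
          by (auto simp: ennreal_mult[symmetric] w_def mult.commute intro!: ennreal_leI mult_left_mono)
        also have "h i t \<le> (\<Sum>j. h j t)" using sum_le_suminf[of "\<lambda>j. h j t" "{i}"] by simp
        finally show ?thesis using t by (simp add: add_increasing)
      qed
    qed auto
    have contD: "continuous_on {c..d} (D 0)"
      using D[of 0] k1 by (intro DERIV_atLeastAtMost_imp_continuous_on) fastforce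
    have meas0: "(\<lambda>t. ennreal \<bar>D 1 t\<bar> * indicator {t\<in>{c..d}. \<bar>D 0 t\<bar> \<le> s j} t) \<in> borel_measurable lborel" for j
      by (rule borel_measurable_sublevel_interval[OF contD cont order_refl])
    then have meas [measurable]: "h j \<in> borel_measurable lborel" for j
      unfolding h_def by (rule borel_measurable_times_ennreal[OF borel_measurable_const])
    have hj: "(\<integral>\<^sup>+t. h j t \<partial>lborel) \<le> ennreal (B * r ^ j)" for j
    proof -
      have "(\<integral>\<^sup>+t. h j t \<partial>lborel) = ennreal (w j) * (\<integral>\<^sup>+t. ennreal \<bar>D 1 t\<bar> * indicator {t\<in>{c..d}. \<bar>D 0 t\<bar> \<le> s j} t \<partial>lborel)"
        unfolding h_def by (intro nn_integral_cmult meas0)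
      also have "\<dots> \<le> ennreal (w j) * ennreal (2 ^ j * (2 ^ Suc k * (s j * (1 + M * (d - c) ^ k))))"
        unfolding s_def by (intro mult_left_mono nn_integral_deriv_sublevel_dyadic k1 cd D cont Mk) auto
      also have "\<dots> = ennreal (w j * (2 ^ j * (2 ^ Suc k * (s j * (1 + M * (d - c) ^ k)))))"
        using M cd by (subst ennreal_mult) (auto simp: w_def s_def)
      also have "\<dots> \<le> ennreal (w j * (2 ^ j * (2 ^ Suc k * (s j * (1 + M * L ^ k)))))"
        using M cd dL by (intro ennreal_leI mult_left_mono add_left_mono power_mono) (auto simp: w_def s_def)
      also have "w j * (2 ^ j * (2 ^ Suc k * (s j * (1 + M * L ^ k)))) = (w j * 2 ^ j * s j) * (2 ^ Suc k * (1 + M * L ^ k))"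
        by (simp add: mult_ac)
      also have "w j * 2 ^ j * s j = 2 powr (real (Suc j) * real k * (1 - \<alpha>) + real j + - (real j * real k))"
        unfolding powr_add w_def s_powr by (simp add: powr_realpow)
      also have "real (Suc j) * real k * (1 - \<alpha>) + real j + - (real j * real k) = real k * (1 - \<alpha>) + (1 - real k * \<alpha>) * real j"
        by (simp add: algebra_simps)
      also have "2 powr \<dots> = 2 powr (real k * (1 - \<alpha>)) * r ^ j"
        by (simp add: powr_add r_def powr_powr[symmetric] powr_realpow)
      finally show ?thesis by (simp add: B_def mult_ac)
    qed
    have "(\<integral>\<^sup>+t. ennreal (\<bar>D 1 t\<bar> * \<bar>D 0 t\<bar> powr (\<alpha> - 1)) * indicator {c..d} t \<partial>lborel)
      \<le> (\<integral>\<^sup>+t. ennreal M * indicator {c..d} t + (\<Sum>j. h j t) \<partial>lborel)"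
      by (intro nn_integral_mono pointwise)
    also have "\<dots> = (\<integral>\<^sup>+t. ennreal M * indicator {c..d} t \<partial>lborel) + (\<integral>\<^sup>+t. (\<Sum>j. h j t) \<partial>lborel)"
      by (intro nn_integral_add) auto
    also have "(\<integral>\<^sup>+t. (\<Sum>j. h j t) \<partial>lborel) = (\<Sum>j. \<integral>\<^sup>+t. h j t \<partial>lborel)"
      by (intro nn_integral_suminf) auto
    also have "\<dots> \<le> (\<Sum>j. ennreal (B * r ^ j))"
      by (intro suminf_le hj) auto
    also have "\<dots> = ennreal (\<Sum>j. B * r ^ j)"
      using r B by (intro suminf_ennreal2) (auto intro!: summable_mult summable_geometric)
    also have "(\<Sum>j. B * r ^ j) = B / (1 - r)"
      using r by (simp add: suminf_mult suminf_geometric summable_geometric)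
    also have "(\<integral>\<^sup>+t. ennreal M * indicator {c..d} t \<partial>lborel) = ennreal (M * (d - c))"
      using cd M by (subst nn_integral_cmult_indicator) (auto simp: ennreal_mult)
    also have "ennreal (M * (d - c)) + ennreal (B / (1 - r)) = ennreal (M * (d - c) + B / (1 - r))"
      using M cd B r by (subst ennreal_plus) auto
    also have "\<dots> \<le> ennreal C"
      unfolding C_def using M dL by (intro ennreal_leI add_right_mono mult_left_mono)
    finally show "(\<integral>\<^sup>+t. ennreal (\<bar>D 1 t\<bar> * \<bar>D 0 t\<bar> powr (\<alpha> - 1)) * indicator {c..d} t \<partial>lborel) \<le> ennreal C"
      by (simp add: add_ac)
  qed
qed

section \<open>Calculus on the coordinate model of Euclidean space\<close>

abbreviation coord_space :: "nat \<Rightarrow> (nat \<Rightarrow> real) set" where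
  "coord_space n \<equiv> topspace (Euclidean_space n)"

lemma Euclidean_space_eq: "Euclidean_space n = top_of_set (coord_space n)"
  by (simp add: Euclidean_space_def euclidean_product_topology)

lemma mem_coord_space: "x \<in> coord_space n \<longleftrightarrow> (\<forall>i\<ge>n. x i = 0)"
  by (simp add: topspace_Euclidean_space)

lemma fun_upd_coord_space [simp]: "x \<in> coord_space n \<Longrightarrow> i < n \<Longrightarrow> x(i := t) \<in> coord_space n"
  by (auto simp: mem_coord_space)

lemma closed_coord_space: "closed (coord_space n)"
proof -
  have "coord_space n = (\<Inter>i\<in>{n..}. {x. x i = 0})"
    by (auto simp: mem_coord_space)
  moreover have "closed {x :: nat \<Rightarrow> real. x i = 0}" for i
    by (intro closed_Collect_eq continuous_on_product_coordinates continuous_on_const)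
  ultimately show ?thesis by (auto intro!: closed_INT)
qed

lemma openin_coord_space_iff: "openin (Euclidean_space n) U \<longleftrightarrow> (\<exists>T. open T \<and> U = coord_space n \<inter> T)"
  by (subst Euclidean_space_eq) (simp add: openin_open)

lemma openin_coord_space_subset: "openin (Euclidean_space n) U \<Longrightarrow> U \<subseteq> coord_space n"
  by (rule openin_subset)

lemma openin_coord_space_borel: "openin (Euclidean_space n) U \<Longrightarrow> U \<in> sets borel"
  using closed_coord_space[of n] by (auto simp: openin_coord_space_iff)

lemma closure_of_coord_space: "\<Omega> \<subseteq> coord_space n \<Longrightarrow> Euclidean_space n closure_of \<Omega> = closure \<Omega>"
  using closure_minimal[OF _ closed_coord_space, of \<Omega> n]
  by (subst Euclidean_space_eq) (auto simp: closure_of_subtopology Int_absorb1)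

lemma frontier_of_coord_space:
  "openin (Euclidean_space n) \<Omega> \<Longrightarrow> Euclidean_space n frontier_of \<Omega> = closure \<Omega> - \<Omega>"
  by (simp add: frontier_of_def interior_of_openin closure_of_coord_space openin_coord_space_subset)

lemma continuous_map_coord_space:
  assumes "U \<subseteq> coord_space n"
  shows "continuous_map (subtopology (Euclidean_space n) U) euclideanreal f \<longleftrightarrow> continuous_on U f"
  using assms by (subst Euclidean_space_eq) (simp add: subtopology_subtopology Int_absorb1)

lemma compactin_coord_space: "compactin (Euclidean_space n) K \<longleftrightarrow> K \<subseteq> coord_space n \<and> compact K"
  by (subst Euclidean_space_eq) (auto simp: compactin_subtopology)

text \<open>Cubes in place of balls: being products, they are easily seen to be compact and of
  finite measure, and they meet coordinate lines in intervals.\<close>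

definition closed_box :: "nat \<Rightarrow> (nat \<Rightarrow> real) \<Rightarrow> real \<Rightarrow> (nat \<Rightarrow> real) set" where
  "closed_box n c r = {x \<in> coord_space n. \<forall>i<n. \<bar>x i - c i\<bar> \<le> r}"

definition open_box :: "nat \<Rightarrow> (nat \<Rightarrow> real) \<Rightarrow> real \<Rightarrow> (nat \<Rightarrow> real) set" where
  "open_box n c r = {x \<in> coord_space n. \<forall>i<n. \<bar>x i - c i\<bar> < r}"

lemma open_box_subset: "open_box n c r \<subseteq> closed_box n c r"
  by (auto simp: open_box_def closed_box_def)

lemma closed_box_subset: "closed_box n c r \<subseteq> coord_space n"
  by (auto simp: closed_box_def)

lemma openin_open_box: "openin (Euclidean_space n) (open_box n c r)"
proof -
  have "open (\<Inter>i<n. {x :: nat \<Rightarrow> real. \<bar>x i - c i\<bar> < r})"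
    by (intro open_INT ballI open_Collect_less continuous_intros) auto
  moreover have "open_box n c r = coord_space n \<inter> (\<Inter>i<n. {x. \<bar>x i - c i\<bar> < r})"
    by (auto simp: open_box_def)
  ultimately show ?thesis unfolding openin_coord_space_iff by blast
qed

lemma compact_closed_box: "compact (closed_box n c r)"
proof -
  \<comment> \<open>Compactness comes from Tychonoff, with the singleton {0} as the factor for every
    coordinate from n on.\<close>
  have eq: "closed_box n c r = PiE UNIV (\<lambda>i. if i < n then {c i - r..c i + r} else {0})"
    by (auto simp: closed_box_def mem_coord_space PiE_iff abs_le_iff split: if_splits) (smt (verit))+
  have "compactin (product_topology (\<lambda>i. euclideanreal) (UNIV :: nat set)) (closed_box n c r)"
    unfolding eq compactin_PiE by auto
  then show ?thesis by (simp add: euclidean_product_topology)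
qed

lemma openin_compl_closed_box: "openin (Euclidean_space n) (coord_space n - closed_box n c r)"
  unfolding openin_coord_space_iff using compact_imp_closed[OF compact_closed_box]
  by (intro exI[of _ "- closed_box n c r"]) auto

text \<open>A basic open set of the product topology grants each coordinate its own radius. The
  minimum over the finitely many coordinates below n suffices, since all others are fixed at
  0.\<close>

lemma closed_box_in_open:
  assumes U: "openin (Euclidean_space n) U" and x: "x \<in> U"
  obtains r where "r > 0" "closed_box n x r \<subseteq> U"
proof -
  obtain T where T: "open T" "U = coord_space n \<inter> T" using U by (auto simp: openin_coord_space_iff)
  then have "openin (product_topology (\<lambda>i. euclidean) UNIV) T" by (simp add: euclidean_product_topology)
  then obtain X where X: "x \<in> PiE UNIV X" "\<And>i. open (X i)" "finite {i. X i \<noteq> UNIV}" "PiE UNIV X \<subseteq> T"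
    using product_topology_open_contains_basis[of "\<lambda>i. euclidean" UNIV T x] x T by auto
  have "\<exists>r>0. \<forall>y. \<bar>y - x i\<bar> \<le> r \<longrightarrow> y \<in> X i" for i :: nat
  proof -
    have "x i \<in> X i" using X(1) by (auto simp: PiE_iff)
    then obtain e where "e > 0" "cball (x i) e \<subseteq> X i" using X(2)[of i] open_contains_cball by blast
    then show ?thesis by (intro exI[of _ e]) (auto simp: subset_eq dist_real_def abs_minus_commute)
  qed
  then obtain r where r: "\<And>i. r i > 0" "\<And>(i :: nat) y. \<bar>y - x i\<bar> \<le> r i \<Longrightarrow> y \<in> X i" by metis
  define q where "q = Min (insert 1 (r ` {..<n}))"
  have q: "q > 0" "\<And>i. i < n \<Longrightarrow> q \<le> r i" using r(1) by (auto simp: q_def)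
  have "closed_box n x q \<subseteq> U"
  proof
    fix y assume y: "y \<in> closed_box n x q"
    have "y i \<in> X i" for i
    proof (cases "i < n")
      case True
      then show ?thesis using y q(2)[of i] by (intro r(2)) (force simp: closed_box_def)
    next
      case False
      then have "y i = x i" using y x T by (auto simp: closed_box_def mem_coord_space)
      then show ?thesis using r(2)[of "x i" i] r(1)[of i] by simp
    qed
    then show "y \<in> U" using X(4) y T by (auto simp: closed_box_def PiE_iff)
  qed
  with q(1) that show ?thesis by blast
qed

lemma eventually_fun_upd_mem:
  assumes U: "openin (Euclidean_space n) U" and x: "x \<in> U" and i: "i < n"
  shows "eventually (\<lambda>t. x(i := t) \<in> U) (nhds (x i))"
proof -
  obtain r where r: "r > 0" "closed_box n x r \<subseteq> U" using closed_box_in_open[OF U x] .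
  have "x \<in> coord_space n" using openin_coord_space_subset[OF U] x by auto
  then have "x(i := t) \<in> U" if "dist t (x i) < r" for t
    using r that i by (intro subsetD[OF r(2)]) (auto simp: closed_box_def dist_real_def)
  with r(1) show ?thesis unfolding eventually_nhds_metric by blast
qed

section \<open>Partial derivatives and functions of class C^1\<close>

lemma partial_eqI: "((\<lambda>t. f (x(i := t))) has_real_derivative d) (at (x i)) \<Longrightarrow> partial i f x = d"
  unfolding partial_def by (rule DERIV_imp_deriv)

lemma has_partial_deriv:
  "has_partial i f x \<Longrightarrow> ((\<lambda>t. f (x(i := t))) has_real_derivative partial i f x) (at (x i))"
  unfolding has_partial_def partial_def by (rule field_differentiable_derivI)

lemma has_partialI: "((\<lambda>t. f (x(i := t))) has_real_derivative d) (at (x i)) \<Longrightarrow> has_partial i f x"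
  unfolding has_partial_def field_differentiable_def by blast

lemma has_partial_cong_open:
  assumes U: "openin (Euclidean_space n) U" and x: "x \<in> U" and i: "i < n" and fg: "\<And>y. y \<in> U \<Longrightarrow> f y = g y"
    and "((\<lambda>t. f (x(i := t))) has_real_derivative d) (at (x i))"
  shows "((\<lambda>t. g (x(i := t))) has_real_derivative d) (at (x i))"
proof -
  have "eventually (\<lambda>t. f (x(i := t)) = g (x(i := t))) (nhds (x i))"
    using eventually_fun_upd_mem[OF U x i] by eventually_elim (rule fg)
  from DERIV_cong_ev[OF refl this refl] assms(5) show ?thesis by simp
qed

lemma partial_cong_open:
  assumes U: "openin (Euclidean_space n) U" and x: "x \<in> U" and i: "i < n" and fg: "\<And>y. y \<in> U \<Longrightarrow> f y = g y"
  shows "partial i f x = partial i g x"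
proof -
  have "eventually (\<lambda>t. f (x(i := t)) = g (x(i := t))) (nhds (x i))"
    using eventually_fun_upd_mem[OF U x i] by eventually_elim (rule fg)
  then show ?thesis unfolding partial_def by (intro deriv_cong_ev) auto
qed

text \<open>On open sets this is the notion \<open>Ck_on n 1 U f\<close>, but bundled with openness
  and phrased by \<open>continuous_on\<close>, to which the usual continuity rules apply.\<close>

definition C1_on :: "nat \<Rightarrow> (nat \<Rightarrow> real) set \<Rightarrow> ((nat \<Rightarrow> real) \<Rightarrow> real) \<Rightarrow> bool" where
  "C1_on n U f \<longleftrightarrow> openin (Euclidean_space n) U \<and> continuous_on U f \<and>
     (\<forall>i<n. (\<forall>x\<in>U. has_partial i f x) \<and> continuous_on U (partial i f))"

lemma C1_onD:
  assumes "C1_on n U f"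
  shows "openin (Euclidean_space n) U" "continuous_on U f"
    "i < n \<Longrightarrow> x \<in> U \<Longrightarrow> ((\<lambda>t. f (x(i := t))) has_real_derivative partial i f x) (at (x i))"
    "i < n \<Longrightarrow> continuous_on U (partial i f)"
  using assms has_partial_deriv by (auto simp: C1_on_def)

lemma C1_onI:
  assumes "openin (Euclidean_space n) U" "continuous_on U f"
    and d: "\<And>i x. i < n \<Longrightarrow> x \<in> U \<Longrightarrow> ((\<lambda>t. f (x(i := t))) has_real_derivative g i x) (at (x i))"
    and g: "\<And>i. i < n \<Longrightarrow> continuous_on U (g i)"
  shows "C1_on n U f"
proof -
  have "partial i f x = g i x" if "i < n" "x \<in> U" for i x using d[OF that] by (rule partial_eqI)
  then have "continuous_on U (partial i f)" if "i < n" for i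
    using g[OF that] that by (simp cong: continuous_on_cong)
  with assms show ?thesis by (auto simp: C1_on_def intro: has_partialI)
qed

lemma C1_on_if_Ck_on: "openin (Euclidean_space n) U \<Longrightarrow> Ck_on n 1 U f \<Longrightarrow> C1_on n U f"
  by (auto simp: C1_on_def continuous_map_coord_space openin_coord_space_subset)

lemma smooth_on_partial: "smooth_on n U f \<Longrightarrow> i < n \<Longrightarrow> smooth_on n U (partial i f)"
  unfolding smooth_on_def by (metis Ck_on.simps(2))

lemma C1_on_if_smooth_on: "openin (Euclidean_space n) U \<Longrightarrow> smooth_on n U f \<Longrightarrow> C1_on n U f"
  by (rule C1_on_if_Ck_on) (auto simp only: smooth_on_def)

lemma C1_on_subset: "C1_on n U f \<Longrightarrow> openin (Euclidean_space n) V \<Longrightarrow> V \<subseteq> U \<Longrightarrow> C1_on n V f"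
  by (auto simp: C1_on_def intro: continuous_on_subset)

lemma C1_on_cong:
  assumes "C1_on n U f" "\<And>x. x \<in> U \<Longrightarrow> f x = g x"
  shows "C1_on n U g"
proof (rule C1_onI[where g = "\<lambda>i. partial i f"])
  show "continuous_on U g" using C1_onD(2)[OF assms(1)] assms(2) by (simp cong: continuous_on_cong)
  fix i x assume "i < n" "x \<in> U"
  then show "((\<lambda>t. g (x(i := t))) has_real_derivative partial i f x) (at (x i))"
    using has_partial_cong_open[OF C1_onD(1)[OF assms(1)]] C1_onD(3)[OF assms(1)] assms(2) by blast
qed (use C1_onD[OF assms(1)] in auto)

text \<open>Both pieces are open, so continuity is a local matter. This serves to glue a cut-off
  function to its extension by zero.\<close>

lemma C1_on_Un:
  assumes U: "C1_on n U f" and V: "C1_on n V f"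
  shows "C1_on n (U \<union> V) f"
proof -
  have oU: "openin (Euclidean_space n) U" and oV: "openin (Euclidean_space n) V" using assms by (auto simp: C1_on_def)
  obtain S T where ST: "open S" "U = coord_space n \<inter> S" "open T" "V = coord_space n \<inter> T"
    using oU oV by (auto simp: openin_coord_space_iff)
  have *: "continuous_on (U \<union> V) h" if "continuous_on U h" "continuous_on V h" for h :: "_ \<Rightarrow> real"
  proof (rule continuous_on_Un_local_open)
    show "openin (top_of_set (U \<union> V)) U" "openin (top_of_set (U \<union> V)) V"
      unfolding openin_open using ST by (auto intro: exI[of _ S] exI[of _ T])
  qed fact+
  show ?thesis using assms openin_Un[OF oU oV] by (auto simp: C1_on_def intro!: *)
qed

lemma C1_on_const: "openin (Euclidean_space n) U \<Longrightarrow> C1_on n U (\<lambda>_. c)"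
  by (rule C1_onI[where g = "\<lambda>_ _. 0"]) auto

lemma C1_on_coord: "openin (Euclidean_space n) U \<Longrightarrow> C1_on n U (\<lambda>x. x k)"
  by (rule C1_onI[where g = "\<lambda>i _. if i = k then 1 else 0"])
    (auto intro: continuous_on_product_coordinates continuous_on_subset)

lemma partial_add:
  assumes "C1_on n U f" "C1_on n U g" "i < n" "x \<in> U"
  shows "((\<lambda>t. f (x(i := t)) + g (x(i := t))) has_real_derivative (partial i f x + partial i g x)) (at (x i))"
  by (intro DERIV_add C1_onD(3)[OF assms(1)] C1_onD(3)[OF assms(2)] assms)

lemma C1_on_add: "C1_on n U f \<Longrightarrow> C1_on n U g \<Longrightarrow> C1_on n U (\<lambda>x. f x + g x)"
  by (rule C1_onI[where g = "\<lambda>i x. partial i f x + partial i g x"])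
    (auto intro!: continuous_intros partial_add dest: C1_onD)

lemma partial_mult:
  assumes "C1_on n U f" "C1_on n U g" "i < n" "x \<in> U"
  shows "((\<lambda>t. f (x(i := t)) * g (x(i := t))) has_real_derivative (partial i f x * g x + f x * partial i g x)) (at (x i))"
  using DERIV_mult[OF C1_onD(3)[OF assms(1,3,4)] C1_onD(3)[OF assms(2,3,4)]] by (simp add: algebra_simps)

lemma C1_on_mult: "C1_on n U f \<Longrightarrow> C1_on n U g \<Longrightarrow> C1_on n U (\<lambda>x. f x * g x)"
  by (rule C1_onI[where g = "\<lambda>i x. partial i f x * g x + f x * partial i g x"])
    (auto intro!: continuous_intros partial_mult dest: C1_onD)

lemma partial_compose:
  assumes "C1_on n U f" "\<And>x. x \<in> U \<Longrightarrow> (h has_real_derivative h' (f x)) (at (f x))" "i < n" "x \<in> U"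
  shows "((\<lambda>t. h (f (x(i := t)))) has_real_derivative (h' (f x) * partial i f x)) (at (x i))"
  by (rule DERIV_chain2[OF _ C1_onD(3)[OF assms(1,3,4)]]) (use assms in simp)

lemma C1_on_compose:
  assumes "C1_on n U f" "\<And>x. x \<in> U \<Longrightarrow> (h has_real_derivative h' (f x)) (at (f x))" "continuous_on (f ` U) h'"
  shows "C1_on n U (\<lambda>x. h (f x))"
proof (rule C1_onI[OF _ _ partial_compose[OF assms(1,2)]])
  have h: "continuous_on (f ` U) h"
    using assms(2) by (auto intro!: continuous_at_imp_continuous_on DERIV_isCont)
  show "continuous_on U (\<lambda>x. h (f x))"
    by (rule continuous_on_compose2[OF h C1_onD(2)[OF assms(1)]]) simp
  have "continuous_on U (\<lambda>x. h' (f x))"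
    by (rule continuous_on_compose2[OF assms(3) C1_onD(2)[OF assms(1)]]) simp
  then show "continuous_on U (\<lambda>x. h' (f x) * partial i f x)" if "i < n" for i
    using C1_onD(4)[OF assms(1) that] by (intro continuous_intros)
qed (use C1_onD[OF assms(1)] in auto)

lemma C1_on_sum:
  assumes "openin (Euclidean_space n) U" "\<And>k. k \<in> A \<Longrightarrow> C1_on n U (f k)"
  shows "C1_on n U (\<lambda>x. \<Sum>k\<in>A. f k x)"
  using assms(2)
  by (induction A rule: infinite_finite_induct) (auto intro: C1_on_const C1_on_add assms(1))

lemma C1_on_prod:
  assumes "openin (Euclidean_space n) U" "\<And>k. k \<in> A \<Longrightarrow> C1_on n U (f k)"
  shows "C1_on n U (\<lambda>x. \<Prod>k\<in>A. f k x)"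
  using assms(2)
  by (induction A rule: infinite_finite_induct) (auto intro: C1_on_const C1_on_mult assms(1))

lemma partial_sum:
  assumes "\<And>k. k \<in> A \<Longrightarrow> C1_on n U (f k)" "i < n" "x \<in> U"
  shows "partial i (\<lambda>x. \<Sum>k\<in>A. f k x) x = (\<Sum>k\<in>A. partial i (f k) x)"
  by (rule partial_eqI) (intro DERIV_sum C1_onD(3)[OF assms(1)] assms(2,3))

section \<open>The chain rule along curves\<close>

lemma tendsto_coordinatewiseI:
  fixes f :: "'a \<Rightarrow> nat \<Rightarrow> real"
  assumes "\<And>i. ((\<lambda>t. f t i) \<longlongrightarrow> l i) F"
  shows "(f \<longlongrightarrow> l) F"
  using assms limitin_componentwise[of "\<lambda>_. euclideanreal" UNIV f l F]
  by (simp add: euclidean_product_topology)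

text \<open>The coordinates are switched on one at a time, using the mean value theorem in each.\<close>

lemma C1_on_chain_rule:
  assumes f: "C1_on n U f" and \<gamma>: "\<And>t. \<gamma> t \<in> coord_space n" "\<gamma> t0 \<in> U"
    and d: "\<And>i. i < n \<Longrightarrow> ((\<lambda>t. \<gamma> t i) has_real_derivative d i) (at t0)"
  shows "((\<lambda>t. f (\<gamma> t)) has_real_derivative (\<Sum>i<n. partial i f (\<gamma> t0) * d i)) (at t0)"
proof -
  have U: "openin (Euclidean_space n) U" using C1_onD(1)[OF f] .
  obtain r where r: "r > 0" "closed_box n (\<gamma> t0) r \<subseteq> U" using closed_box_in_open[OF U \<gamma>(2)] .
  define z where "z k t i = (if i < k then \<gamma> t i else \<gamma> t0 i)" for k t i
  have lim: "((\<lambda>t. \<gamma> t i) \<longlongrightarrow> \<gamma> t0 i) (at t0)" for i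
  proof (cases "i < n")
    case True
    then show ?thesis using DERIV_isCont[OF d] by (simp add: isCont_def)
  next
    case False
    then show ?thesis using \<gamma>(1) by (simp add: mem_coord_space)
  qed
  have "((\<lambda>t. f (z k t)) has_real_derivative (\<Sum>i<k. partial i f (\<gamma> t0) * d i)) (at t0)" if "k \<le> n" for k
    using that
  proof (induction k)
    case 0
    then show ?case by (simp add: z_def)
  next
    case (Suc k)
    then have k: "k < n" by simp
    define F where "F t s = f ((z k t)(k := s))" for t s
    have zk: "z k t = (z k t)(k := \<gamma> t0 k)" "z (Suc k) t = (z k t)(k := \<gamma> t k)" for t
      by (auto simp: z_def fun_eq_iff)
    have near: "eventually (\<lambda>t. \<forall>i<n. \<bar>\<gamma> t i - \<gamma> t0 i\<bar> \<le> r) (at t0)"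
    proof -
      have "eventually (\<lambda>t. \<bar>\<gamma> t i - \<gamma> t0 i\<bar> \<le> r) (at t0)" for i
        using tendstoD[OF lim[of i] r(1)] by eventually_elim (simp add: dist_real_def)
      then have "eventually (\<lambda>t. \<forall>i\<in>{..<n}. \<bar>\<gamma> t i - \<gamma> t0 i\<bar> \<le> r) (at t0)"
        by (intro eventually_ball_finite) auto
      then show ?thesis by (rule eventually_mono) auto
    qed
    have "\<exists>\<xi>. \<bar>\<xi> - \<gamma> t0 k\<bar> \<le> \<bar>\<gamma> t k - \<gamma> t0 k\<bar> \<and>
        F t (\<gamma> t k) - F t (\<gamma> t0 k) = (\<gamma> t k - \<gamma> t0 k) * partial k f ((z k t)(k := \<xi>))"
      if t: "\<forall>i<n. \<bar>\<gamma> t i - \<gamma> t0 i\<bar> \<le> r" for t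
    proof -
      have mem: "(z k t)(k := s) \<in> U" if "\<bar>s - \<gamma> t0 k\<bar> \<le> \<bar>\<gamma> t k - \<gamma> t0 k\<bar>" for s
        using that t k r(1) \<gamma>(1)[of t] \<gamma>(1)[of t0]
        by (intro subsetD[OF r(2)]) (auto simp: closed_box_def z_def mem_coord_space intro: order_trans)
      have der: "(F t has_real_derivative partial k f ((z k t)(k := s))) (at s)"
        if "\<bar>s - \<gamma> t0 k\<bar> \<le> \<bar>\<gamma> t k - \<gamma> t0 k\<bar>" for s
        using C1_onD(3)[OF f k mem[OF that]] by (simp add: F_def[abs_def])
      consider "\<gamma> t k = \<gamma> t0 k" | "\<gamma> t0 k < \<gamma> t k" | "\<gamma> t k < \<gamma> t0 k" by linarith
      then show ?thesis
      proof cases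
        case 1
        then show ?thesis by (intro exI[of _ "\<gamma> t0 k"]) simp
      next
        case 2
        obtain \<xi> where "\<gamma> t0 k < \<xi>" "\<xi> < \<gamma> t k"
          "F t (\<gamma> t k) - F t (\<gamma> t0 k) = (\<gamma> t k - \<gamma> t0 k) * partial k f ((z k t)(k := \<xi>))"
          using MVT2[OF 2, of "F t" "\<lambda>s. partial k f ((z k t)(k := s))"] der by (auto simp: abs_le_iff)
        then show ?thesis by (intro exI[of _ \<xi>]) auto
      next
        case 3
        obtain \<xi> where "\<gamma> t k < \<xi>" "\<xi> < \<gamma> t0 k"
          "F t (\<gamma> t0 k) - F t (\<gamma> t k) = (\<gamma> t0 k - \<gamma> t k) * partial k f ((z k t)(k := \<xi>))"
          using MVT2[OF 3, of "F t" "\<lambda>s. partial k f ((z k t)(k := s))"] der by (auto simp: abs_le_iff)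
        then show ?thesis by (intro exI[of _ \<xi>]) (auto simp: algebra_simps)
      qed
    qed
    \<comment> \<open>The mean value point is no further from the old coordinate than the new one
      is. This alone makes the intermediate points \<open>y t\<close> below converge to
      \<open>\<gamma> t0\<close>, where continuity of the partial derivative takes over.\<close>
    then obtain \<xi> where \<xi>: "\<And>t. \<forall>i<n. \<bar>\<gamma> t i - \<gamma> t0 i\<bar> \<le> r \<Longrightarrow> \<bar>\<xi> t - \<gamma> t0 k\<bar> \<le> \<bar>\<gamma> t k - \<gamma> t0 k\<bar>"
      "\<And>t. \<forall>i<n. \<bar>\<gamma> t i - \<gamma> t0 i\<bar> \<le> r \<Longrightarrow>
        F t (\<gamma> t k) - F t (\<gamma> t0 k) = (\<gamma> t k - \<gamma> t0 k) * partial k f ((z k t)(k := \<xi> t))"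
      by metis
    define y where "y t = (z k t)(k := \<xi> t)" for t
    have "((\<lambda>t. \<xi> t - \<gamma> t0 k) \<longlongrightarrow> 0) (at t0)"
    proof (rule Lim_null_comparison)
      show "eventually (\<lambda>t. norm (\<xi> t - \<gamma> t0 k) \<le> \<bar>\<gamma> t k - \<gamma> t0 k\<bar>) (at t0)"
        using near by eventually_elim (use \<xi>(1) in auto)
      show "((\<lambda>t. \<bar>\<gamma> t k - \<gamma> t0 k\<bar>) \<longlongrightarrow> 0) (at t0)"
        using tendsto_rabs[OF tendsto_diff[OF lim[of k] tendsto_const[of "\<gamma> t0 k"]]] by simp
    qed
    from LIM_zero_cancel[OF this] have "(\<xi> \<longlongrightarrow> \<gamma> t0 k) (at t0)" .
    then have "((\<lambda>t. y t i) \<longlongrightarrow> \<gamma> t0 i) (at t0)" for i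
      by (cases "i = k"; cases "i < k") (auto simp: y_def z_def lim)
    then have ylim: "(y \<longlongrightarrow> \<gamma> t0) (at t0)" by (rule tendsto_coordinatewiseI)
    have yU: "eventually (\<lambda>t. y t \<in> U) (at t0)"
      using near
    proof eventually_elim
      case (elim t)
      then show ?case
        using \<xi>(1)[OF elim] k r(1) \<gamma>(1)[of t] \<gamma>(1)[of t0]
        by (intro subsetD[OF r(2)]) (auto simp: closed_box_def y_def z_def mem_coord_space intro: order_trans)
    qed
    have q: "((\<lambda>t. partial k f (y t)) \<longlongrightarrow> partial k f (\<gamma> t0)) (at t0)"
      by (rule continuous_on_tendsto_compose[OF C1_onD(4)[OF f k] ylim \<gamma>(2) yU])
    have "((\<lambda>t. F t (\<gamma> t k) - F t (\<gamma> t0 k)) has_real_derivative partial k f (\<gamma> t0) * d k) (at t0)"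
    proof -
      have "((\<lambda>t. (\<gamma> t k - \<gamma> t0 k) / (t - t0) * partial k f (y t)) \<longlongrightarrow> d k * partial k f (\<gamma> t0)) (at t0)"
        using d[OF k] unfolding has_field_derivative_iff by (intro tendsto_mult q)
      moreover have "eventually (\<lambda>t. (\<gamma> t k - \<gamma> t0 k) / (t - t0) * partial k f (y t) =
          (F t (\<gamma> t k) - F t (\<gamma> t0 k) - (F t0 (\<gamma> t0 k) - F t0 (\<gamma> t0 k))) / (t - t0)) (at t0)"
        using near by eventually_elim (use \<xi>(2) in \<open>simp add: y_def\<close>)
      ultimately show ?thesis
        unfolding has_field_derivative_iff by (simp add: mult.commute[of "partial k f (\<gamma> t0)"] Lim_transform_eventually)
    qed
    from DERIV_add[OF Suc.IH this] k have
      "((\<lambda>t. f (z k t) + (F t (\<gamma> t k) - F t (\<gamma> t0 k))) has_real_derivative (\<Sum>i<Suc k. partial i f (\<gamma> t0) * d i)) (at t0)"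
      by simp
    moreover have "f (z k t) + (F t (\<gamma> t k) - F t (\<gamma> t0 k)) = f (z (Suc k) t)" for t
      unfolding F_def zk(1)[symmetric] zk(2)[symmetric] by simp
    ultimately show ?case by simp
  qed
  from this[of n] have "((\<lambda>t. f (z n t)) has_real_derivative (\<Sum>i<n. partial i f (\<gamma> t0) * d i)) (at t0)" by simp
  moreover have "z n t = \<gamma> t" for t
    using \<gamma>(1)[of t] \<gamma>(1)[of t0] by (auto simp: z_def fun_eq_iff mem_coord_space)
  ultimately show ?thesis by simp
qed

section \<open>Integration along coordinate lines\<close>

abbreviation lebesgue_coords :: "nat \<Rightarrow> (nat \<Rightarrow> real) measure" where
  "lebesgue_coords n \<equiv> lborel_coords {..<n}"

lemma sets_lborel_coords [simp, measurable_cong]: "sets (lborel_coords J) = sets borel"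
  by (simp add: lborel_coords_def)

lemma space_lborel_coords [simp]: "space (lborel_coords J) = UNIV"
  by (simp add: lborel_coords_def)

definition coords_embed :: "nat set \<Rightarrow> (nat \<Rightarrow> real) \<Rightarrow> nat \<Rightarrow> real" where
  "coords_embed J y = (\<lambda>i. if i \<in> J then y i else 0)"

lemma coords_embed_measurable [measurable]:
  "coords_embed J \<in> measurable (Pi\<^sub>M J (\<lambda>_. lborel)) (borel :: (nat \<Rightarrow> real) measure)"
  using measurable_coords_embedding[of J] by (simp add: coords_embed_def[abs_def])

lemma lborel_coords_eq: "lborel_coords J = distr (Pi\<^sub>M J (\<lambda>_. lborel)) borel (coords_embed J)"
  by (simp add: lborel_coords_def coords_embed_def[abs_def])

lemma coords_embed_insert: "coords_embed (insert i J) (y(i := t)) = (coords_embed J y)(i := t)"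
  by (auto simp: coords_embed_def)

interpretation lborel_product: product_sigma_finite "\<lambda>_ :: nat. lborel :: real measure"
  by standard

lemma nn_integral_lborel_coords:
  "f \<in> borel_measurable borel \<Longrightarrow>
    (\<integral>\<^sup>+x. f x \<partial>lborel_coords J) = (\<integral>\<^sup>+y. f (coords_embed J y) \<partial>Pi\<^sub>M J (\<lambda>_. lborel))"
  unfolding lborel_coords_eq by (rule nn_integral_distr) simp_all

lemma measurable_fun_upd_pair [measurable]:
  "(\<lambda>(x, t). x(i := t)) \<in> measurable (borel \<Otimes>\<^sub>M borel) (borel :: ('a :: countable \<Rightarrow> real) measure)"
proof (rule measurable_coordinatewise_then_product)
  fix k
  show "(\<lambda>z. (case z of (x, t) \<Rightarrow> x(i := t)) k) \<in> borel_measurable (borel \<Otimes>\<^sub>M (borel :: real measure))"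
    by (cases "k = i") (auto simp: case_prod_beta intro!: measurable_compose[OF measurable_fst] measurable_product_coordinates)
qed

lemma measurable_fun_upd_line [measurable]:
  "(\<lambda>t. x(i := t)) \<in> measurable borel (borel :: ('a :: countable \<Rightarrow> real) measure)"
  using measurable_compose[OF measurable_Pair[OF measurable_const[of x] measurable_ident_sets[OF refl]] measurable_fun_upd_pair[of i]]
  by simp

lemma nn_integral_line_measurable [measurable]:
  fixes f :: "(nat \<Rightarrow> real) \<Rightarrow> ennreal"
  assumes [measurable]: "f \<in> borel_measurable borel"
  shows "(\<lambda>x. \<integral>\<^sup>+t. f (x(i := t)) \<partial>lborel) \<in> borel_measurable borel"
proof -
  have "(\<lambda>(x, t). f (x(i := t))) \<in> borel_measurable (borel \<Otimes>\<^sub>M lborel)"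
    using measurable_compose[OF measurable_fun_upd_pair[of i] assms]
    by (simp add: case_prod_beta' measurable_lborel2 cong: measurable_cong_sets)
  then show ?thesis by (rule lborel.borel_measurable_nn_integral)
qed

lemma integral_line_measurable [measurable]:
  fixes f :: "(nat \<Rightarrow> real) \<Rightarrow> real"
  assumes [measurable]: "f \<in> borel_measurable borel"
  shows "(\<lambda>x. \<integral>t. f (x(i := t)) \<partial>lborel) \<in> borel_measurable borel"
proof -
  have "(\<lambda>(x, t). f (x(i := t))) \<in> borel_measurable (borel \<Otimes>\<^sub>M lborel)"
    using measurable_compose[OF measurable_fun_upd_pair[of i] assms]
    by (simp add: case_prod_beta' measurable_lborel2 cong: measurable_cong_sets)
  then show ?thesis by (rule lborel.borel_measurable_lebesgue_integral)
qed

section \<open>Fubini in one coordinate\<close>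

lemma nn_integral_coords_insert:
  fixes f :: "(nat \<Rightarrow> real) \<Rightarrow> ennreal"
  assumes J: "finite J" "i \<notin> J" and f [measurable]: "f \<in> borel_measurable borel"
  shows "(\<integral>\<^sup>+x. f x \<partial>lborel_coords (insert i J)) = (\<integral>\<^sup>+x. \<integral>\<^sup>+t. f (x(i := t)) \<partial>lborel \<partial>lborel_coords J)"
proof -
  have "(\<integral>\<^sup>+x. f x \<partial>lborel_coords (insert i J)) = (\<integral>\<^sup>+y. f (coords_embed (insert i J) y) \<partial>Pi\<^sub>M (insert i J) (\<lambda>_. lborel))"
    by (rule nn_integral_lborel_coords) simp
  also have "\<dots> = (\<integral>\<^sup>+y. \<integral>\<^sup>+t. f (coords_embed (insert i J) (y(i := t))) \<partial>lborel \<partial>Pi\<^sub>M J (\<lambda>_. lborel))"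
    by (rule lborel_product.product_nn_integral_insert[OF J]) measurable
  also have "\<dots> = (\<integral>\<^sup>+y. \<integral>\<^sup>+t. f ((coords_embed J y)(i := t)) \<partial>lborel \<partial>Pi\<^sub>M J (\<lambda>_. lborel))"
    by (simp add: coords_embed_insert)
  also have "\<dots> = (\<integral>\<^sup>+x. \<integral>\<^sup>+t. f (x(i := t)) \<partial>lborel \<partial>lborel_coords J)"
    by (rule nn_integral_lborel_coords[symmetric]) measurable
  finally show ?thesis .
qed

lemma integral_coords_insert:
  fixes f :: "(nat \<Rightarrow> real) \<Rightarrow> real"
  assumes J: "finite J" "i \<notin> J" and f: "integrable (lborel_coords (insert i J)) f"
  shows "(\<integral>x. f x \<partial>lborel_coords (insert i J)) = (\<integral>x. \<integral>t. f (x(i := t)) \<partial>lborel \<partial>lborel_coords J)"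
proof -
  have fm [measurable]: "f \<in> borel_measurable borel"
    using borel_measurable_integrable[OF f] by simp
  have int: "integrable (Pi\<^sub>M (insert i J) (\<lambda>_. lborel)) (\<lambda>y. f (coords_embed (insert i J) y))"
    using f unfolding lborel_coords_eq by (subst (asm) integrable_distr_eq) auto
  have "(\<integral>x. f x \<partial>lborel_coords (insert i J)) = (\<integral>y. f (coords_embed (insert i J) y) \<partial>Pi\<^sub>M (insert i J) (\<lambda>_. lborel))"
    unfolding lborel_coords_eq by (rule integral_distr) auto
  also have "\<dots> = (\<integral>y. \<integral>t. f (coords_embed (insert i J) (y(i := t))) \<partial>lborel \<partial>Pi\<^sub>M J (\<lambda>_. lborel))"
    by (rule lborel_product.product_integral_insert[OF J int])
  also have "\<dots> = (\<integral>y. \<integral>t. f ((coords_embed J y)(i := t)) \<partial>lborel \<partial>Pi\<^sub>M J (\<lambda>_. lborel))"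
    by (simp add: coords_embed_insert)
  also have "\<dots> = (\<integral>x. \<integral>t. f (x(i := t)) \<partial>lborel \<partial>lborel_coords J)"
    unfolding lborel_coords_eq by (rule integral_distr[symmetric]) auto
  finally show ?thesis .
qed

text \<open>Identities that hold only on the coordinate subspace may therefore be used under the
  integral, although the measure lives on all of \<open>nat \<Rightarrow> real\<close>.\<close>

lemma AE_lborel_coords_zero: "AE x in lborel_coords J. \<forall>i. i \<notin> J \<longrightarrow> x i = 0"
proof -
  have "{x :: nat \<Rightarrow> real. \<forall>i. i \<notin> J \<longrightarrow> x i = 0} \<in> sets borel"
  proof -
    have "closed {x :: nat \<Rightarrow> real. \<forall>i. i \<notin> J \<longrightarrow> x i = 0}"
      by (intro closed_Collect_all closed_Collect_imp closed_Collect_eq continuous_intros) auto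
    then show ?thesis by (rule borel_closed)
  qed
  then show ?thesis unfolding lborel_coords_eq
    by (subst AE_distr_iff) (auto simp: coords_embed_def)
qed

lemma AE_lborel_coords_mem:
  assumes "J \<subseteq> {..<n}"
  shows "AE x in lborel_coords J. x \<in> coord_space n"
  using AE_lborel_coords_zero[of J] by eventually_elim (use assms in \<open>auto simp: mem_coord_space\<close>)

lemma lessThan_insert_Diff: "i < n \<Longrightarrow> {..<n} = insert i ({..<n :: nat} - {i})"
  by auto

lemma nn_integral_coords_line:
  fixes f :: "(nat \<Rightarrow> real) \<Rightarrow> ennreal"
  assumes i: "i < n" and f: "f \<in> borel_measurable borel"
  shows "(\<integral>\<^sup>+x. f x \<partial>lebesgue_coords n) = (\<integral>\<^sup>+x. \<integral>\<^sup>+t. f (x(i := t)) \<partial>lborel \<partial>lborel_coords ({..<n} - {i}))"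
  by (subst lessThan_insert_Diff[OF i]) (rule nn_integral_coords_insert[OF _ _ f], auto)

lemma integral_coords_line:
  fixes f :: "(nat \<Rightarrow> real) \<Rightarrow> real"
  assumes i: "i < n" and f: "integrable (lebesgue_coords n) f"
  shows "(\<integral>x. f x \<partial>lebesgue_coords n) = (\<integral>x. \<integral>t. f (x(i := t)) \<partial>lborel \<partial>lborel_coords ({..<n} - {i}))"
  by (subst lessThan_insert_Diff[OF i]) (rule integral_coords_insert, use f i in \<open>auto simp: insert_absorb\<close>)

section \<open>Finite measure of boxes and integrability of bounded functions\<close>

lemma coord_box_borel [measurable]: "{x :: nat \<Rightarrow> real. \<forall>i\<in>J. \<bar>x i - c i\<bar> \<le> r} \<in> sets borel"
proof (rule borel_closed)
  have "{x :: nat \<Rightarrow> real. \<forall>i\<in>J. \<bar>x i - c i\<bar> \<le> r} = (\<Inter>i\<in>J. {x. \<bar>x i - c i\<bar> \<le> r})" by auto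
  then show "closed {x :: nat \<Rightarrow> real. \<forall>i\<in>J. \<bar>x i - c i\<bar> \<le> r}"
    by (auto intro!: closed_INT closed_Collect_le continuous_intros)
qed

lemma emeasure_lborel_coords_box:
  assumes J: "finite J"
  shows "emeasure (lborel_coords J) {x. \<forall>i\<in>J. \<bar>x i - c i\<bar> \<le> r} < \<infinity>"
proof -
  have "emeasure (lborel_coords J) {x. \<forall>i\<in>J. \<bar>x i - c i\<bar> \<le> r} =
      emeasure (Pi\<^sub>M J (\<lambda>_. lborel)) (coords_embed J -` {x. \<forall>i\<in>J. \<bar>x i - c i\<bar> \<le> r} \<inter> space (Pi\<^sub>M J (\<lambda>_. lborel)))"
    unfolding lborel_coords_eq by (intro emeasure_distr coord_box_borel) auto
  also have "coords_embed J -` {x. \<forall>i\<in>J. \<bar>x i - c i\<bar> \<le> r} \<inter> space (Pi\<^sub>M J (\<lambda>_. lborel)) = PiE J (\<lambda>i. {c i - r..c i + r})"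
    by (auto simp: coords_embed_def space_PiM PiE_iff abs_le_iff) (smt (verit))+
  also have "emeasure (Pi\<^sub>M J (\<lambda>_. lborel)) (PiE J (\<lambda>i. {c i - r..c i + r})) = (\<Prod>i\<in>J. emeasure lborel {c i - r..c i + r})"
    using J by (intro lborel_product.emeasure_PiM) auto
  also have "\<dots> < \<infinity>"
    using J by (induction J rule: finite_induct) (auto simp: ennreal_mult_less_top less_top[symmetric] ennreal_mult_eq_top_iff emeasure_lborel_Icc_eq)
  finally show ?thesis .
qed

lemma closed_box_borel [measurable]: "closed_box n c r \<in> sets borel"
  using compact_closed_box compact_imp_closed by (intro borel_closed) blast

lemma emeasure_closed_box: "emeasure (lebesgue_coords n) (closed_box n c r) < \<infinity>"
proof -
  have "emeasure (lebesgue_coords n) (closed_box n c r) \<le> emeasure (lebesgue_coords n) {x. \<forall>i\<in>{..<n}. \<bar>x i - c i\<bar> \<le> r}"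
    by (rule emeasure_mono) (auto simp: closed_box_def intro: coord_box_borel[of "{..<n}", simplified])
  also have "\<dots> < \<infinity>" by (rule emeasure_lborel_coords_box) simp
  finally show ?thesis .
qed

lemma set_integrable_bounded:
  fixes f :: "(nat \<Rightarrow> real) \<Rightarrow> real"
  assumes A: "A \<in> sets borel" "A \<subseteq> closed_box n c r" and f: "continuous_on A f" "\<And>x. x \<in> A \<Longrightarrow> \<bar>f x\<bar> \<le> B"
  shows "set_integrable (lebesgue_coords n) A f"
  unfolding set_integrable_def
proof (rule integrableI_bounded_set[where A = A and B = B])
  show "A \<in> sets (lebesgue_coords n)" using A by simp
  show "(\<lambda>x. indicator A x *\<^sub>R f x) \<in> borel_measurable (lebesgue_coords n)"
    using borel_measurable_continuous_on_indicator[OF A(1) f(1)] by simp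
  have "emeasure (lebesgue_coords n) A \<le> emeasure (lebesgue_coords n) (closed_box n c r)"
    using A by (intro emeasure_mono) auto
  then show "emeasure (lebesgue_coords n) A < \<infinity>"
    using emeasure_closed_box[of n c r] by (rule le_less_trans)
qed (use f in \<open>auto split: split_indicator\<close>)

lemma bounded_on_compact:
  fixes f :: "'a :: topological_space \<Rightarrow> real"
  assumes "compact K" "continuous_on K f"
  obtains B where "B \<ge> 0" "\<And>x. x \<in> K \<Longrightarrow> \<bar>f x\<bar> \<le> B"
proof -
  have "bounded (f ` K)" using compact_continuous_image[OF assms(2,1)] compact_imp_bounded by blast
  then obtain B where "\<forall>y\<in>f ` K. norm y \<le> B" by (auto simp: bounded_iff)
  then show ?thesis by (intro that[of "max B 0"]) (auto simp: le_max_iff_disj)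
qed

text \<open>A point of \<open>Z\<close> that is isolated in its line within \<open>Z\<close> has, for some \<open>m\<close>, no other point of \<open>Z\<close> on
  the line within distance \<open>1/(m+1)\<close>. These sets are Borel since projections of compact sets are
  compact, and they meet each line in a countable set.\<close>

lemma AE_islimpt_line:
  assumes Z: "compact Z" and i: "i < n"
  shows "AE x in lebesgue_coords n. x \<in> Z \<longrightarrow> x i islimpt {t. x(i := t) \<in> Z}"
proof -
  \<comment> \<open>The lower bound 1/(l+1) keeps pairs off the diagonal by a closed condition, so
    that \<open>P m l\<close> is compact; the union over l restores the plain condition that the two
    points differ.\<close>
  define P where "P m l = {z \<in> Z \<times> Z. (\<forall>k. k \<noteq> i \<longrightarrow> fst z k = snd z k) \<and>
      1 / real (Suc l) \<le> \<bar>fst z i - snd z i\<bar> \<and> \<bar>fst z i - snd z i\<bar> \<le> 1 / real (Suc m)}" for m l :: nat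
  define bad where "bad m = Z - (\<Union>l. fst ` P m l)" for m
  have "compact (P m l)" for m l
  proof -
    have cont: "continuous_on UNIV (\<lambda>z :: (nat \<Rightarrow> real) \<times> (nat \<Rightarrow> real). fst z k)"
      "continuous_on UNIV (\<lambda>z :: (nat \<Rightarrow> real) \<times> (nat \<Rightarrow> real). snd z k)" for k
      by (rule continuous_on_product_then_coordinatewise; intro continuous_on_fst continuous_on_snd continuous_on_id)+
    have "closed (\<Inter>k\<in>- {i}. {z :: (nat \<Rightarrow> real) \<times> (nat \<Rightarrow> real). fst z k = snd z k})"
      by (intro closed_INT ballI closed_Collect_eq cont)
    moreover have "closed {z :: (nat \<Rightarrow> real) \<times> (nat \<Rightarrow> real). 1 / real (Suc l) \<le> \<bar>fst z i - snd z i\<bar>}"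
      "closed {z :: (nat \<Rightarrow> real) \<times> (nat \<Rightarrow> real). \<bar>fst z i - snd z i\<bar> \<le> 1 / real (Suc m)}"
      by (intro closed_Collect_le continuous_on_rabs continuous_on_diff continuous_on_const cont)+
    ultimately have "closed ((\<Inter>k\<in>- {i}. {z :: (nat \<Rightarrow> real) \<times> (nat \<Rightarrow> real). fst z k = snd z k}) \<inter>
        {z. 1 / real (Suc l) \<le> \<bar>fst z i - snd z i\<bar>} \<inter> {z. \<bar>fst z i - snd z i\<bar> \<le> 1 / real (Suc m)})"
      by (intro closed_Int)
    moreover have "(\<Inter>k\<in>- {i}. {z :: (nat \<Rightarrow> real) \<times> (nat \<Rightarrow> real). fst z k = snd z k}) \<inter>
        {z. 1 / real (Suc l) \<le> \<bar>fst z i - snd z i\<bar>} \<inter> {z. \<bar>fst z i - snd z i\<bar> \<le> 1 / real (Suc m)} =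
      {z. (\<forall>k. k \<noteq> i \<longrightarrow> fst z k = snd z k) \<and>
      1 / real (Suc l) \<le> \<bar>fst z i - snd z i\<bar> \<and> \<bar>fst z i - snd z i\<bar> \<le> 1 / real (Suc m)}"
      by auto
    ultimately have cl: "closed {z :: (nat \<Rightarrow> real) \<times> (nat \<Rightarrow> real). (\<forall>k. k \<noteq> i \<longrightarrow> fst z k = snd z k) \<and>
      1 / real (Suc l) \<le> \<bar>fst z i - snd z i\<bar> \<and> \<bar>fst z i - snd z i\<bar> \<le> 1 / real (Suc m)}"
      by simp
    have "P m l = (Z \<times> Z) \<inter> {z. (\<forall>k. k \<noteq> i \<longrightarrow> fst z k = snd z k) \<and>
      1 / real (Suc l) \<le> \<bar>fst z i - snd z i\<bar> \<and> \<bar>fst z i - snd z i\<bar> \<le> 1 / real (Suc m)}"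
      by (auto simp: P_def)
    then show ?thesis using compact_Int_closed[OF compact_Times[OF Z Z] cl] by simp
  qed
  then have "compact (fst ` P m l)" for m l
    by (rule compact_continuous_image[OF continuous_on_fst[OF continuous_on_id]])
  then have bad_borel [measurable]: "bad m \<in> sets borel" for m
    unfolding bad_def using Z by (intro sets.Diff sets.countable_UN) (auto intro!: borel_closed compact_imp_closed)
  have bad: "\<bar>s - t\<bar> > 1 / real (Suc m)" if st: "x(i := s) \<in> bad m" "x(i := t) \<in> bad m" "s \<noteq> t" for x s t m
  proof (rule ccontr)
    assume *: "\<not> ?thesis"
    obtain l where l: "1 / real (Suc l) < \<bar>s - t\<bar>"
      using reals_Archimedean[of "\<bar>s - t\<bar>"] st(3) by (auto simp: inverse_eq_divide)
    have "(x(i := s), x(i := t)) \<in> P m l"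
      using st * l by (auto simp: P_def bad_def)
    then have "x(i := s) \<in> fst ` P m l" by force
    then show False using st(1) by (auto simp: bad_def)
  qed
  have null: "emeasure (lebesgue_coords n) (bad m) = 0" for m
  proof -
    have "countable {t. x(i := t) \<in> bad m}" for x
    proof (rule countable_image_inj_on)
      \<comment> \<open>Two bad points of a line are more than 1/(m+1) apart, so that rounding t
        (m+1) down separates them and the slice embeds into the integers.\<close>
      show "inj_on (\<lambda>t. \<lfloor>t * real (Suc m)\<rfloor>) {t. x(i := t) \<in> bad m}"
      proof (rule inj_onI, rule ccontr)
        fix s t assume st: "s \<in> {t. x(i := t) \<in> bad m}" "t \<in> {t. x(i := t) \<in> bad m}"
          "\<lfloor>s * real (Suc m)\<rfloor> = \<lfloor>t * real (Suc m)\<rfloor>" "s \<noteq> t"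
        then have "\<bar>s * real (Suc m) - t * real (Suc m)\<bar> < 1" by linarith
        then have "\<bar>s - t\<bar> * real (Suc m) < 1" by (simp add: left_diff_distrib[symmetric] abs_mult del: of_nat_Suc)
        then have "\<bar>s - t\<bar> < 1 / real (Suc m)" by (simp add: field_simps del: of_nat_Suc)
        with bad[of x s m t] st show False by auto
      qed
    qed (rule countableI_type)
    then have "emeasure lborel {t. x(i := t) \<in> bad m} = 0" for x by (rule emeasure_lborel_countable)
    moreover have "(\<integral>\<^sup>+t. indicator (bad m) (x(i := t)) \<partial>lborel) = emeasure lborel {t. x(i := t) \<in> bad m}" for x
    proof -
      have "{t. x(i := t) \<in> bad m} \<in> sets lborel"
        using measurable_sets[OF measurable_fun_upd_line[of x i] bad_borel[of m]] by (simp add: vimage_def)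
      then have "(\<integral>\<^sup>+t. indicator {t. x(i := t) \<in> bad m} t \<partial>lborel) = emeasure lborel {t. x(i := t) \<in> bad m}"
        by simp
      then show ?thesis by (simp add: indicator_def of_bool_def)
    qed
    ultimately have "(\<integral>\<^sup>+x. indicator (bad m) x \<partial>lebesgue_coords n) = 0"
      by (subst nn_integral_coords_line[OF i]) auto
    then show ?thesis by simp
  qed
  have "AE x in lebesgue_coords n. \<forall>m. x \<notin> bad m"
    unfolding AE_all_countable using null by (auto intro!: AE_not_in null_setsI)
  then show ?thesis
  proof eventually_elim
    case (elim x)
    show ?case
    proof
      assume x: "x \<in> Z"
      show "x i islimpt {t. x(i := t) \<in> Z}"
        unfolding islimpt_approachable
      proof (intro allI impI)
        fix e :: real assume "e > 0"
        then obtain m where m: "1 / real (Suc m) < e" using reals_Archimedean by (auto simp: inverse_eq_divide)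
        have "x \<in> (\<Union>l. fst ` P m l)" using elim x by (auto simp: bad_def)
        then obtain l y where y: "(x, y) \<in> P m l" by auto
        have "x(i := y i) = y"
        proof
          fix k
          show "(x(i := y i)) k = y k" using y by (cases "k = i") (simp_all add: P_def)
        qed
        moreover have "y \<in> Z" "0 < 1 / real (Suc l)" "1 / real (Suc l) \<le> \<bar>x i - y i\<bar>" "\<bar>x i - y i\<bar> \<le> 1 / real (Suc m)"
          using y by (simp_all add: P_def)
        moreover from this m have "y i \<noteq> x i" "dist (y i) (x i) < e"
          unfolding dist_real_def by linarith+
        ultimately show "\<exists>t\<in>{t. x(i := t) \<in> Z}. t \<noteq> x i \<and> dist t (x i) < e"
          by (intro bexI[of _ "y i"]) auto
      qed
    qed
  qed
qed

text \<open>The derivative can be computed along S, where every difference quotient is 0.\<close>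

lemma DERIV_zero_if_islimpt:
  fixes f :: "real \<Rightarrow> real"
  assumes d: "(f has_real_derivative d) (at x)" and S: "x islimpt S" "\<And>t. t \<in> S \<Longrightarrow> f t = 0" and x: "f x = 0"
  shows "d = 0"
proof -
  have "((\<lambda>y. (f y - f x) / (y - x)) \<longlongrightarrow> d) (at x within S)"
    using has_field_derivative_at_within[OF d, of S] by (simp add: has_field_derivative_iff)
  moreover have "((\<lambda>y. (f y - f x) / (y - x)) \<longlongrightarrow> 0) (at x within S)"
    by (rule tendsto_eventually) (use S(2) x in \<open>auto simp: eventually_at_filter\<close>)
  moreover have "at x within S \<noteq> bot" using S(1) by (simp add: trivial_limit_within)
  ultimately show ?thesis by (rule tendsto_unique[rotated])
qed

section \<open>The divergence theorem in a boundary chart\<close>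

lemma continuous_on_coord: "continuous_on A (\<lambda>x :: nat \<Rightarrow> real. x k)"
  by (rule continuous_on_subset[OF continuous_on_product_coordinates subset_UNIV])

lemma DERIV_zero_if_eventually_zero:
  fixes f :: "real \<Rightarrow> real"
  assumes "(f has_real_derivative d) (at t)" "eventually (\<lambda>u. f u = 0) (nhds t)"
  shows "d = 0"
proof -
  have "((\<lambda>_. 0) has_real_derivative d) (at t)"
    using assms(1) DERIV_cong_ev[OF refl assms(2) refl] by simp
  then show ?thesis using DERIV_unique DERIV_const by blast
qed

text \<open>The half line is cut at a point b beyond the support, to the right of a for s = 1 and to
  the left for s = -1. Only the value at a survives, as the lower or the upper end point
  respectively; hence the sign - s.\<close>

lemma integral_halfline_deriv:
  fixes f :: "real \<Rightarrow> real"
  assumes d: "\<And>t. (f has_real_derivative f' t) (at t)" and cont: "continuous_on UNIV f'"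
    and zero: "\<And>t. \<bar>t - c\<bar> > r \<Longrightarrow> f t = 0" and s: "s \<in> {-1, 1 :: real}"
  shows "(\<integral>t. indicator {t. s * (t - a) > 0} t * f' t \<partial>lborel) = - s * f a"
proof -
  have zero': "f' t = 0" if "\<bar>t - c\<bar> > r" for t
  proof -
    have "eventually (\<lambda>u. \<bar>u - c\<bar> > r) (nhds t)"
    proof -
      have "open {u :: real. r < \<bar>u - c\<bar>}" by (intro open_Collect_less continuous_intros)
      from eventually_nhds_in_open[OF this, of t] that show ?thesis by simp
    qed
    then have "eventually (\<lambda>u. f u = 0) (nhds t)" by eventually_elim (rule zero)
    then show ?thesis by (rule DERIV_zero_if_eventually_zero[OF d])
  qed
  define b where "b = (if s = 1 then max a (c + \<bar>r\<bar>) + 1 else min a (c - \<bar>r\<bar>) - 1)"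
  define l u where "l = min a b" and "u = max a b"
  have lu: "l \<le> u" by (simp add: l_def u_def)
  \<comment> \<open>The half line excludes a while the closed interval contains it, so the two
    integrands agree only off a single point.\<close>
  have "AE t in lborel. indicator {t. s * (t - a) > 0} t * f' t = indicator {l..u} t *\<^sub>R f' t"
    using AE_lborel_singleton[of a]
  proof eventually_elim
    case (elim t)
    show ?case
    proof (cases "s = 1")
      case True
      then have "l = a" "u = b" "c + \<bar>r\<bar> < b" by (simp_all add: l_def u_def b_def)
      moreover from this have "f' t = 0" if "b < t" using that by (intro zero') linarith
      ultimately show ?thesis using True elim by (auto simp: indicator_def not_le)
    next
      case False
      with s have "s = -1" by simp
      then have "l = b" "u = a" "b < c - \<bar>r\<bar>" by (simp_all add: l_def u_def b_def)
      moreover from this have "f' t = 0" if "t < b" using that by (intro zero') linarith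
      ultimately show ?thesis using \<open>s = -1\<close> elim by (auto simp: indicator_def not_le)
    qed
  qed
  moreover have [measurable]: "f' \<in> borel_measurable borel" using cont by (rule borel_measurable_continuous_onI)
  ultimately have "(\<integral>t. indicator {t. s * (t - a) > 0} t * f' t \<partial>lborel) = (\<integral>t. indicator {l..u} t *\<^sub>R f' t \<partial>lborel)"
    by (intro integral_cong_AE) auto
  also have "\<dots> = f u - f l"
  proof (rule integral_FTC_Icc[OF lu])
    show "continuous_on {l..u} f'" using cont by (rule continuous_on_subset) simp
    show "(f has_vector_derivative f' t) (at t within {l..u})" for t
      using has_field_derivative_at_within[OF d] by (simp add: has_real_derivative_iff_has_vector_derivative)
  qed
  also have "\<dots> = - s * f a"
  proof -
    have "f b = 0" by (rule zero) (auto simp: b_def)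
    then show ?thesis using s by (auto simp: l_def u_def b_def)
  qed
  finally show ?thesis .
qed

lemma integral_line_deriv:
  fixes f :: "real \<Rightarrow> real"
  assumes d: "\<And>t. (f has_real_derivative f' t) (at t)" and cont: "continuous_on UNIV f'"
    and zero: "\<And>t. \<bar>t - c\<bar> > r \<Longrightarrow> f t = 0"
  shows "(\<integral>t. f' t \<partial>lborel) = 0"
proof -
  define a where "a = c - \<bar>r\<bar> - 1"
  have "f' t = 0" if "t \<le> a" for t
  proof -
    have "eventually (\<lambda>u. u < a + 1) (nhds t)"
      using that eventually_nhds_in_open[of "{..<a + 1}" t] by simp
    then have "eventually (\<lambda>u. f u = 0) (nhds t)"
      by eventually_elim (rule zero, auto simp: a_def)
    then show ?thesis by (rule DERIV_zero_if_eventually_zero[OF d])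
  qed
  then have "f' t = indicator {t. 1 * (t - a) > 0} t * f' t" for t
    by (cases "t \<le> a") auto
  then have "(\<integral>t. f' t \<partial>lborel) = (\<integral>t. indicator {t. 1 * (t - a) > 0} t * f' t \<partial>lborel)"
    by presburger
  also have "\<dots> = - 1 * f a"
    by (rule integral_halfline_deriv[OF d cont zero]) auto
  also have "f a = 0" by (rule zero) (auto simp: a_def)
  finally show ?thesis by simp
qed

section \<open>Functions of class C^1 supported in a box\<close>

definition C1_box :: "nat \<Rightarrow> (nat \<Rightarrow> real) \<Rightarrow> real \<Rightarrow> ((nat \<Rightarrow> real) \<Rightarrow> real) \<Rightarrow> bool" where
  "C1_box n c r f \<longleftrightarrow> C1_on n (coord_space n) f \<and> (\<forall>x\<in>coord_space n - closed_box n c r. f x = 0)"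

lemma C1_boxD:
  assumes "C1_box n c r f"
  shows "C1_on n (coord_space n) f" "x \<in> coord_space n \<Longrightarrow> x \<notin> closed_box n c r \<Longrightarrow> f x = 0"
  using assms by (auto simp: C1_box_def)

lemma C1_box_partial_zero:
  assumes f: "C1_box n c r f" and i: "i < n" and x: "x \<in> coord_space n" "x \<notin> closed_box n c r"
  shows "partial i f x = 0"
proof -
  have "partial i f x = partial i (\<lambda>_. 0) x"
    using x i C1_boxD(2)[OF f] by (intro partial_cong_open[OF openin_compl_closed_box[of n c r]]) auto
  also have "\<dots> = 0" by (rule partial_eqI) simp
  finally show ?thesis .
qed

lemma set_integrable_box_support:
  fixes f :: "(nat \<Rightarrow> real) \<Rightarrow> real"
  assumes A: "A \<in> sets borel" "A \<subseteq> coord_space n" and f: "continuous_on (coord_space n) f"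
    and zero: "\<And>x. x \<in> coord_space n \<Longrightarrow> x \<notin> closed_box n c r \<Longrightarrow> f x = 0"
  shows "set_integrable (lebesgue_coords n) A f"
proof -
  obtain B where B: "\<And>x. x \<in> closed_box n c r \<Longrightarrow> \<bar>f x\<bar> \<le> B"
    using bounded_on_compact[OF compact_closed_box continuous_on_subset[OF f closed_box_subset]] by blast
  have "set_integrable (lebesgue_coords n) (A \<inter> closed_box n c r) f"
    using A B by (intro set_integrable_bounded continuous_on_subset[OF f]) (auto simp: closed_box_borel)
  moreover have "indicator (A \<inter> closed_box n c r) x *\<^sub>R f x = indicator A x *\<^sub>R f x" for x
    using A(2) zero[of x] by (auto split: split_indicator)
  ultimately show ?thesis unfolding set_integrable_def by (simp only:)
qed

lemma continuous_on_line:
  assumes "continuous_on (coord_space n) f" "x \<in> coord_space n" "i < n"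
  shows "continuous_on UNIV (\<lambda>t. f (x(i := t)))"
proof (rule continuous_on_compose2[OF assms(1)])
  show "continuous_on UNIV (\<lambda>t. x(i := t))"
  proof (rule continuous_on_coordinatewise_then_product)
    show "continuous_on UNIV (\<lambda>t. (x(i := t)) k)" for k by (cases "k = i") auto
  qed
qed (use assms in auto)

lemma C1_box_line:
  assumes f: "C1_box n c r f" and x: "x \<in> coord_space n" and i: "i < n"
  shows "((\<lambda>t. f (x(i := t))) has_real_derivative partial i f (x(i := t))) (at t)"
    "continuous_on UNIV (\<lambda>t. partial i f (x(i := t)))"
    "\<bar>t - c i\<bar> > r \<Longrightarrow> f (x(i := t)) = 0"
proof -
  show "((\<lambda>t. f (x(i := t))) has_real_derivative partial i f (x(i := t))) (at t)"
    using C1_onD(3)[OF C1_boxD(1)[OF f] i fun_upd_coord_space[OF x i]] by simp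
  show "continuous_on UNIV (\<lambda>t. partial i f (x(i := t)))"
    by (rule continuous_on_line[OF C1_onD(4)[OF C1_boxD(1)[OF f] i] x i])
  show "f (x(i := t)) = 0" if "\<bar>t - c i\<bar> > r"
    using that i x by (intro C1_boxD(2)[OF f]) (auto simp: closed_box_def)
qed

text \<open>Each line in direction j lies entirely inside or outside of P, so Fubini reduces the
  claim to the integral of a derivative over a full line. The sets of interest are the half space
  orthogonal to another axis and the whole coordinate subspace.\<close>

lemma integral_partial_invariant_set:
  assumes f: "C1_box n c r f" and j: "j < n" and P: "P \<in> sets borel" "P \<subseteq> coord_space n"
    and inv: "\<And>x t. x \<in> coord_space n \<Longrightarrow> x(j := t) \<in> P \<longleftrightarrow> x \<in> P"
  shows "(LINT x:P|lebesgue_coords n. partial j f x) = 0"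
proof -
  have int: "integrable (lebesgue_coords n) (\<lambda>x. indicator P x *\<^sub>R partial j f x)"
    using set_integrable_box_support[OF P C1_onD(4)[OF C1_boxD(1)[OF f] j] C1_box_partial_zero[OF f j]]
    by (simp add: set_integrable_def)
  have "(LINT x:P|lebesgue_coords n. partial j f x) =
      (\<integral>x. \<integral>t. indicator P (x(j := t)) *\<^sub>R partial j f (x(j := t)) \<partial>lborel \<partial>lborel_coords ({..<n} - {j}))"
    unfolding set_lebesgue_integral_def by (rule integral_coords_line[OF j int])
  also have "\<dots> = 0"
  proof (rule integral_eq_zero_AE)
    show "AE x in lborel_coords ({..<n} - {j}). (\<integral>t. indicator P (x(j := t)) *\<^sub>R partial j f (x(j := t)) \<partial>lborel) = 0"
      using AE_lborel_coords_mem[of "{..<n} - {j}" n, OF Diff_subset]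
    proof eventually_elim
      case (elim x)
      have "(\<integral>t. indicator P (x(j := t)) *\<^sub>R partial j f (x(j := t)) \<partial>lborel) =
          indicator P x * (\<integral>t. partial j f (x(j := t)) \<partial>lborel)"
        by (simp add: indicator_def inv[OF elim])
      also have "(\<integral>t. partial j f (x(j := t)) \<partial>lborel) = 0"
        by (rule integral_line_deriv[OF C1_box_line[OF f elim j]])
      finally show ?case by (simp only: mult_zero_right)
    qed
  qed
  finally show ?thesis .
qed

text \<open>The formula \<open>h\<close> for the inner integral is trusted only on the coordinate
  subspace. Cut off there, it coincides with a line integral, and this gives its
  measurability.\<close>

lemma integral_coords_lineI:
  fixes f :: "(nat \<Rightarrow> real) \<Rightarrow> real"
  assumes i: "i < n" and f: "integrable (lebesgue_coords n) f"
    and h: "\<And>x. x \<in> coord_space n \<Longrightarrow> (\<integral>t. f (x(i := t)) \<partial>lborel) = h x"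
  shows "(\<integral>x. f x \<partial>lebesgue_coords n) = (LINT x:coord_space n|lborel_coords ({..<n} - {i}). h x)"
proof -
  have [measurable]: "f \<in> borel_measurable borel" using borel_measurable_integrable[OF f] by simp
  have [measurable]: "coord_space n \<in> sets borel" using closed_coord_space by (rule borel_closed)
  have "(\<lambda>x. indicator (coord_space n) x *\<^sub>R h x) = (\<lambda>x. indicator (coord_space n) x *\<^sub>R (\<integral>t. f (x(i := t)) \<partial>lborel))"
    using h by (auto simp: fun_eq_iff split: split_indicator)
  also have "\<dots> \<in> borel_measurable (lborel_coords ({..<n} - {i}))" by measurable
  finally have m: "(\<lambda>x. indicator (coord_space n) x *\<^sub>R h x) \<in> borel_measurable (lborel_coords ({..<n} - {i}))" .
  show ?thesis
    unfolding integral_coords_line[OF i f] set_lebesgue_integral_def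
  proof (rule integral_cong_AE[OF _ m])
    show "(\<lambda>x. \<integral>t. f (x(i := t)) \<partial>lborel) \<in> borel_measurable (lborel_coords ({..<n} - {i}))" by measurable
    show "AE x in lborel_coords ({..<n} - {i}). (\<integral>t. f (x(i := t)) \<partial>lborel) = indicator (coord_space n) x *\<^sub>R h x"
      using AE_lborel_coords_mem[of "{..<n} - {i}" n, OF Diff_subset]
      by eventually_elim (simp add: h)
  qed
qed

lemma partial_invariant_coord:
  assumes "\<And>x t. x \<in> coord_space n \<Longrightarrow> g (x(i := t)) = g x" "x \<in> coord_space n" "j < n"
  shows "partial j g (x(i := t)) = (if j = i then 0 else partial j g x)"
proof (cases "j = i")
  case True
  have "partial i g (x(i := t)) = 0"
    by (rule partial_eqI) (use assms in simp)
  with True show ?thesis by simp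
next
  case False
  then have "g ((x(i := t))(j := u)) = g (x(j := u))" for u
    using assms(1)[OF fun_upd_coord_space[OF assms(2,3)], of u t] by (simp add: fun_upd_twist)
  then show ?thesis using False by (simp add: partial_def)
qed

section \<open>Domains on one side of a graph\<close>

locale graph_domain =
  fixes n i :: nat and s :: real and g :: "(nat \<Rightarrow> real) \<Rightarrow> real"
  assumes i: "i < n" and s: "s \<in> {-1, 1}" and g: "C1_on n (coord_space n) g"
    and g_inv: "\<And>x t. x \<in> coord_space n \<Longrightarrow> g (x(i := t)) = g x"
begin

definition D :: "(nat \<Rightarrow> real) set" where "D = {x \<in> coord_space n. s * (x i - g x) > 0}"

lemma g_partial_inv: "x \<in> coord_space n \<Longrightarrow> j < n \<Longrightarrow> partial j g (x(i := t)) = partial j g x"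
  using partial_invariant_coord[OF g_inv] by (metis fun_upd_triv)

lemma g_partial_i: "x \<in> coord_space n \<Longrightarrow> partial i g x = 0"
  using partial_invariant_coord[OF g_inv _ i] by (metis fun_upd_triv)

lemma D_borel [measurable]: "D \<in> sets borel"
proof -
  have "openin (top_of_set (coord_space n)) (coord_space n \<inter> (\<lambda>x. s * (x i - g x)) -` {0<..})"
    by (intro continuous_openin_preimage_gen continuous_on_mult continuous_on_diff continuous_on_const
        continuous_on_coord C1_onD(2)[OF g] open_greaterThan)
  also have "coord_space n \<inter> (\<lambda>x. s * (x i - g x)) -` {0<..} = D" by (auto simp: D_def)
  finally have "openin (Euclidean_space n) D" by (simp only: Euclidean_space_eq[symmetric])
  then show ?thesis by (rule openin_coord_space_borel)
qed

lemma half_space_borel: "{x \<in> coord_space n. s * x i > 0} \<in> sets borel"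
proof -
  have "{x \<in> coord_space n. s * x i > 0} = coord_space n \<inter> {x. 0 < s * x i}" by auto
  moreover have "open {x :: nat \<Rightarrow> real. 0 < s * x i}"
    by (intro open_Collect_less continuous_on_mult continuous_on_const continuous_on_coord)
  ultimately show ?thesis using closed_coord_space[of n] by auto
qed

text \<open>Lines in direction i meet \<open>D\<close> in a half line that ends on the graph. The
  extra factor \<open>h\<close>, constant along these lines, is there to admit the weight
  \<open>partial k g\<close> that the shear produces.\<close>

lemma integral_line_D:
  assumes f: "C1_box n c r f" and h: "continuous_on (coord_space n) h"
    and h_inv: "\<And>x t. x \<in> coord_space n \<Longrightarrow> h (x(i := t)) = h x"
  shows "(LINT x:D|lebesgue_coords n. h x * partial i f x) =
    (LINT y:coord_space n|lborel_coords ({..<n} - {i}). - s * h y * f (y(i := g y)))"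
proof -
  have int: "integrable (lebesgue_coords n) (\<lambda>x. indicator D x *\<^sub>R (h x * partial i f x))"
  proof -
    have "set_integrable (lebesgue_coords n) D (\<lambda>x. h x * partial i f x)"
    proof (rule set_integrable_box_support)
      show "continuous_on (coord_space n) (\<lambda>x. h x * partial i f x)"
        by (intro continuous_intros h C1_onD(4)[OF C1_boxD(1)[OF f] i])
    qed (use C1_box_partial_zero[OF f i] in \<open>auto simp: D_def[symmetric] D_borel\<close>, auto simp: D_def)
    then show ?thesis by (simp add: set_integrable_def)
  qed
  show ?thesis
    unfolding set_lebesgue_integral_def
  proof (subst integral_coords_lineI[OF i int])
    fix x assume x: "x \<in> coord_space n"
    have "indicator D (x(i := t)) *\<^sub>R (h (x(i := t)) * partial i f (x(i := t))) =
        h x * (indicator {t. s * (t - g x) > 0} t * partial i f (x(i := t)))" for t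
      using x i by (simp add: D_def h_inv g_inv indicator_def)
    then have "(\<integral>t. indicator D (x(i := t)) *\<^sub>R (h (x(i := t)) * partial i f (x(i := t))) \<partial>lborel) =
        h x * (\<integral>t. indicator {t. s * (t - g x) > 0} t * partial i f (x(i := t)) \<partial>lborel)"
      by (simp only: integral_mult_right_zero)
    also have "\<dots> = h x * (- s * f (x(i := g x)))"
      by (subst integral_halfline_deriv[OF C1_box_line[OF f x i] s]) auto
    finally show "(\<integral>t. indicator D (x(i := t)) *\<^sub>R (h (x(i := t)) * partial i f (x(i := t))) \<partial>lborel) =
        - s * h x * f (x(i := g x))" by simp
  qed (simp add: set_lebesgue_integral_def)
qed

text \<open>The shear maps a half space onto \<open>D\<close> and preserves the measure.\<close>

definition shear :: "(nat \<Rightarrow> real) \<Rightarrow> nat \<Rightarrow> real" where "shear x = x(i := x i + g x)"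

lemma shear_mem: "x \<in> coord_space n \<Longrightarrow> shear x \<in> coord_space n"
  using i by (simp add: shear_def)

lemma continuous_on_shear: "continuous_on (coord_space n) shear"
  unfolding shear_def
proof (rule continuous_on_coordinatewise_then_product)
  show "continuous_on (coord_space n) (\<lambda>x. (x(i := x i + g x)) k)" for k
    using continuous_on_add[OF continuous_on_coord[of _ i] C1_onD(2)[OF g]] continuous_on_coord[of _ k]
    by (cases "k = i") simp_all
qed

text \<open>As \<open>g\<close> does not depend on coordinate i, it takes the same value at x and at
  \<open>shear x\<close>. If the latter lies in the box, x has therefore been moved by no more than
  the bound of \<open>g\<close> on that box.\<close>

lemma shear_support:
  obtains R where "\<And>x. x \<in> coord_space n \<Longrightarrow> x \<notin> closed_box n c R \<Longrightarrow> shear x \<notin> closed_box n c r"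
proof -
  obtain B where B: "\<And>x. x \<in> closed_box n c r \<Longrightarrow> \<bar>g x\<bar> \<le> B" "B \<ge> 0"
    using bounded_on_compact[OF compact_closed_box continuous_on_subset[OF C1_onD(2)[OF g] closed_box_subset]] by blast
  show ?thesis
  proof (rule that[of "r + B"], rule notI)
    fix x assume x: "x \<in> coord_space n" "x \<notin> closed_box n c (r + B)" and sh: "shear x \<in> closed_box n c r"
    have "\<bar>g x\<bar> \<le> B"
      using B(1)[OF sh] x(1) by (simp add: shear_def g_inv)
    moreover have "\<bar>shear x k - c k\<bar> \<le> r" if "k < n" for k
      using sh that by (auto simp: closed_box_def)
    ultimately have "\<bar>x k - c k\<bar> \<le> r + B" if "k < n" for k
      using that B(2) by (cases "k = i") (force simp: shear_def)+
    with x show False by (auto simp: closed_box_def)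
  qed
qed

text \<open>On each line in direction i the shear is a translation by \<open>g x\<close>. By
  translation invariance both integrals reduce to the same integral \<open>I\<close> over the
  hyperplane; the factor \<open>h\<close> is constant on these lines and stays outside.\<close>

lemma integral_shear:
  fixes \<phi> h :: "(nat \<Rightarrow> real) \<Rightarrow> real"
  assumes \<phi>: "continuous_on (coord_space n) \<phi>" "\<And>x. x \<in> coord_space n \<Longrightarrow> x \<notin> closed_box n c r \<Longrightarrow> \<phi> x = 0"
    and h: "continuous_on (coord_space n) h" and h_inv: "\<And>x t. x \<in> coord_space n \<Longrightarrow> h (x(i := t)) = h x"
  shows "set_integrable (lebesgue_coords n) {x \<in> coord_space n. s * x i > 0} (\<lambda>x. h x * \<phi> (shear x))"
    "set_integrable (lebesgue_coords n) D (\<lambda>x. h x * \<phi> x)"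
    "(LINT x:{x \<in> coord_space n. s * x i > 0}|lebesgue_coords n. h x * \<phi> (shear x)) =
     (LINT x:D|lebesgue_coords n. h x * \<phi> x)"
proof -
  let ?P = "{x \<in> coord_space n. s * x i > 0}"
  note P = half_space_borel
  have D: "D \<subseteq> coord_space n" by (auto simp: D_def)
  obtain R where R: "\<And>x. x \<in> coord_space n \<Longrightarrow> x \<notin> closed_box n c R \<Longrightarrow> shear x \<notin> closed_box n c r"
    using shear_support by blast
  show intP: "set_integrable (lebesgue_coords n) ?P (\<lambda>x. h x * \<phi> (shear x))"
  proof (rule set_integrable_box_support)
    show "?P \<in> sets borel" by (rule P)
    have "continuous_on (coord_space n) (\<lambda>x. \<phi> (shear x))"
      by (rule continuous_on_compose2[OF \<phi>(1) continuous_on_shear]) (auto simp: shear_mem)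
    then show "continuous_on (coord_space n) (\<lambda>x. h x * \<phi> (shear x))" using h by (intro continuous_intros)
    show "h x * \<phi> (shear x) = 0" if "x \<in> coord_space n" "x \<notin> closed_box n c R" for x
      using \<phi>(2)[OF shear_mem R] that by simp
  qed auto
  show intD: "set_integrable (lebesgue_coords n) D (\<lambda>x. h x * \<phi> x)"
    by (rule set_integrable_box_support[OF D_borel D continuous_on_mult[OF h \<phi>(1)]]) (use \<phi>(2) in auto)
  define I where "I x = h x * (\<integral>t. indicator {t. s * (t - g x) > 0} t * \<phi> (x(i := t)) \<partial>lborel)" for x
  have "(LINT x:D|lebesgue_coords n. h x * \<phi> x) = (LINT x:coord_space n|lborel_coords ({..<n} - {i}). I x)"
    unfolding set_lebesgue_integral_def[of _ D]
  proof (rule integral_coords_lineI[OF i intD[unfolded set_integrable_def]])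
    fix x assume x: "x \<in> coord_space n"
    have "indicator D (x(i := t)) *\<^sub>R (h (x(i := t)) * \<phi> (x(i := t))) =
        h x * (indicator {t. s * (t - g x) > 0} t * \<phi> (x(i := t)))" for t
      using x i by (simp add: D_def h_inv g_inv indicator_def)
    then show "(\<integral>t. indicator D (x(i := t)) *\<^sub>R (h (x(i := t)) * \<phi> (x(i := t))) \<partial>lborel) = I x"
      by (simp only: I_def integral_mult_right_zero)
  qed
  moreover have "(LINT x:?P|lebesgue_coords n. h x * \<phi> (shear x)) = (LINT x:coord_space n|lborel_coords ({..<n} - {i}). I x)"
    unfolding set_lebesgue_integral_def[of _ ?P]
  proof (rule integral_coords_lineI[OF i intP[unfolded set_integrable_def]])
    fix x assume x: "x \<in> coord_space n"
    \<comment> \<open>The redundant factor 1 brings the integrand into the form required by the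
      affine substitution t to g x + 1 t.\<close>
    have "indicator ?P (x(i := t)) *\<^sub>R (h (x(i := t)) * \<phi> (shear (x(i := t)))) =
        h x * (indicator {t. s * (t - g x) > 0} (g x + 1 * t) * \<phi> (x(i := g x + 1 * t)))" for t
      using x i by (simp add: shear_def h_inv g_inv indicator_def add.commute)
    then show "(\<integral>t. indicator ?P (x(i := t)) *\<^sub>R (h (x(i := t)) * \<phi> (shear (x(i := t)))) \<partial>lborel) = I x"
      unfolding I_def
      by (subst lborel_integral_real_affine[of 1 _ "g x"]) (simp_all only: integral_mult_right_zero abs_one scaleR_one one_neq_zero not_False_eq_True)
  qed
  ultimately show "(LINT x:?P|lebesgue_coords n. h x * \<phi> (shear x)) = (LINT x:D|lebesgue_coords n. h x * \<phi> x)"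
    by simp
qed

lemma partial_shear:
  assumes f: "C1_on n (coord_space n) f" and k: "k < n" and x: "x \<in> coord_space n"
  shows "((\<lambda>t. f (shear (x(k := t)))) has_real_derivative
    partial k f (shear x) + partial i f (shear x) * partial k g x) (at (x k))"
proof -
  \<comment> \<open>The column of the Jacobian of the shear that belongs to coordinate k.\<close>
  define d where "d l = (if l = k then 1 else 0) + (if l = i then partial k g x else 0)" for l
  have "((\<lambda>t. f (shear (x(k := t)))) has_real_derivative (\<Sum>l<n. partial l f (shear (x(k := x k))) * d l)) (at (x k))"
  proof (rule C1_on_chain_rule[OF f])
    show "shear (x(k := t)) \<in> coord_space n" for t by (intro shear_mem fun_upd_coord_space x k)
    show "shear (x(k := x k)) \<in> coord_space n" by (intro shear_mem fun_upd_coord_space x k)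
    fix l assume "l < n"
    have "((\<lambda>t. g (x(k := t))) has_real_derivative partial k g x) (at (x k))"
      by (rule C1_onD(3)[OF g k x])
    then show "((\<lambda>t. shear (x(k := t)) l) has_real_derivative d l) (at (x k))"
      by (cases "l = i"; cases "l = k") (auto simp: shear_def d_def intro!: derivative_eq_intros)
  qed
  also have "(\<Sum>l<n. partial l f (shear (x(k := x k))) * d l) = partial k f (shear x) + partial i f (shear x) * partial k g x"
    using i k by (simp add: d_def distrib_left sum.distrib if_distrib[of "\<lambda>z. _ * z"] sum.delta cong: if_cong)
  finally show ?thesis .
qed

lemma C1_box_shear:
  assumes f: "C1_box n c r f"
  obtains R where "C1_box n c R (\<lambda>x. f (shear x))"
proof -
  obtain R where R: "\<And>x. x \<in> coord_space n \<Longrightarrow> x \<notin> closed_box n c R \<Longrightarrow> shear x \<notin> closed_box n c r"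
    using shear_support by blast
  have cont: "continuous_on (coord_space n) (\<lambda>x. \<psi> (shear x))" if "continuous_on (coord_space n) \<psi>" for \<psi> :: "_ \<Rightarrow> real"
    by (rule continuous_on_compose2[OF that continuous_on_shear]) (auto simp: shear_mem)
  have "C1_on n (coord_space n) (\<lambda>x. f (shear x))"
  proof (rule C1_onI[OF _ _ partial_shear[OF C1_boxD(1)[OF f]]])
    show "continuous_on (coord_space n) (\<lambda>x. f (shear x))" by (intro cont C1_onD(2)[OF C1_boxD(1)[OF f]])
    show "continuous_on (coord_space n) (\<lambda>x. partial k f (shear x) + partial i f (shear x) * partial k g x)" if "k < n" for k
      by (intro continuous_on_add continuous_on_mult cont C1_onD(4)[OF C1_boxD(1)[OF f]] C1_onD(4)[OF g] that i)
  qed auto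
  then have "C1_box n c R (\<lambda>x. f (shear x))"
    unfolding C1_box_def using R C1_boxD(2)[OF f] shear_mem by blast
  then show ?thesis by (rule that)
qed

text \<open>For k = i this is the fundamental theorem on lines. Otherwise \<open>partial k\<close>
  of the sheared function has integral 0 over the half space; the chain rule and the shear turn this
  into a vanishing integral over \<open>D\<close> of \<open>partial k f\<close> plus
  \<open>partial k g\<close> times \<open>partial i f\<close>, and the second summand is a boundary
  integral by the case of direction i. The factor s (partial k g - 1 or 0) will be recognised as
  area element times normal component.\<close>

lemma integral_partial_D:
  assumes f: "C1_box n c r f" and k: "k < n"
  shows "(LINT x:D|lebesgue_coords n. partial k f x) =
    (LINT y:coord_space n|lborel_coords ({..<n} - {i}). s * (partial k g y - (if k = i then 1 else 0)) * f (y(i := g y)))"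
proof (cases "k = i")
  case True
  have "(LINT y:coord_space n|lborel_coords ({..<n} - {i}). - s * 1 * f (y(i := g y))) =
     (LINT y:coord_space n|lborel_coords ({..<n} - {i}). s * (partial k g y - (if k = i then 1 else 0)) * f (y(i := g y)))"
    unfolding set_lebesgue_integral_def
    by (intro Bochner_Integration.integral_cong) (auto simp: True g_partial_i split: split_indicator)
  then show ?thesis using integral_line_D[OF f, of "\<lambda>_. 1"] True by simp
next
  case False
  let ?P = "{x \<in> coord_space n. s * x i > 0}"
  obtain R where H: "C1_box n c R (\<lambda>x. f (shear x))" using C1_box_shear[OF f] .
  note P = half_space_borel
  note fk = C1_onD(4)[OF C1_boxD(1)[OF f] k] C1_box_partial_zero[OF f k]
  note fi = C1_onD(4)[OF C1_boxD(1)[OF f] i] C1_box_partial_zero[OF f i]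
  note gk = C1_onD(4)[OF g k] g_partial_inv[OF _ k]
  have partial_H: "partial k (\<lambda>x. f (shear x)) x = 1 * partial k f (shear x) + partial k g x * partial i f (shear x)"
    if "x \<in> coord_space n" for x
    using partial_eqI[OF partial_shear[OF C1_boxD(1)[OF f] k that]] by simp
  have "0 = (LINT x:?P|lebesgue_coords n. partial k (\<lambda>x. f (shear x)) x)"
    using False k by (intro integral_partial_invariant_set[OF H k P, symmetric]) auto
  also have "\<dots> = (LINT x:?P|lebesgue_coords n. 1 * partial k f (shear x) + partial k g x * partial i f (shear x))"
    unfolding set_lebesgue_integral_def
    by (intro Bochner_Integration.integral_cong refl) (simp add: partial_H split: split_indicator)
  also have "\<dots> = (LINT x:?P|lebesgue_coords n. 1 * partial k f (shear x)) + (LINT x:?P|lebesgue_coords n. partial k g x * partial i f (shear x))"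
    by (intro set_integral_add integral_shear[OF fk] integral_shear[OF fi gk]) auto
  also have "(LINT x:?P|lebesgue_coords n. 1 * partial k f (shear x)) = (LINT x:D|lebesgue_coords n. 1 * partial k f x)"
    by (intro integral_shear[OF fk]) auto
  also have "(LINT x:?P|lebesgue_coords n. partial k g x * partial i f (shear x)) = (LINT x:D|lebesgue_coords n. partial k g x * partial i f x)"
    by (intro integral_shear[OF fi gk])
  also have "(LINT x:D|lebesgue_coords n. partial k g x * partial i f x) =
     (LINT y:coord_space n|lborel_coords ({..<n} - {i}). - s * partial k g y * f (y(i := g y)))"
    by (rule integral_line_D[OF f gk])
  also have "\<dots> = - (LINT y:coord_space n|lborel_coords ({..<n} - {i}). s * (partial k g y - (if k = i then 1 else 0)) * f (y(i := g y)))"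
    using False unfolding set_lebesgue_integral_def by (simp flip: integral_minus)
  finally show ?thesis by simp
qed

end

section \<open>The exterior normal and the surface measure in a chart\<close>

text \<open>For distinct unit vectors v and w the direction w - v makes an obtuse angle with v and
  an acute one with w, so it would point both into and out of \<Omega>.\<close>

lemma is_exterior_normal_unique:
  assumes v: "is_exterior_normal n \<Omega> x v" and w: "is_exterior_normal n \<Omega> x w"
  shows "v = w"
proof (rule ccontr)
  assume "v \<noteq> w"
  have mem: "v \<in> coord_space n" "w \<in> coord_space n" using v w by (auto simp: is_exterior_normal_def)
  have sq: "(\<Sum>k<n. (v k)\<^sup>2) = 1" "(\<Sum>k<n. (w k)\<^sup>2) = 1"
    using v w by (auto simp: is_exterior_normal_def L2_set_def real_sqrt_eq_1_iff)
  obtain k where k: "v k \<noteq> w k" using \<open>v \<noteq> w\<close> by auto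
  then have "k < n" using mem by (metis mem_coord_space not_le)
  have "0 < (\<Sum>k<n. (v k - w k)\<^sup>2)"
    using k \<open>k < n\<close> by (intro sum_pos2[of _ k]) auto
  also have "(\<Sum>k<n. (v k - w k)\<^sup>2) = (\<Sum>k<n. (v k)\<^sup>2) + (\<Sum>k<n. (w k)\<^sup>2) - 2 * (\<Sum>k<n. v k * w k)"
    by (simp add: power2_diff sum.distrib sum_subtractf sum_distrib_left mult.assoc)
  finally have vw: "(\<Sum>k<n. v k * w k) < 1" using sq by simp
  define z where "z k = w k - v k" for k
  have z: "z \<in> coord_space n" using mem by (auto simp: z_def mem_coord_space)
  have "(\<Sum>k<n. v k * z k) < 0" "(\<Sum>k<n. w k * z k) > 0"
    using vw sq by (simp_all add: z_def right_diff_distrib sum_subtractf power2_eq_square mult.commute)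
  then have "\<forall>\<^sub>F t in at_right 0. (\<lambda>i. x i + t * z i) \<in> \<Omega>" "\<forall>\<^sub>F t in at_right 0. (\<lambda>i. x i + t * z i) \<notin> \<Omega>"
    using v w z by (auto simp: is_exterior_normal_def)
  then have "\<forall>\<^sub>F t in at_right (0::real). False" by eventually_elim simp
  then show False by (simp add: trivial_limit_at_right_real eventually_False)
qed

lemma grad_norm_square: "(grad_norm n f x)\<^sup>2 = (\<Sum>k<n. (partial k f x)\<^sup>2)"
  by (simp add: grad_norm_def L2_set_def sum_nonneg)

lemma continuous_on_grad_norm: "C1_on n U f \<Longrightarrow> continuous_on U (grad_norm n f)"
  unfolding grad_norm_def[abs_def] L2_set_def
  by (intro continuous_on_real_sqrt continuous_on_sum continuous_on_power C1_onD(4)) auto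

section \<open>Area element and normal of a graph\<close>

context graph_domain
begin

definition area :: "(nat \<Rightarrow> real) \<Rightarrow> real" where "area x = sqrt (1 + (grad_norm n g x)\<^sup>2)"

text \<open>The gradient of the level function s (g - x_i), divided by its length
  \<open>area\<close>. For s = 1 the domain lies above the graph, and this vector points
  downwards.\<close>

definition normal :: "(nat \<Rightarrow> real) \<Rightarrow> nat \<Rightarrow> real" where
  "normal x k = (if k < n then s * (partial k g x - (if k = i then 1 else 0)) / area x else 0)"

lemma area_pos: "area x > 0"
  by (auto simp: area_def intro: add_pos_nonneg)

lemma continuous_on_area: "continuous_on (coord_space n) area"
  unfolding area_def[abs_def]
  by (intro continuous_on_real_sqrt continuous_on_add continuous_on_const continuous_on_power continuous_on_grad_norm g)

lemma continuous_on_normal: "continuous_on (coord_space n) (\<lambda>x. normal x k)"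
  unfolding normal_def using area_pos
  by (cases "k < n") (auto intro!: continuous_on_divide continuous_on_mult continuous_on_diff continuous_on_const
      continuous_on_area C1_onD(4)[OF g] simp: less_imp_neq[THEN not_sym])

lemma area_inv: "x \<in> coord_space n \<Longrightarrow> area (x(i := t)) = area x"
  by (simp add: area_def grad_norm_square g_partial_inv)

lemma normal_inv: "x \<in> coord_space n \<Longrightarrow> normal (x(i := t)) k = normal x k"
  by (simp add: normal_def g_partial_inv area_inv)

lemma area_normal: "k < n \<Longrightarrow> area x * normal x k = s * (partial k g x - (if k = i then 1 else 0))"
  using area_pos[of x] by (simp add: normal_def)

lemma L2_set_normal:
  assumes x: "x \<in> coord_space n"
  shows "L2_set (normal x) {..<n} = 1"
proof -
  have "(\<Sum>k<n. (partial k g x - (if k = i then 1 else 0))\<^sup>2) = (\<Sum>k<n. (partial k g x)\<^sup>2 + (if k = i then 1 else 0))"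
    using g_partial_i[OF x] by (intro sum.cong) auto
  also have "\<dots> = (area x)\<^sup>2"
    using i by (simp add: sum.distrib area_def grad_norm_square add_nonneg_nonneg sum_nonneg)
  finally have *: "(\<Sum>k<n. (partial k g x - (if k = i then 1 else 0))\<^sup>2) = (area x)\<^sup>2" .
  have "(\<Sum>k<n. (normal x k)\<^sup>2) = (\<Sum>k<n. (partial k g x - (if k = i then 1 else 0))\<^sup>2 / (area x)\<^sup>2)"
    using s by (intro sum.cong) (auto simp: normal_def power_divide power_mult_distrib)
  also have "\<dots> = 1" using area_pos[of x] by (simp add: sum_divide_distrib[symmetric] *)
  finally show ?thesis by (simp add: L2_set_def)
qed

text \<open>The level function s (x_i - g) vanishes at x, and its derivative in direction w is -
  \<open>area x\<close> times the inner product of w with the normal. A nonzero derivative decides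
  the sign for small t > 0.\<close>

lemma graph_side:
  assumes x: "x \<in> coord_space n" "x i = g x" and w: "w \<in> coord_space n"
  shows "(\<Sum>k<n. normal x k * w k) < 0 \<Longrightarrow> \<forall>\<^sub>F t in at_right 0. s * (x i + t * w i - g (\<lambda>k. x k + t * w k)) > 0"
    "(\<Sum>k<n. normal x k * w k) > 0 \<Longrightarrow> \<forall>\<^sub>F t in at_right 0. s * (x i + t * w i - g (\<lambda>k. x k + t * w k)) < 0"
proof -
  define h where "h t = s * (x i + t * w i - g (\<lambda>k. x k + t * w k))" for t
  have "((\<lambda>t. g (\<lambda>k. x k + t * w k)) has_real_derivative (\<Sum>k<n. partial k g (\<lambda>k. x k + 0 * w k) * w k)) (at 0)"
    using x w by (intro C1_on_chain_rule[OF g]) (auto simp: mem_coord_space intro!: derivative_eq_intros)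
  then have "(h has_real_derivative s * (w i - (\<Sum>k<n. partial k g x * w k))) (at 0)"
    unfolding h_def by (auto intro!: derivative_eq_intros)
  moreover have "s * (w i - (\<Sum>k<n. partial k g x * w k)) = - area x * (\<Sum>k<n. normal x k * w k)"
  proof -
    have "area x * (\<Sum>k<n. normal x k * w k) = (\<Sum>k<n. s * (partial k g x - (if k = i then 1 else 0)) * w k)"
      unfolding sum_distrib_left by (intro sum.cong) (auto simp: area_normal mult.assoc[symmetric])
    also have "\<dots> = s * ((\<Sum>k<n. partial k g x * w k) - (\<Sum>k<n. (if k = i then 1 else 0) * w k))"
      by (simp add: sum_distrib_left sum_subtractf algebra_simps)
    also have "(\<Sum>k<n. (if k = i then 1 else 0) * w k) = w i"
      using i by (simp add: if_distrib[of "\<lambda>z. z * _"] cong: if_cong)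
    finally show ?thesis by (simp add: algebra_simps)
  qed
  ultimately have d: "(h has_real_derivative - area x * (\<Sum>k<n. normal x k * w k)) (at 0)" by simp
  have h0: "h 0 = 0" using x by (simp add: h_def)
  show "\<forall>\<^sub>F t in at_right 0. s * (x i + t * w i - g (\<lambda>k. x k + t * w k)) > 0" if "(\<Sum>k<n. normal x k * w k) < 0"
  proof -
    have "- area x * (\<Sum>k<n. normal x k * w k) > 0" using that area_pos[of x] by (simp add: mult_less_0_iff mult_pos_neg)
    from DERIV_pos_inc_right[OF d this] obtain e where "e > 0" "\<And>t. t > 0 \<Longrightarrow> t < e \<Longrightarrow> h t > 0"
      using h0 by auto
    then show ?thesis unfolding h_def[symmetric] by (intro eventually_at_rightI[of 0 e]) auto
  qed
  show "\<forall>\<^sub>F t in at_right 0. s * (x i + t * w i - g (\<lambda>k. x k + t * w k)) < 0" if "(\<Sum>k<n. normal x k * w k) > 0"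
  proof -
    have "- area x * (\<Sum>k<n. normal x k * w k) < 0" using that area_pos[of x] by simp
    from DERIV_neg_dec_right[OF d this] obtain e where "e > 0" "\<And>t. t > 0 \<Longrightarrow> t < e \<Longrightarrow> h t < 0"
      using h0 by auto
    then show ?thesis unfolding h_def[symmetric] by (intro eventually_at_rightI[of 0 e]) auto
  qed
qed

end

section \<open>Boundary charts of \<Omega>\<close>

locale boundary_chart_domain = graph_domain n i s g for n i s g +
  fixes \<Omega> U :: "(nat \<Rightarrow> real) set"
  assumes \<Omega>: "openin (Euclidean_space n) \<Omega>" and chart: "boundary_chart n \<Omega> U i s g"
begin

lemma U: "openin (Euclidean_space n) U" using chart by (simp add: boundary_chart_def)

lemma U_subset: "x \<in> U \<Longrightarrow> x \<in> coord_space n" using openin_coord_space_subset[OF U] by auto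

lemma \<Omega>_iff: "x \<in> U \<Longrightarrow> x \<in> \<Omega> \<longleftrightarrow> s * (x i - g x) > 0"
  using chart by (auto simp: boundary_chart_def)

text \<open>A point of the graph is a limit of points of \<Omega> obtained by shifting coordinate i
  by s/(m+1). Conversely, a point strictly on the wrong side of the graph has a neighbourhood within
  U that misses \<Omega>.\<close>

lemma frontier_iff:
  assumes x: "x \<in> U"
  shows "x \<in> closure \<Omega> - \<Omega> \<longleftrightarrow> x i = g x"
proof
  assume eq: "x i = g x"
  define y where "y m = x(i := x i + s * inverse (real (Suc m)))" for m
  have lim: "(\<lambda>m. x i + s * inverse (real (Suc m))) \<longlonglongrightarrow> x i"
    using tendsto_add[OF tendsto_const tendsto_mult[OF tendsto_const LIMSEQ_inverse_real_of_nat], of "x i" s] by simp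
  have "\<forall>\<^sub>F m in sequentially. y m \<in> U"
    using eventually_compose_filterlim[OF eventually_fun_upd_mem[OF U x i] lim] by (simp add: y_def)
  then have ev: "\<forall>\<^sub>F m in sequentially. y m \<in> closure \<Omega>"
  proof eventually_elim
    case (elim m)
    have "y m i - g (y m) = s * inverse (real (Suc m))" using U_subset[OF x] by (simp add: y_def g_inv eq)
    then have "y m \<in> \<Omega>" unfolding \<Omega>_iff[OF elim] using s by (auto simp: mult.assoc[symmetric])
    then show ?case using closure_subset by blast
  qed
  have y: "y \<longlonglongrightarrow> x"
  proof (rule tendsto_coordinatewiseI)
    show "(\<lambda>m. y m k) \<longlonglongrightarrow> x k" for k using lim by (cases "k = i") (simp_all add: y_def)
  qed
  have "x \<in> closure \<Omega>"
    by (rule Lim_in_closed_set[OF closed_closure ev trivial_limit_sequentially y])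
  then show "x \<in> closure \<Omega> - \<Omega>" using \<Omega>_iff[OF x] eq by simp
next
  assume *: "x \<in> closure \<Omega> - \<Omega>"
  have "\<not> s * (x i - g x) < 0"
  proof
    assume neg: "s * (x i - g x) < 0"
    have "openin (top_of_set (coord_space n)) (coord_space n \<inter> (\<lambda>x. s * (x i - g x)) -` {..<0})"
      by (intro continuous_openin_preimage_gen continuous_on_mult continuous_on_diff continuous_on_const
          continuous_on_coord C1_onD(2)[OF g] open_lessThan)
    then have "openin (Euclidean_space n) (U \<inter> (coord_space n \<inter> (\<lambda>x. s * (x i - g x)) -` {..<0}))"
      by (simp only: Euclidean_space_eq[symmetric] openin_Int[OF U])
    then obtain T where T: "open T" "U \<inter> (coord_space n \<inter> (\<lambda>x. s * (x i - g x)) -` {..<0}) = coord_space n \<inter> T"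
      by (auto simp: openin_coord_space_iff)
    then have "x \<in> T" using x neg U_subset[OF x] by auto
    then have "T \<inter> \<Omega> \<noteq> {}" using * T(1) open_Int_closure_eq_empty[of T \<Omega>] by auto
    then obtain z where z: "z \<in> T" "z \<in> \<Omega>" by auto
    then have "z \<in> U" "s * (z i - g z) < 0" using T(2) openin_coord_space_subset[OF \<Omega>] by auto
    with \<Omega>_iff[of z] z show False by simp
  qed
  then have "s * (x i - g x) = 0" using * \<Omega>_iff[OF x] by auto
  then show "x i = g x" using s by auto
qed

lemma exterior_normal_eq:
  assumes x: "x \<in> U" "x i = g x"
  shows "exterior_normal n \<Omega> x = normal x"
proof -
  have xc: "x \<in> coord_space n" using U_subset x by simp
  have near: "\<forall>\<^sub>F t in at_right 0. (\<lambda>k. x k + t * w k) \<in> U" if w: "w \<in> coord_space n" for w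
  proof -
    obtain T where T: "open T" "U = coord_space n \<inter> T" using U by (auto simp: openin_coord_space_iff)
    have "((\<lambda>t. (\<lambda>k. x k + t * w k)) \<longlongrightarrow> x) (at_right 0)"
    proof (rule tendsto_coordinatewiseI)
      show "((\<lambda>t. x k + t * w k) \<longlongrightarrow> x k) (at_right 0)" for k
        by (auto intro!: tendsto_eq_intros)
    qed
    then have "\<forall>\<^sub>F t in at_right 0. (\<lambda>k. x k + t * w k) \<in> T"
      using T x(1) by (intro topological_tendstoD) auto
    then show ?thesis using xc w T(2) by (auto elim!: eventually_mono simp: mem_coord_space)
  qed
  have ext: "is_exterior_normal n \<Omega> x (normal x)"
    unfolding is_exterior_normal_def
  proof (intro conjI ballI impI)
    show "normal x \<in> coord_space n" by (simp add: mem_coord_space normal_def)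
    show "L2_set (normal x) {..<n} = 1" by (rule L2_set_normal[OF xc])
    fix w assume w: "w \<in> coord_space n"
    show "\<forall>\<^sub>F t in at_right 0. (\<lambda>k. x k + t * w k) \<in> \<Omega>" if "(\<Sum>k<n. normal x k * w k) < 0"
      using near[OF w] graph_side(1)[OF xc x(2) w that] by eventually_elim (simp add: \<Omega>_iff)
    show "\<forall>\<^sub>F t in at_right 0. (\<lambda>k. x k + t * w k) \<notin> \<Omega>" if "(\<Sum>k<n. normal x k * w k) > 0"
      using near[OF w] graph_side(2)[OF xc x(2) w that] by eventually_elim (simp add: \<Omega>_iff)
  qed
  show ?thesis unfolding exterior_normal_def
    by (rule the_equality[where P = "is_exterior_normal n \<Omega> x", OF ext]) (rule is_exterior_normal_unique[OF _ ext])
qed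

text \<open>Off \<open>coord_space n\<close> the functions \<open>g\<close> and \<open>area\<close> are arbitrary, so they are cut off to be Borel.\<close>

lemma surface_integral:
  fixes \<phi> :: "(nat \<Rightarrow> real) \<Rightarrow> real"
  assumes \<sigma>: "is_surface_measure n \<Omega> \<sigma>"
    and \<phi>: "continuous_on (coord_space n) \<phi>" "\<And>x. x \<in> coord_space n \<Longrightarrow> x \<notin> closed_box n c r \<Longrightarrow> \<phi> x = 0"
    and box: "closed_box n c r \<subseteq> U"
  shows "set_integrable \<sigma> (closure \<Omega> - \<Omega>) \<phi>"
    "(LINT x:closure \<Omega> - \<Omega>|\<sigma>. \<phi> x) =
     (LINT y:coord_space n|lborel_coords ({..<n} - {i}). area y * \<phi> (y(i := g y)))"
proof -
  define F where "F = closure \<Omega> - \<Omega>"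
  define \<mu> where "\<mu> = lborel_coords ({..<n} - {i})"
  have sets_\<mu> [measurable_cong, simp]: "sets \<mu> = sets borel" by (simp add: \<mu>_def)
  have sets_\<sigma> [measurable_cong, simp]: "sets \<sigma> = sets borel" using \<sigma> by (simp add: is_surface_measure_def)
  have space_\<sigma>: "space \<sigma> = UNIV" using sets_eq_imp_space_eq[OF sets_\<sigma>] by simp
  have cs [measurable]: "coord_space n \<in> sets borel" using closed_coord_space by (rule borel_closed)
  have F_sub: "F \<subseteq> coord_space n"
    using closure_minimal[OF openin_coord_space_subset[OF \<Omega>] closed_coord_space] by (auto simp: F_def)
  have [measurable]: "U \<in> sets borel" "F \<in> sets borel"
    using openin_coord_space_borel[OF U] openin_coord_space_borel[OF \<Omega>] by (auto simp: F_def)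
  define B where "B = U \<inter> F"
  have B [measurable]: "B \<in> sets borel" by (simp add: B_def)
  define g' where "g' y = indicator (coord_space n) y *\<^sub>R g y" for y
  define W where "W y = indicator (coord_space n) y *\<^sub>R area y" for y
  define \<phi>' where "\<phi>' y = indicator (coord_space n) y *\<^sub>R \<phi> y" for y
  define T where "T y = y(i := g' y)" for y
  have [measurable]: "g' \<in> borel_measurable borel" "W \<in> borel_measurable borel" "\<phi>' \<in> borel_measurable borel"
    unfolding g'_def[abs_def] W_def[abs_def] \<phi>'_def[abs_def]
    by (intro borel_measurable_continuous_on_indicator cs C1_onD(2)[OF g] continuous_on_area \<phi>(1))+
  have T [measurable]: "T \<in> measurable borel borel"
  proof (rule measurable_coordinatewise_then_product)
    show "(\<lambda>y. T y k) \<in> borel_measurable borel" for k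
      by (cases "k = i") (auto simp: T_def)
  qed
  have W_nonneg: "W y \<ge> 0" for y using area_pos[of y] by (auto simp: W_def indicator_def)
  have T_eq: "T y = y(i := g y)" "T y \<in> coord_space n" if "y \<in> coord_space n" for y
    using that i by (simp_all add: T_def g'_def)
  have AE_cs: "AE y in \<mu>. y \<in> coord_space n"
    unfolding \<mu>_def by (rule AE_lborel_coords_mem) auto
  \<comment> \<open>The indicator discards those points of the global graph that leave the chart,
    where the graph need not be part of the boundary.\<close>
  define d where "d y = W y * indicator B (T y)" for y
  have d: "d \<in> borel_measurable borel" "\<And>y. d y \<ge> 0"
    unfolding d_def using W_nonneg by (measurable, auto)
  note [measurable] = d(1)
  define \<rho> where "\<rho> = distr (density \<mu> (\<lambda>y. ennreal (d y))) borel T"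
  \<comment> \<open>The defining formula of the surface measure, read as an identity of measures:
    within the chart, \<sigma> is the image of the weighted hyperplane measure under the graph map
    \<open>T\<close>. Integrals of functions then follow from the transformation rules for images
    and densities.\<close>
  have rho: "density \<sigma> (\<lambda>x. ennreal (indicator B x)) = \<rho>"
  proof (rule measure_eqI)
    show "sets (density \<sigma> (\<lambda>x. ennreal (indicator B x))) = sets \<rho>" by (simp add: \<rho>_def)
    fix A assume "A \<in> sets (density \<sigma> (\<lambda>x. ennreal (indicator B x)))"
    then have A [measurable]: "A \<in> sets borel" by simp
    have "emeasure (density \<sigma> (\<lambda>x. ennreal (indicator B x))) A = (\<integral>\<^sup>+x. ennreal (indicator B x) * indicator A x \<partial>\<sigma>)"
      by (rule emeasure_density) auto
    also have "\<dots> = (\<integral>\<^sup>+x. indicator (A \<inter> B) x \<partial>\<sigma>)"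
      by (intro nn_integral_cong) (auto split: split_indicator)
    also have "\<dots> = emeasure \<sigma> (A \<inter> B)" by simp
    also have "\<dots> = (\<integral>\<^sup>+y. ennreal (sqrt (1 + (grad_norm n g y)\<^sup>2)) * indicator (A \<inter> B) (y(i := g y)) \<partial>\<mu>)"
    proof -
      have "A \<inter> B \<in> sets borel" using A B by (rule sets.Int)
      moreover have "A \<inter> B \<subseteq> U \<inter> Euclidean_space n frontier_of \<Omega>"
        by (auto simp: B_def F_def frontier_of_coord_space[OF \<Omega>])
      ultimately show ?thesis
        using \<sigma> chart unfolding is_surface_measure_def \<mu>_def by blast
    qed
    also have "\<dots> = (\<integral>\<^sup>+y. ennreal (d y) * indicator (T -` A) y \<partial>\<mu>)"
    proof (rule nn_integral_cong_AE)
      show "AE y in \<mu>. ennreal (sqrt (1 + (grad_norm n g y)\<^sup>2)) * indicator (A \<inter> B) (y(i := g y)) = ennreal (d y) * indicator (T -` A) y"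
        using AE_cs by eventually_elim (auto simp: d_def W_def area_def T_eq indicator_def)
    qed
    also have "\<dots> = emeasure (density \<mu> (\<lambda>y. ennreal (d y))) (T -` A)"
      using measurable_sets[OF T A] by (intro emeasure_density[symmetric]) auto
    also have "\<dots> = emeasure \<rho> A"
      unfolding \<rho>_def by (subst emeasure_distr) (auto simp: \<mu>_def)
    finally show "emeasure (density \<sigma> (\<lambda>x. ennreal (indicator B x))) A = emeasure \<rho> A" .
  qed
  have F_B: "indicator F x *\<^sub>R \<phi> x = indicator B x *\<^sub>R \<phi>' x" for x
    using F_sub \<phi>(2)[of x] box by (auto simp: B_def \<phi>'_def indicator_def)
  \<comment> \<open>Where \<phi> does not vanish, \<open>T y\<close> lies in the box and thus in the
    chart, and a graph point of the chart is a boundary point; so the indicator in \<open>d\<close>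
    may be dropped.\<close>
  have dT: "AE y in \<mu>. d y *\<^sub>R \<phi>' (T y) = indicator (coord_space n) y *\<^sub>R (area y * \<phi> (y(i := g y)))"
    using AE_cs
  proof eventually_elim
    case (elim y)
    have "indicator B (T y) * \<phi> (T y) = \<phi> (T y)"
    proof (cases "T y \<in> closed_box n c r")
      case True
      then have U: "T y \<in> U" using box by auto
      have "T y i = g (T y)" using elim by (simp add: T_eq g_inv)
      then have "T y \<in> F" using frontier_iff[OF U] by (simp add: F_def)
      then show ?thesis using U by (simp add: B_def)
    qed (use \<phi>(2) T_eq elim in auto)
    then show ?case using elim T_eq[OF elim] by (auto simp: d_def W_def \<phi>'_def)
  qed
  have int: "integrable \<mu> (\<lambda>y. d y *\<^sub>R \<phi>' (T y))"
  proof -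
    obtain M where M: "\<And>x. x \<in> closed_box n c r \<Longrightarrow> \<bar>area x * \<phi> x\<bar> \<le> M" "M \<ge> 0"
      using bounded_on_compact[OF compact_closed_box
          continuous_on_subset[OF continuous_on_mult[OF continuous_on_area \<phi>(1)] closed_box_subset]] by blast
    define K where "K = {y :: nat \<Rightarrow> real. \<forall>k\<in>{..<n} - {i}. \<bar>y k - c k\<bar> \<le> r}"
    have K [measurable]: "K \<in> sets borel" unfolding K_def by (rule coord_box_borel)
    show ?thesis
    proof (rule integrableI_bounded_set[where A = K and B = M])
      show "emeasure \<mu> K < \<infinity>" unfolding \<mu>_def K_def by (rule emeasure_lborel_coords_box) simp
      have "AE y in \<mu>. y \<in> coord_space n \<longrightarrow> norm (d y *\<^sub>R \<phi>' (T y)) \<le> M \<and> (y \<notin> K \<longrightarrow> d y *\<^sub>R \<phi>' (T y) = 0)"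
        using dT
      proof eventually_elim
        case (elim y)
        show ?case
        proof
          assume y: "y \<in> coord_space n"
          have eq: "d y *\<^sub>R \<phi>' (T y) = area (T y) * \<phi> (T y)"
            using elim y by (simp add: T_eq area_inv)
          show "norm (d y *\<^sub>R \<phi>' (T y)) \<le> M \<and> (y \<notin> K \<longrightarrow> d y *\<^sub>R \<phi>' (T y) = 0)"
          proof (cases "T y \<in> closed_box n c r")
            case True
            have "y \<in> K"
              unfolding K_def
            proof (intro CollectI ballI)
              fix k assume "k \<in> {..<n} - {i}"
              then have "T y k = y k" "k < n" by (auto simp: T_def)
              with True show "\<bar>y k - c k\<bar> \<le> r" by (auto simp: closed_box_def)
            qed
            with True M(1) show ?thesis unfolding eq by auto
          qed (use \<phi>(2)[OF T_eq(2)[OF y]] M(2) eq in auto)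
        qed
      qed
      then show "AE y in \<mu>. y \<in> K \<longrightarrow> norm (d y *\<^sub>R \<phi>' (T y)) \<le> M" "AE y in \<mu>. y \<notin> K \<longrightarrow> d y *\<^sub>R \<phi>' (T y) = 0"
        using AE_cs by (eventually_elim, simp)+
    qed auto
  qed
  have int\<rho>: "integrable \<rho> \<phi>'"
    unfolding \<rho>_def using int d by (subst integrable_distr_eq) (auto simp: integrable_density)
  have "integrable \<sigma> (\<lambda>x. indicator B x *\<^sub>R \<phi>' x)"
    using int\<rho> unfolding rho[symmetric] by (subst (asm) integrable_density) auto
  then show "set_integrable \<sigma> (closure \<Omega> - \<Omega>) \<phi>"
    unfolding set_integrable_def F_def[symmetric] F_B .
  have "(LINT x:closure \<Omega> - \<Omega>|\<sigma>. \<phi> x) = (\<integral>x. indicator B x *\<^sub>R \<phi>' x \<partial>\<sigma>)"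
    unfolding set_lebesgue_integral_def F_def[symmetric] F_B ..
  also have "\<dots> = (\<integral>x. \<phi>' x \<partial>\<rho>)"
    unfolding rho[symmetric] by (subst integral_density) auto
  also have "\<dots> = (\<integral>y. \<phi>' (T y) \<partial>density \<mu> (\<lambda>y. ennreal (d y)))"
    unfolding \<rho>_def by (rule integral_distr) auto
  also have "\<dots> = (\<integral>y. d y *\<^sub>R \<phi>' (T y) \<partial>\<mu>)"
    using d by (subst integral_density) auto
  also have "\<dots> = (LINT y:coord_space n|\<mu>. area y * \<phi> (y(i := g y)))"
    unfolding set_lebesgue_integral_def
  proof (rule integral_cong_AE[OF _ _ dT])
    have "continuous_on (coord_space n) (\<lambda>y. y(i := g y))"
    proof (rule continuous_on_coordinatewise_then_product)
      show "continuous_on (coord_space n) (\<lambda>y. (y(i := g y)) k)" for k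
        using C1_onD(2)[OF g] continuous_on_coord[of _ k] by (cases "k = i") simp_all
    qed
    then have "continuous_on (coord_space n) (\<lambda>y. area y * \<phi> (y(i := g y)))"
      using i by (intro continuous_on_mult continuous_on_area continuous_on_compose2[OF \<phi>(1)]) auto
    then show "(\<lambda>y. indicator (coord_space n) y *\<^sub>R (area y * \<phi> (y(i := g y)))) \<in> borel_measurable \<mu>"
      using borel_measurable_continuous_on_indicator[OF cs] by (simp only: measurable_cong_sets[OF sets_\<mu> refl])
  qed measurable
  finally show "(LINT x:closure \<Omega> - \<Omega>|\<sigma>. \<phi> x) =
     (LINT y:coord_space n|lborel_coords ({..<n} - {i}). area y * \<phi> (y(i := g y)))"
    unfolding \<mu>_def .
qed

text \<open>\<Omega> agrees with \<open>D\<close>, and \<open>exterior_normal\<close> with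
  \<open>normal\<close>, only inside the chart. Since \<open>f\<close> is supported there, either
  may be replaced by the other, and the boundary integral over \<open>D\<close> becomes one against
  \<sigma>.\<close>

lemma divergence_theorem_chart:
  assumes \<sigma>: "is_surface_measure n \<Omega> \<sigma>" and f: "C1_box n c r f" and box: "closed_box n c r \<subseteq> U" and k: "k < n"
  shows "set_integrable \<sigma> (closure \<Omega> - \<Omega>) (\<lambda>x. f x * exterior_normal n \<Omega> x k)"
    "(LINT x:\<Omega>|lebesgue_coords n. partial k f x) = (LINT x:closure \<Omega> - \<Omega>|\<sigma>. f x * exterior_normal n \<Omega> x k)"
proof -
  let ?F = "closure \<Omega> - \<Omega>"
  let ?\<phi> = "\<lambda>x. f x * normal x k"
  have F_sub: "?F \<subseteq> coord_space n"
    using closure_minimal[OF openin_coord_space_subset[OF \<Omega>] closed_coord_space] by auto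
  have \<phi>: "continuous_on (coord_space n) ?\<phi>" "\<And>x. x \<in> coord_space n \<Longrightarrow> x \<notin> closed_box n c r \<Longrightarrow> ?\<phi> x = 0"
    using C1_boxD(2)[OF f] by (auto intro!: continuous_on_mult continuous_on_normal C1_onD(2)[OF C1_boxD(1)[OF f]])
  have eq: "indicator ?F x *\<^sub>R (f x * exterior_normal n \<Omega> x k) = indicator ?F x *\<^sub>R ?\<phi> x" for x
  proof (cases "x \<in> ?F \<and> x \<in> closed_box n c r")
    case True
    then have U: "x \<in> U" using box by auto
    moreover have "x i = g x" using frontier_iff[OF U] True by simp
    ultimately show ?thesis by (simp only: exterior_normal_eq)
  next
    case False
    then show ?thesis using F_sub C1_boxD(2)[OF f, of x] by (auto simp: indicator_def)
  qed
  note S = surface_integral[OF \<sigma> \<phi> box]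
  show "set_integrable \<sigma> ?F (\<lambda>x. f x * exterior_normal n \<Omega> x k)"
    using S(1) unfolding set_integrable_def eq .
  have "(LINT x:\<Omega>|lebesgue_coords n. partial k f x) = (LINT x:D|lebesgue_coords n. partial k f x)"
  proof -
    have "indicator \<Omega> x *\<^sub>R partial k f x = indicator D x *\<^sub>R partial k f x" for x
    proof (cases "x \<in> closed_box n c r")
      case True
      then have "x \<in> U" using box by auto
      then show ?thesis using \<Omega>_iff[of x] U_subset[of x] by (simp add: D_def indicator_def)
    next
      case False
      then show ?thesis using C1_box_partial_zero[OF f k, of x] openin_coord_space_subset[OF \<Omega>]
        by (auto simp: D_def indicator_def)
    qed
    then show ?thesis unfolding set_lebesgue_integral_def by (simp only:)
  qed
  also have "\<dots> = (LINT y:coord_space n|lborel_coords ({..<n} - {i}). s * (partial k g y - (if k = i then 1 else 0)) * f (y(i := g y)))"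
    by (rule integral_partial_D[OF f k])
  also have "\<dots> = (LINT y:coord_space n|lborel_coords ({..<n} - {i}). area y * ?\<phi> (y(i := g y)))"
    unfolding set_lebesgue_integral_def
    by (intro Bochner_Integration.integral_cong refl)
      (auto simp: normal_inv area_normal[OF k, symmetric] mult_ac split: split_indicator)
  also have "\<dots> = (LINT x:?F|\<sigma>. ?\<phi> x)" by (rule S(2)[symmetric])
  also have "\<dots> = (LINT x:?F|\<sigma>. f x * exterior_normal n \<Omega> x k)"
    unfolding set_lebesgue_integral_def eq ..
  finally show "(LINT x:\<Omega>|lebesgue_coords n. partial k f x) = (LINT x:?F|\<sigma>. f x * exterior_normal n \<Omega> x k)" .
qed

end

section \<open>The divergence theorem on smooth bounded domains\<close>

lemma DERIV_max_0_square:
  "((\<lambda>t. (max 0 t)\<^sup>2) has_real_derivative 2 * max 0 t) (at (t :: real))"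
proof -
  consider "t > 0" | "t < 0" | "t = 0" by linarith
  then show ?thesis
  proof cases
    case 1
    then have ev: "eventually (\<lambda>u. (max 0 u)\<^sup>2 = u\<^sup>2) (nhds t)"
      using eventually_nhds_in_open[of "{0<..}" t] by (auto elim!: eventually_mono)
    have "((\<lambda>u. u\<^sup>2) has_real_derivative 2 * max 0 t) (at t)"
      using 1 by (auto intro!: derivative_eq_intros)
    then show ?thesis by (rule DERIV_cong_ev[OF refl ev refl, THEN iffD2])
  next
    case 2
    then have ev: "eventually (\<lambda>u. (max 0 u)\<^sup>2 = 0) (nhds t)"
      using eventually_nhds_in_open[of "{..<0}" t] by (auto elim!: eventually_mono)
    have "((\<lambda>u. 0) has_real_derivative 2 * max 0 t) (at t)"
      using 2 by (auto intro!: derivative_eq_intros)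
    then show ?thesis by (rule DERIV_cong_ev[OF refl ev refl, THEN iffD2])
  next
    case 3
    have "((\<lambda>h. ((max 0 h)\<^sup>2 - (max 0 0)\<^sup>2) / (h - 0)) \<longlongrightarrow> 0) (at (0::real))"
    proof (rule Lim_null_comparison)
      show "eventually (\<lambda>h. norm (((max 0 h)\<^sup>2 - (max 0 0)\<^sup>2) / (h - 0)) \<le> \<bar>h\<bar>) (at (0::real))"
        by (intro always_eventually) (auto simp: max_def power2_eq_square)
      show "((\<lambda>h. \<bar>h\<bar>) \<longlongrightarrow> 0) (at (0::real))" by (rule tendsto_rabs_zero[OF tendsto_ident_at])
    qed
    then show ?thesis using 3 by (simp add: has_field_derivative_iff)
  qed
qed

text \<open>Squared truncated parabolas: they are of class C^1, the regularity at which the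
  divergence theorem is stated.\<close>

definition bump :: "nat \<Rightarrow> (nat \<Rightarrow> real) \<Rightarrow> real \<Rightarrow> (nat \<Rightarrow> real) \<Rightarrow> real" where
  "bump n c r x = (\<Prod>k<n. (max 0 (r\<^sup>2 - (x k - c k)\<^sup>2))\<^sup>2)"

lemma C1_on_bump: "C1_on n (coord_space n) (bump n c r)"
  unfolding bump_def
proof (rule C1_on_prod)
  fix k
  show "C1_on n (coord_space n) (\<lambda>x. (max 0 (r\<^sup>2 - (x k - c k)\<^sup>2))\<^sup>2)"
  proof (rule C1_on_compose[OF C1_on_coord])
    show "((\<lambda>t. (max 0 (r\<^sup>2 - (t - c k)\<^sup>2))\<^sup>2) has_real_derivative
        2 * max 0 (r\<^sup>2 - (x k - c k)\<^sup>2) * (- (2 * (x k - c k)))) (at (x k))" for x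
      by (rule DERIV_chain2[OF DERIV_max_0_square]) (auto intro!: derivative_eq_intros)
    show "continuous_on ((\<lambda>x. x k) ` coord_space n) (\<lambda>t. 2 * max 0 (r\<^sup>2 - (t - c k)\<^sup>2) * (- (2 * (t - c k))))"
      by (intro continuous_intros)
  qed simp
qed simp

lemma bump_nonneg: "bump n c r x \<ge> 0"
  by (simp add: bump_def prod_nonneg)

lemma bump_pos:
  assumes "x \<in> open_box n c r"
  shows "bump n c r x > 0"
proof -
  have "(x k - c k)\<^sup>2 < r\<^sup>2" if "k < n" for k
    using assms that by (intro power2_strict_mono) (auto simp: open_box_def intro: less_le_trans)
  then have "max 0 (r\<^sup>2 - (x k - c k)\<^sup>2) > 0" if "k < n" for k
    using that by (simp add: less_max_iff_disj)
  then show ?thesis unfolding bump_def by (intro prod_pos ballI zero_less_power) auto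
qed

lemma bump_zero:
  assumes "x \<in> coord_space n" "x \<notin> closed_box n c r" "r > 0"
  shows "bump n c r x = 0"
proof -
  obtain k where k: "k < n" "\<bar>x k - c k\<bar> > r" using assms by (auto simp: closed_box_def not_le)
  then have "r\<^sup>2 \<le> (x k - c k)\<^sup>2"
    using assms(3) power_mono[of r "\<bar>x k - c k\<bar>" 2] by simp
  then have "(max 0 (r\<^sup>2 - (x k - c k)\<^sup>2))\<^sup>2 = 0" by simp
  with k(1) show ?thesis unfolding bump_def by (intro prod_zero) auto
qed

text \<open>The function is C^1 on V and identically 0 on the complement of the closed box; these
  two open sets cover the coordinate subspace.\<close>

lemma C1_box_extend_zero:
  assumes f: "C1_on n V f" and h: "C1_box n c r h" and V: "closed_box n c r \<subseteq> V"
  shows "C1_box n c r (\<lambda>x. if x \<in> V then h x * f x else 0)"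
proof -
  let ?f = "\<lambda>x. if x \<in> V then h x * f x else 0"
  have oV: "openin (Euclidean_space n) V" using C1_onD(1)[OF f] .
  then have Vs: "V \<subseteq> coord_space n" by (rule openin_coord_space_subset)
  note o = openin_compl_closed_box[of n c r]
  have "C1_on n V ?f"
    by (rule C1_on_cong[OF C1_on_mult[OF C1_on_subset[OF C1_boxD(1)[OF h] oV Vs] f]]) simp
  moreover have "C1_on n (coord_space n - closed_box n c r) ?f"
    by (rule C1_on_cong[OF C1_on_const[OF o, of 0]]) (use C1_boxD(2)[OF h] in auto)
  ultimately have "C1_on n (V \<union> (coord_space n - closed_box n c r)) ?f" by (rule C1_on_Un)
  moreover have "V \<union> (coord_space n - closed_box n c r) = coord_space n" using V Vs by auto
  ultimately have "C1_on n (coord_space n) ?f" by simp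
  then show ?thesis unfolding C1_box_def using C1_boxD(2)[OF h] by auto
qed

lemma compact_closure_bounded_domain:
  assumes "smooth_bounded_domain n \<Omega>"
  obtains R where "compact (closure \<Omega>)" "closure \<Omega> \<subseteq> closed_box n (\<lambda>_. 0) R"
proof -
  obtain R where R: "\<And>x. x \<in> \<Omega> \<Longrightarrow> L2_set x {..<n} \<le> R"
    using assms by (auto simp: smooth_bounded_domain_def)
  have sub: "\<Omega> \<subseteq> coord_space n"
    using assms by (auto simp: smooth_bounded_domain_def dest: openin_coord_space_subset)
  have "\<Omega> \<subseteq> closed_box n (\<lambda>_. 0) R"
  proof
    fix x assume x: "x \<in> \<Omega>"
    have "\<bar>x i\<bar> \<le> R" if "i < n" for i
      using member_le_L2_set[of "{..<n}" i "\<lambda>i. \<bar>x i\<bar>"] that R[OF x] by (simp add: L2_set_def)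
    with x sub show "x \<in> closed_box n (\<lambda>_. 0) R" by (auto simp: closed_box_def)
  qed
  moreover have cl: "closed (closed_box n (\<lambda>_. 0) R)" using compact_closed_box compact_imp_closed by blast
  ultimately have "closure \<Omega> \<subseteq> closed_box n (\<lambda>_. 0) R" by (rule closure_minimal)
  moreover from this have "compact (closure \<Omega>)"
    using compact_Int_closed[OF compact_closed_box closed_closure] by (metis inf.absorb2)
  ultimately show ?thesis using that by blast
qed

lemma finite_box_cover:
  assumes K: "compact K" "K \<subseteq> coord_space n" and r: "\<And>x. x \<in> K \<Longrightarrow> r x > 0"
  obtains X where "finite X" "X \<subseteq> K" "K \<subseteq> (\<Union>x\<in>X. open_box n x (r x))"
proof -
  have "\<exists>T. open T \<and> open_box n x (r x) = coord_space n \<inter> T" for x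
    using openin_open_box[of n x "r x"] by (simp add: openin_coord_space_iff)
  then obtain T where T: "\<And>x. open (T x)" "\<And>x. open_box n x (r x) = coord_space n \<inter> T x" by metis
  have "K \<subseteq> (\<Union>x\<in>K. T x)"
  proof
    fix x assume x: "x \<in> K"
    then have "x \<in> open_box n x (r x)" using K(2) r[OF x] by (auto simp: open_box_def)
    then show "x \<in> (\<Union>x\<in>K. T x)" using T(2) x by blast
  qed
  then obtain X where "X \<subseteq> K" "finite X" "K \<subseteq> (\<Union>x\<in>X. T x)"
    using compactE_image[OF K(1), of K T] T(1) by blast
  then show ?thesis using that[of X] T(2) K(2) by blast
qed

text \<open>Dividing by a \<open>C\<^sup>1\<close> function that agrees with the sum of the bumps on \<open>K\<close> but is positive
  everywhere avoids dividing by \<open>0\<close> outside of \<open>K\<close>.\<close>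

lemma partition_of_unity:
  assumes K: "compact K" "K \<subseteq> coord_space n" and X: "finite X" "K \<subseteq> (\<Union>x\<in>X. open_box n x (r x))"
    and r: "\<And>x. x \<in> X \<Longrightarrow> r x > 0"
  obtains \<theta> where "\<And>x. x \<in> X \<Longrightarrow> C1_box n x (r x) (\<theta> x)" "\<And>y. y \<in> K \<Longrightarrow> (\<Sum>x\<in>X. \<theta> x y) = (1 :: real)"
proof (cases "K = {}")
  case True
  then show ?thesis using that[of "\<lambda>_ _. 0"] by (auto simp: C1_box_def intro: C1_on_const)
next
  case False
  define S where "S y = (\<Sum>x\<in>X. bump n x (r x) y)" for y
  have S_nonneg: "S y \<ge> 0" for y unfolding S_def by (intro sum_nonneg bump_nonneg)
  have S_C1: "C1_on n (coord_space n) S" unfolding S_def[abs_def] by (intro C1_on_sum C1_on_bump) simp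
  have S_pos: "S y > 0" if y: "y \<in> K" for y
  proof -
    obtain x where x: "x \<in> X" "y \<in> open_box n x (r x)" using X(2) y by auto
    then show ?thesis unfolding S_def by (intro sum_pos2[OF X(1) x(1)] bump_pos bump_nonneg)
  qed
  obtain y0 where y0: "y0 \<in> K" "\<And>y. y \<in> K \<Longrightarrow> S y0 \<le> S y"
    using continuous_attains_inf[OF K(1) False continuous_on_subset[OF C1_onD(2)[OF S_C1] K(2)]] by blast
  define m where "m = S y0"
  have m: "m > 0" using S_pos[OF y0(1)] by (simp add: m_def)
  \<comment> \<open>It equals t for t at least m, the minimum of \<open>S\<close> on K, and is
    positive for all t \<ge> 0, with value m at 0. The square makes the transition C^1.\<close>
  define \<rho> where "\<rho> t = t + (max 0 (m - t))\<^sup>2 / m" for t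
  have \<rho>_pos: "\<rho> t > 0" if "t \<ge> 0" for t
  proof (cases "t = 0")
    case True
    then show ?thesis using m by (simp add: \<rho>_def)
  next
    case False
    then show ?thesis using m that by (auto simp: \<rho>_def intro!: add_pos_nonneg)
  qed
  have d\<rho>: "((\<lambda>t. 1 / \<rho> t) has_real_derivative - ((1 - 2 * max 0 (m - t) / m) / (\<rho> t * \<rho> t))) (at t)" if "t \<ge> 0" for t
  proof -
    have "((\<lambda>t. (max 0 (m - t))\<^sup>2) has_real_derivative 2 * max 0 (m - t) * (- 1)) (at t)"
      by (rule DERIV_chain2[OF DERIV_max_0_square]) (auto intro!: derivative_eq_intros)
    then have "(\<rho> has_real_derivative 1 + 2 * max 0 (m - t) * (- 1) / m) (at t)"
      unfolding \<rho>_def[abs_def] by (intro DERIV_add DERIV_ident DERIV_cdivide)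
    from DERIV_inverse_fun[OF this] \<rho>_pos[OF that] show ?thesis
      by (simp add: inverse_eq_divide power2_eq_square divide_inverse[symmetric])
  qed
  have "continuous_on {0..} \<rho>" unfolding \<rho>_def[abs_def] using m by (intro continuous_intros) auto
  then have "continuous_on {0..} (\<lambda>t. - ((1 - 2 * max 0 (m - t) / m) / (\<rho> t * \<rho> t)))"
    using \<rho>_pos m by (intro continuous_intros) (auto simp: less_imp_neq[THEN not_sym])
  then have "continuous_on (S ` coord_space n) (\<lambda>t. - ((1 - 2 * max 0 (m - t) / m) / (\<rho> t * \<rho> t)))"
    by (rule continuous_on_subset) (use S_nonneg in auto)
  then have inv_C1: "C1_on n (coord_space n) (\<lambda>y. 1 / \<rho> (S y))"
    by (rule C1_on_compose[OF S_C1 d\<rho>[OF S_nonneg]])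
  define \<theta> where "\<theta> x y = bump n x (r x) y * (1 / \<rho> (S y))" for x y
  show ?thesis
  proof (rule that[of \<theta>])
    show "C1_box n x (r x) (\<theta> x)" if "x \<in> X" for x
      unfolding C1_box_def \<theta>_def
      using C1_on_mult[OF C1_on_bump inv_C1] bump_zero[of _ n x "r x"] r[OF that] by auto
    show "(\<Sum>x\<in>X. \<theta> x y) = 1" if "y \<in> K" for y
    proof -
      have "\<rho> (S y) = S y" using y0(2)[OF that] by (simp add: \<rho>_def m_def)
      then have "(\<Sum>x\<in>X. \<theta> x y) = S y * (1 / S y)"
        unfolding \<theta>_def by (simp only: S_def sum_distrib_right[symmetric])
      then show ?thesis using S_pos[OF that] by simp
    qed
  qed
qed

text \<open>Both sides are additive in \<open>f\<close>, so only the localised pieces matter. A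
  piece supported inside \<Omega> contributes 0 to either side; a piece supported in a boundary
  chart is covered by the case of a graph.\<close>

theorem divergence_theorem:
  assumes \<Omega>: "smooth_bounded_domain n \<Omega>" and \<sigma>: "is_surface_measure n \<Omega> \<sigma>"
    and f: "C1_on n V f" and V: "closure \<Omega> \<subseteq> V" and k: "k < n"
  shows "set_integrable (lebesgue_coords n) \<Omega> (partial k f)"
    "set_integrable \<sigma> (closure \<Omega> - \<Omega>) (\<lambda>x. f x * exterior_normal n \<Omega> x k)"
    "(LINT x:\<Omega>|lebesgue_coords n. partial k f x) = (LINT x:closure \<Omega> - \<Omega>|\<sigma>. f x * exterior_normal n \<Omega> x k)"
proof -
  let ?F = "closure \<Omega> - \<Omega>"
  have o: "openin (Euclidean_space n) \<Omega>" using \<Omega> by (simp add: smooth_bounded_domain_def)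
  have sub: "\<Omega> \<subseteq> coord_space n" using openin_coord_space_subset[OF o] .
  have oV: "openin (Euclidean_space n) V" using C1_onD(1)[OF f] .
  have K: "compact (closure \<Omega>)" "closure \<Omega> \<subseteq> coord_space n"
    using compact_closure_bounded_domain[OF \<Omega>] closure_minimal[OF sub closed_coord_space] by auto
  have "\<exists>r>0. closed_box n x r \<subseteq> V \<and>
      (closed_box n x r \<subseteq> \<Omega> \<or> (\<exists>U i s g. boundary_chart n \<Omega> U i s g \<and> closed_box n x r \<subseteq> U))"
    if x: "x \<in> closure \<Omega>" for x
  proof (cases "x \<in> \<Omega>")
    case True
    then obtain r where "r > 0" "closed_box n x r \<subseteq> V \<inter> \<Omega>"
      using closed_box_in_open[OF openin_Int[OF oV o]] x V by blast
    then show ?thesis by auto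
  next
    case False
    then obtain U i s g where U: "x \<in> U" "boundary_chart n \<Omega> U i s g"
      using x \<Omega> unfolding smooth_bounded_domain_def frontier_of_coord_space[OF o] by blast
    then have "openin (Euclidean_space n) U" by (simp add: boundary_chart_def)
    then obtain r where "r > 0" "closed_box n x r \<subseteq> V \<inter> U"
      using closed_box_in_open[OF openin_Int[OF oV]] x V U by blast
    then show ?thesis using U(2) by blast
  qed
  then obtain r where r: "\<And>x. x \<in> closure \<Omega> \<Longrightarrow> r x > 0" "\<And>x. x \<in> closure \<Omega> \<Longrightarrow> closed_box n x (r x) \<subseteq> V"
    "\<And>x. x \<in> closure \<Omega> \<Longrightarrow> closed_box n x (r x) \<subseteq> \<Omega> \<or> (\<exists>U i s g. boundary_chart n \<Omega> U i s g \<and> closed_box n x (r x) \<subseteq> U)"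
    by metis
  obtain X where X: "finite X" "X \<subseteq> closure \<Omega>" "closure \<Omega> \<subseteq> (\<Union>x\<in>X. open_box n x (r x))"
    using finite_box_cover[OF K, of r] r(1) by metis
  obtain \<theta> where \<theta>: "\<And>x. x \<in> X \<Longrightarrow> C1_box n x (r x) (\<theta> x)" "\<And>y. y \<in> closure \<Omega> \<Longrightarrow> (\<Sum>x\<in>X. \<theta> x y) = (1 :: real)"
    using partition_of_unity[OF K X(1,3)] r(1) X(2) by (metis subsetD)
  define h where "h x y = (if y \<in> V then \<theta> x y * f y else 0)" for x y
  have h: "C1_box n x (r x) (h x)" if "x \<in> X" for x
    unfolding h_def using X(2) that by (intro C1_box_extend_zero[OF f \<theta>(1)] r(2)) auto
  have loc: "set_integrable (lebesgue_coords n) \<Omega> (partial k (h x)) \<and>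
      set_integrable \<sigma> ?F (\<lambda>y. h x y * exterior_normal n \<Omega> y k) \<and>
      (LINT y:\<Omega>|lebesgue_coords n. partial k (h x) y) = (LINT y:?F|\<sigma>. h x y * exterior_normal n \<Omega> y k)"
    if x: "x \<in> X" for x
  proof -
    have int: "set_integrable (lebesgue_coords n) \<Omega> (partial k (h x))"
      using h[OF x] k by (intro set_integrable_box_support[OF openin_coord_space_borel[OF o] sub]
          C1_onD(4)[OF C1_boxD(1)] C1_box_partial_zero) auto
    from r(3) X(2) x consider "closed_box n x (r x) \<subseteq> \<Omega>" |
      U i s g where "boundary_chart n \<Omega> U i s g" "closed_box n x (r x) \<subseteq> U" by blast
    then show ?thesis
    proof cases
      case 1
      \<comment> \<open>The boundary term vanishes pointwise, and the volume term is an integral of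
        a derivative over the whole coordinate subspace.\<close>
      have "h x y = 0" if "y \<in> ?F" for y
        using C1_boxD(2)[OF h[OF x], of y] 1 that K(2) by auto
      then have F0: "indicator ?F y *\<^sub>R (h x y * exterior_normal n \<Omega> y k) = 0" for y
        by (cases "y \<in> ?F") simp_all
      have "indicator \<Omega> y *\<^sub>R partial k (h x) y = indicator (coord_space n) y *\<^sub>R partial k (h x) y" for y
        using C1_box_partial_zero[OF h[OF x] k, of y] 1 sub by (auto simp: indicator_def)
      then have "(LINT y:\<Omega>|lebesgue_coords n. partial k (h x) y) = (LINT y:coord_space n|lebesgue_coords n. partial k (h x) y)"
        unfolding set_lebesgue_integral_def by (simp only:)
      also have "\<dots> = 0"
        using closed_coord_space k by (intro integral_partial_invariant_set[OF h[OF x] k])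
          (auto simp: mem_coord_space)
      finally show ?thesis using int unfolding set_integrable_def set_lebesgue_integral_def F0 by simp
    next
      case 2
      interpret graph_domain n i s g
        using 2(1) by unfold_locales (auto simp: boundary_chart_def intro: C1_on_if_smooth_on)
      interpret boundary_chart_domain n i s g \<Omega> U
        using o 2(1) by unfold_locales
      show ?thesis using int divergence_theorem_chart[OF \<sigma> h[OF x] 2(2) k] by blast
    qed
  qed
  have f_eq: "f y = (\<Sum>x\<in>X. h x y)" if "y \<in> closure \<Omega>" for y
  proof -
    have "(\<Sum>x\<in>X. h x y) = (\<Sum>x\<in>X. \<theta> x y) * f y"
      using that V unfolding sum_distrib_right by (intro sum.cong) (auto simp: h_def)
    then show ?thesis using \<theta>(2)[OF that] by simp
  qed
  have partial_eq: "partial k f y = (\<Sum>x\<in>X. partial k (h x) y)" if y: "y \<in> \<Omega>" for y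
  proof -
    have "partial k f y = partial k (\<lambda>y. \<Sum>x\<in>X. h x y) y"
      using f_eq closure_subset[of \<Omega>] by (intro partial_cong_open[OF o y k]) auto
    also have "\<dots> = (\<Sum>x\<in>X. partial k (h x) y)"
      using y sub by (intro partial_sum[of X n "coord_space n"] C1_boxD(1)[OF h] k) auto
    finally show ?thesis .
  qed
  have 1: "indicator \<Omega> y *\<^sub>R partial k f y = (\<Sum>x\<in>X. indicator \<Omega> y *\<^sub>R partial k (h x) y)" for y
    by (cases "y \<in> \<Omega>") (simp_all add: partial_eq)
  have 2: "indicator ?F y *\<^sub>R (f y * exterior_normal n \<Omega> y k) = (\<Sum>x\<in>X. indicator ?F y *\<^sub>R (h x y * exterior_normal n \<Omega> y k))" for y
    by (cases "y \<in> ?F") (simp_all add: f_eq sum_distrib_right)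
  show "set_integrable (lebesgue_coords n) \<Omega> (partial k f)"
    unfolding set_integrable_def 1 using loc by (intro Bochner_Integration.integrable_sum) (auto simp: set_integrable_def)
  show "set_integrable \<sigma> ?F (\<lambda>x. f x * exterior_normal n \<Omega> x k)"
    unfolding set_integrable_def 2 using loc by (intro Bochner_Integration.integrable_sum) (auto simp: set_integrable_def)
  show "(LINT x:\<Omega>|lebesgue_coords n. partial k f x) = (LINT x:?F|\<sigma>. f x * exterior_normal n \<Omega> x k)"
  proof -
    have "(LINT x:\<Omega>|lebesgue_coords n. partial k f x) = (\<Sum>x\<in>X. LINT y:\<Omega>|lebesgue_coords n. partial k (h x) y)"
      unfolding set_lebesgue_integral_def 1 using loc
      by (intro Bochner_Integration.integral_sum) (auto simp: set_integrable_def)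
    also have "\<dots> = (\<Sum>x\<in>X. LINT y:?F|\<sigma>. h x y * exterior_normal n \<Omega> y k)"
      using loc by (intro sum.cong) auto
    also have "\<dots> = (LINT x:?F|\<sigma>. f x * exterior_normal n \<Omega> x k)"
      unfolding set_lebesgue_integral_def 2 using loc
      by (intro Bochner_Integration.integral_sum[symmetric]) (auto simp: set_integrable_def)
    finally show ?thesis .
  qed
qed

section \<open>The regularised flux\<close>

lemma Ck_on_subset: "Ck_on n k U f \<Longrightarrow> V \<subseteq> U \<Longrightarrow> Ck_on n k V f"
proof (induction k arbitrary: f)
  case 0
  then show ?case by (auto intro: continuous_map_from_subtopology_mono)
next
  case (Suc k)
  then show ?case by (auto intro: continuous_map_from_subtopology_mono)
qed

lemma smooth_on_subset: "smooth_on n U f \<Longrightarrow> V \<subseteq> U \<Longrightarrow> smooth_on n V f"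
  unfolding smooth_on_def using Ck_on_subset by blast

lemma smooth_on_iterated_partial: "smooth_on n U f \<Longrightarrow> i < n \<Longrightarrow> smooth_on n U ((partial i ^^ m) f)"
  by (induction m) (auto intro: smooth_on_partial)

text \<open>The one-variable bound is applied on every line in direction j to the iterated partial
  derivatives in that direction. Its constant depends on the side of the box and on bounds for two
  of these derivatives over the box, not on the line, so integrating over the remaining coordinates
  costs only the finite measure of the base.\<close>

lemma nn_integral_partial_powr_box:
  assumes V: "openin (Euclidean_space n) V" and w: "smooth_on n V w" and Q: "closed_box n c r \<subseteq> V" and r: "r > 0"
    and \<alpha>: "0 < \<alpha>" "\<alpha> < 1" and j: "j < n"
  shows "(\<integral>\<^sup>+x. ennreal (\<bar>partial j w x\<bar> * \<bar>w x\<bar> powr (\<alpha> - 1)) * indicator (closed_box n c r) x \<partial>lebesgue_coords n) < \<infinity>"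
proof -
  let ?Q = "closed_box n c r"
  let ?J = "{..<n} - {j}"
  define D where "D m = (partial j ^^ m) w" for m
  have D0: "D 0 = w" "D 1 = partial j w" by (simp_all add: D_def)
  have D: "C1_on n V (D m)" for m
    unfolding D_def by (intro C1_on_if_smooth_on V smooth_on_iterated_partial w j)
  have D_Suc: "partial j (D m) = D (Suc m)" for m by (simp add: D_def)
  obtain k :: nat where "1 / \<alpha> < real k" using reals_Archimedean2 by blast
  then have k: "real k * \<alpha> > 1" using \<alpha> by (simp add: field_simps)
  have bd: "\<exists>B\<ge>0. \<forall>x\<in>?Q. \<bar>D m x\<bar> \<le> B" for m
    using bounded_on_compact[OF compact_closed_box continuous_on_subset[OF C1_onD(2)[OF D] Q]] by metis
  obtain M1 Mk where M1: "M1 \<ge> 0" "\<And>x. x \<in> ?Q \<Longrightarrow> \<bar>D 1 x\<bar> \<le> M1" and Mk: "Mk \<ge> 0" "\<And>x. x \<in> ?Q \<Longrightarrow> \<bar>D k x\<bar> \<le> Mk"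
    using bd[of 1] bd[of k] by metis
  define M where "M = max M1 Mk"
  have M: "M \<ge> 0" "\<And>x. x \<in> ?Q \<Longrightarrow> \<bar>D 1 x\<bar> \<le> M" "\<And>x. x \<in> ?Q \<Longrightarrow> \<bar>D k x\<bar> \<le> M"
    using M1 Mk by (auto simp: M_def le_max_iff_disj)
  have L0: "0 \<le> 2 * r" using r by simp
  obtain C where C: "\<forall>(D :: nat \<Rightarrow> real \<Rightarrow> real) c d. c \<le> d \<longrightarrow> d - c \<le> 2 * r \<longrightarrow>
      (\<forall>m<k. \<forall>t\<in>{c..d}. (D m has_real_derivative D (Suc m) t) (at t)) \<longrightarrow>
      continuous_on {c..d} (D 1) \<longrightarrow> (\<forall>t\<in>{c..d}. \<bar>D k t\<bar> \<le> M \<and> \<bar>D 1 t\<bar> \<le> M) \<longrightarrow>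
      (\<integral>\<^sup>+t. ennreal (\<bar>D 1 t\<bar> * \<bar>D 0 t\<bar> powr (\<alpha> - 1)) * indicator {c..d} t \<partial>lborel) \<le> ennreal C"
    using nn_integral_deriv_powr_bound[OF \<alpha> k M(1) L0] by blast
  define h where "h x = ennreal (\<bar>D 1 x\<bar> * \<bar>D 0 x\<bar> powr (\<alpha> - 1)) * indicator ?Q x" for x
  define B where "B = {y :: nat \<Rightarrow> real. \<forall>i\<in>?J. \<bar>y i - c i\<bar> \<le> r}"
  have B [measurable]: "B \<in> sets borel" unfolding B_def by (rule coord_box_borel)
  have meas: "h \<in> borel_measurable borel"
  proof -
    have [measurable]: "(\<lambda>x. D m x * indicator ?Q x) \<in> borel_measurable borel" for m
      by (intro borel_measurable_continuous_on_times_indicator closed_box_borel continuous_on_subset[OF C1_onD(2)[OF D] Q])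
    have "(\<lambda>x. ennreal (\<bar>D 1 x * indicator ?Q x\<bar> * \<bar>D 0 x * indicator ?Q x\<bar> powr (\<alpha> - 1)) * indicator ?Q x) \<in> borel_measurable borel"
      by measurable
    also have "(\<lambda>x. ennreal (\<bar>D 1 x * indicator ?Q x\<bar> * \<bar>D 0 x * indicator ?Q x\<bar> powr (\<alpha> - 1)) * indicator ?Q x) = h"
      by (auto simp: h_def fun_eq_iff split: split_indicator)
    finally show ?thesis .
  qed
  have "(\<integral>\<^sup>+x. h x \<partial>lebesgue_coords n) = (\<integral>\<^sup>+y. \<integral>\<^sup>+t. h (y(j := t)) \<partial>lborel \<partial>lborel_coords ?J)"
    by (rule nn_integral_coords_line[OF j meas])
  also have "\<dots> \<le> (\<integral>\<^sup>+y. ennreal C * indicator B y \<partial>lborel_coords ?J)"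
  proof (rule nn_integral_mono_AE)
    show "AE y in lborel_coords ?J. (\<integral>\<^sup>+t. h (y(j := t)) \<partial>lborel) \<le> ennreal C * indicator B y"
      using AE_lborel_coords_mem[of ?J n, OF Diff_subset]
    proof eventually_elim
      case (elim y)
      have Q_iff: "y(j := t) \<in> ?Q \<longleftrightarrow> y \<in> B \<and> t \<in> {c j - r..c j + r}" for t
        using elim j by (auto simp: closed_box_def B_def abs_le_iff)
      show ?case
      proof (cases "y \<in> B")
        case True
        have "(\<integral>\<^sup>+t. h (y(j := t)) \<partial>lborel) =
          (\<integral>\<^sup>+t. ennreal (\<bar>D 1 (y(j := t))\<bar> * \<bar>D 0 (y(j := t))\<bar> powr (\<alpha> - 1)) * indicator {c j - r..c j + r} t \<partial>lborel)"
          unfolding h_def using Q_iff True by (intro nn_integral_cong) (simp add: indicator_def)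
        also have "\<dots> \<le> ennreal C"
        proof (rule C[rule_format, of "c j - r" "c j + r" "\<lambda>m t. D m (y(j := t))"])
          fix m t assume t: "t \<in> {c j - r..c j + r}"
          then have "y(j := t) \<in> ?Q" using Q_iff True by simp
          then have "y(j := t) \<in> V" using Q by auto
          from C1_onD(3)[OF D j this, of m] show "((\<lambda>t. D m (y(j := t))) has_real_derivative D (Suc m) (y(j := t))) (at t)"
            by (simp add: D_Suc)
        next
          have "continuous_on {c j - r..c j + r} (\<lambda>t. y(j := t))"
          proof (rule continuous_on_coordinatewise_then_product)
            show "continuous_on {c j - r..c j + r} (\<lambda>t. (y(j := t)) l)" for l by (cases "l = j") auto
          qed
          then show "continuous_on {c j - r..c j + r} (\<lambda>t. D 1 (y(j := t)))"
            by (rule continuous_on_compose2[OF C1_onD(2)[OF D]]) (use Q Q_iff True in auto)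
        next
          show "\<bar>D k (y(j := t))\<bar> \<le> M \<and> \<bar>D 1 (y(j := t))\<bar> \<le> M" if "t \<in> {c j - r..c j + r}" for t
            using that M(2,3)[of "y(j := t)"] Q_iff True by simp
        qed (use r in auto)
        finally show ?thesis using True by simp
      next
        case False
        then have "h (y(j := t)) = 0" for t using Q_iff by (simp add: h_def)
        then show ?thesis by simp
      qed
    qed
  qed
  also have "\<dots> = ennreal C * emeasure (lborel_coords ?J) B"
    by (intro nn_integral_cmult_indicator) simp
  also have "\<dots> < \<infinity>"
    using emeasure_lborel_coords_box[of ?J c r] by (auto simp: B_def ennreal_mult_less_top)
  finally show ?thesis unfolding h_def D0 .
qed

lemma set_integrable_partial_powr:
  assumes V: "openin (Euclidean_space n) V" and w: "smooth_on n V w" and K: "compact K" "K \<subseteq> V"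
    and A: "A \<in> sets borel" "A \<subseteq> K" and \<alpha>: "0 < \<alpha>" "\<alpha> < 1" and j: "j < n"
  shows "set_integrable (lebesgue_coords n) A (\<lambda>x. \<bar>partial j w x\<bar> * \<bar>w x\<bar> powr (\<alpha> - 1))"
proof -
  define h where "h x = \<bar>partial j w x\<bar> * \<bar>w x\<bar> powr (\<alpha> - 1)" for x
  have Kc: "K \<subseteq> coord_space n" using K openin_coord_space_subset[OF V] by auto
  have "\<exists>r>0. closed_box n x r \<subseteq> V" if "x \<in> K" for x
    using closed_box_in_open[OF V, of x] that K(2) by blast
  then obtain r where r: "\<And>x. x \<in> K \<Longrightarrow> r x > 0" "\<And>x. x \<in> K \<Longrightarrow> closed_box n x (r x) \<subseteq> V" by metis
  obtain X where X: "finite X" "X \<subseteq> K" "K \<subseteq> (\<Union>x\<in>X. open_box n x (r x))"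
    using finite_box_cover[OF K(1) Kc, of r] r(1) by metis
  have w1: "C1_on n V w" by (intro C1_on_if_smooth_on V w)
  have h_meas: "(\<lambda>x. h x * indicator S x) \<in> borel_measurable borel" if "S \<in> sets borel" "S \<subseteq> V" for S
  proof -
    have [measurable]: "(\<lambda>x. w x * indicator S x) \<in> borel_measurable borel"
      "(\<lambda>x. partial j w x * indicator S x) \<in> borel_measurable borel" "S \<in> sets borel"
      using that by (auto intro!: borel_measurable_continuous_on_times_indicator
          continuous_on_subset[OF C1_onD(2)[OF w1]] continuous_on_subset[OF C1_onD(4)[OF w1 j]])
    have "(\<lambda>x. \<bar>partial j w x * indicator S x\<bar> * \<bar>w x * indicator S x\<bar> powr (\<alpha> - 1) * indicator S x) \<in> borel_measurable borel"
      by measurable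
    also have "(\<lambda>x. \<bar>partial j w x * indicator S x\<bar> * \<bar>w x * indicator S x\<bar> powr (\<alpha> - 1) * indicator S x) = (\<lambda>x. h x * indicator S x)"
      by (auto simp: h_def fun_eq_iff split: split_indicator)
    finally show ?thesis .
  qed
  have ennreal_h: "ennreal (h x) * indicator S x = ennreal (h x * indicator S x)" for x S
    by (auto split: split_indicator)
  have "(\<integral>\<^sup>+x. ennreal (h x * indicator A x) \<partial>lebesgue_coords n)
    \<le> (\<integral>\<^sup>+x. (\<Sum>c\<in>X. ennreal (h x) * indicator (closed_box n c (r c)) x) \<partial>lebesgue_coords n)"
  proof (rule nn_integral_mono)
    fix x
    show "ennreal (h x * indicator A x) \<le> (\<Sum>c\<in>X. ennreal (h x) * indicator (closed_box n c (r c)) x)"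
    proof (cases "x \<in> A")
      case True
      then obtain c where c: "c \<in> X" "x \<in> closed_box n c (r c)" using A(2) X(3) open_box_subset by blast
      then have "ennreal (h x) * indicator (closed_box n c (r c)) x \<le> (\<Sum>c\<in>X. ennreal (h x) * indicator (closed_box n c (r c)) x)"
        by (intro member_le_sum X(1)) auto
      then show ?thesis using True c by simp
    qed simp
  qed
  also have "\<dots> = (\<Sum>c\<in>X. \<integral>\<^sup>+x. ennreal (h x) * indicator (closed_box n c (r c)) x \<partial>lebesgue_coords n)"
    unfolding ennreal_h using X(2) r(2) h_meas[OF closed_box_borel]
    by (intro nn_integral_sum) (auto intro!: measurable_compose[OF _ measurable_ennreal])
  also have "\<dots> < \<infinity>"
  proof -
    have "(\<integral>\<^sup>+x. ennreal (h x) * indicator (closed_box n c (r c)) x \<partial>lebesgue_coords n) < top" if "c \<in> X" for c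
      using nn_integral_partial_powr_box[OF V w r(2) r(1) \<alpha> j] X(2) that by (auto simp: h_def)
    then show ?thesis using X(1) by simp
  qed
  finally have fin: "(\<integral>\<^sup>+x. ennreal (h x * indicator A x) \<partial>lebesgue_coords n) < \<infinity>" .
  have "integrable (lebesgue_coords n) (\<lambda>x. h x * indicator A x)"
  proof (rule integrableI_bounded)
    show "(\<lambda>x. h x * indicator A x) \<in> borel_measurable (lebesgue_coords n)"
      using h_meas[OF A(1)] A(2) K(2) by auto
    have "norm (h x * indicator A x) = h x * indicator A x" for x by (simp add: h_def split: split_indicator)
    then show "(\<integral>\<^sup>+x. ennreal (norm (h x * indicator A x)) \<partial>lebesgue_coords n) < \<infinity>" using fin by simp
  qed
  then show ?thesis by (simp add: set_integrable_def h_def mult.commute)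
qed

section \<open>The flux, its regularisation and their derivatives\<close>

locale flux_domain =
  fixes n :: nat and \<Omega> V :: "(nat \<Rightarrow> real) set" and \<sigma> :: "(nat \<Rightarrow> real) measure"
    and a u :: "(nat \<Rightarrow> real) \<Rightarrow> real" and p :: real
  assumes \<Omega>: "smooth_bounded_domain n \<Omega>" and \<sigma>: "is_surface_measure n \<Omega> \<sigma>"
    and V: "openin (Euclidean_space n) V" "closure \<Omega> \<subseteq> V"
    and a: "C1_on n V a" and u: "smooth_on n V u" and p: "p > 1"
begin

abbreviation "w k \<equiv> partial k u"

definition N :: "(nat \<Rightarrow> real) \<Rightarrow> real" where "N x = (\<Sum>k<n. (w k x)\<^sup>2)"

definition q :: real where "q = (p - 2) / 2"

definition flux :: "real \<Rightarrow> nat \<Rightarrow> (nat \<Rightarrow> real) \<Rightarrow> real" where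
  "flux e j x = a x * (N x + e) powr q * w j x"

definition dflux :: "real \<Rightarrow> nat \<Rightarrow> (nat \<Rightarrow> real) \<Rightarrow> real" where
  "dflux e j x = partial j a x * (N x + e) powr q * w j x
     + a x * (q * (N x + e) powr (q - 1) * (\<Sum>k<n. 2 * w k x * partial j (w k) x)) * w j x
     + a x * (N x + e) powr q * partial j (w j) x"

text \<open>The common value, almost everywhere in \<Omega>, of the limit of
  \<open>dflux e j\<close> as e tends to 0 and of the classical derivative of the flux wherever that
  exists. On the zero set of the gradient this value is 0.\<close>

definition dflux0 :: "nat \<Rightarrow> (nat \<Rightarrow> real) \<Rightarrow> real" where
  "dflux0 j x = (if N x = 0 then 0 else dflux 0 j x)"

lemma open_\<Omega>: "openin (Euclidean_space n) \<Omega>" using \<Omega> by (simp add: smooth_bounded_domain_def)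

lemma \<Omega>_borel [measurable]: "\<Omega> \<in> sets borel" using openin_coord_space_borel[OF open_\<Omega>] .

lemma compact_K: "compact (closure \<Omega>)" using compact_closure_bounded_domain[OF \<Omega>] by blast

lemma \<Omega>_V: "\<Omega> \<subseteq> V" using V(2) closure_subset by blast

lemma w_smooth: "k < n \<Longrightarrow> smooth_on n V (w k)" by (rule smooth_on_partial[OF u])

lemma w_C1: "k < n \<Longrightarrow> C1_on n V (w k)" by (intro C1_on_if_smooth_on V w_smooth)

lemma N_nonneg: "N x \<ge> 0" by (simp add: N_def sum_nonneg)

lemma N_C1: "C1_on n V N"
  unfolding N_def[abs_def] power2_eq_square by (intro C1_on_sum C1_on_mult V w_C1) auto

lemma partial_N:
  assumes "j < n" "x \<in> V"
  shows "partial j N x = (\<Sum>k<n. 2 * w k x * partial j (w k) x)"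
proof -
  have "partial j N x = (\<Sum>k<n. partial j (\<lambda>x. w k x * w k x) x)"
    unfolding N_def[abs_def] power2_eq_square using assms
    by (intro partial_sum[of _ n V] C1_on_mult w_C1) auto
  also have "\<dots> = (\<Sum>k<n. 2 * w k x * partial j (w k) x)"
    using assms by (intro sum.cong refl partial_eqI) (auto intro!: DERIV_cong[OF partial_mult[OF w_C1 w_C1]])
  finally show ?thesis .
qed

lemma w_square_le_N: "k < n \<Longrightarrow> (w k x)\<^sup>2 \<le> N x"
  unfolding N_def by (intro member_le_sum) auto

lemma N_zero_iff: "N x = 0 \<longleftrightarrow> (\<forall>k<n. w k x = 0)"
  by (auto simp: N_def sum_nonneg_eq_0_iff)

lemma has_partial_flux:
  assumes j: "j < n" and x: "x \<in> V" and e: "N x + e > 0"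
  shows "((\<lambda>t. flux e j (x(j := t))) has_real_derivative dflux e j x) (at (x j))"
proof -
  have N: "((\<lambda>t. (N (x(j := t)) + e) powr q) has_real_derivative
      q * (N x + e) powr (q - 1) * (\<Sum>k<n. 2 * w k x * partial j (w k) x)) (at (x j))"
    using C1_onD(3)[OF N_C1 j x] e partial_N[OF j x]
    by (auto intro!: derivative_eq_intros)
  show ?thesis
    unfolding flux_def dflux_def
    by (rule DERIV_cong[OF DERIV_mult[OF DERIV_mult[OF C1_onD(3)[OF a j x] N] C1_onD(3)[OF w_C1[OF j] j x]]])
      (simp add: algebra_simps)
qed

lemma flux_C1: "e > 0 \<Longrightarrow> j < n \<Longrightarrow> C1_on n V (flux e j)"
  unfolding flux_def[abs_def]
proof (intro C1_on_mult a w_C1)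
  assume e: "e > 0"
  have pos: "N x + e > 0" for x using N_nonneg[of x] e by simp
  show "C1_on n V (\<lambda>x. (N x + e) powr q)"
  proof (rule C1_on_compose[OF N_C1, where h = "\<lambda>t. (t + e) powr q"])
    show "((\<lambda>t. (t + e) powr q) has_real_derivative q * (N x + e) powr (q - 1)) (at (N x))" for x
      using pos[of x] by (auto intro!: derivative_eq_intros)
    show "continuous_on (N ` V) (\<lambda>t. q * (t + e) powr (q - 1))"
      using pos by (intro continuous_intros) (auto simp: less_imp_neq[THEN not_sym])
  qed
qed

lemma partial_flux: "e > 0 \<Longrightarrow> j < n \<Longrightarrow> x \<in> V \<Longrightarrow> partial j (flux e j) x = dflux e j x"
  using N_nonneg[of x] by (intro partial_eqI has_partial_flux) auto

lemma p_flux_eq: "p_flux p n a u j = flux 0 j"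
proof
  fix x
  have "grad_norm n u x powr (p - 2) = N x powr q"
    unfolding q_def N_def grad_norm_square[symmetric]
    by (rule power2_powr_half[symmetric]) (simp add: grad_norm_def L2_set_nonneg)
  then show "p_flux p n a u j x = flux 0 j x" by (simp add: p_flux_def flux_def)
qed

text \<open>The factor |w_j| contributes half a power of N + e, and the resulting exponent q + 1/2 =
  (p - 1)/2 is positive. Hence the flux stays bounded as e tends to 0 even when q is
  negative.\<close>

lemma abs_flux_le:
  assumes "j < n" "0 \<le> e"
  shows "\<bar>flux e j x\<bar> \<le> \<bar>a x\<bar> * (N x + e) powr ((p - 1) / 2)"
proof -
  have "(w j x)\<^sup>2 \<le> N x + e" using w_square_le_N[OF assms(1), of x] assms(2) by simp
  then have "\<bar>w j x\<bar> \<le> sqrt (N x + e)" by (metis real_sqrt_abs real_sqrt_le_iff)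
  also have "\<dots> = (N x + e) powr (1 / 2)" using N_nonneg[of x] assms(2) by (simp add: powr_half_sqrt)
  finally have "(N x + e) powr q * \<bar>w j x\<bar> \<le> (N x + e) powr q * (N x + e) powr (1 / 2)"
    by (intro mult_left_mono) auto
  also have "\<dots> = (N x + e) powr ((p - 1) / 2)"
    by (simp add: powr_add[symmetric] q_def field_simps)
  finally have "\<bar>a x\<bar> * ((N x + e) powr q * \<bar>w j x\<bar>) \<le> \<bar>a x\<bar> * (N x + e) powr ((p - 1) / 2)"
    by (intro mult_left_mono) auto
  then show ?thesis by (simp add: flux_def abs_mult mult.assoc)
qed

text \<open>In the term with exponent q - 1 the two factors w_k and w_j satisfy |w_k w_j| \<le> N +
  e and restore the lost power. All second derivatives of u then appear as (N + e)^q |d_j w_k|, the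
  form that can be compared with |w_k|^(p-2) |d_j w_k|.\<close>

lemma abs_dflux_le:
  assumes j: "j < n" and e: "e > 0"
  shows "\<bar>dflux e j x\<bar> \<le> \<bar>partial j a x\<bar> * (N x + e) powr ((p - 1) / 2)
    + \<bar>a x\<bar> * ((2 * \<bar>q\<bar> + 1) * (\<Sum>k<n. (N x + e) powr q * \<bar>partial j (w k) x\<bar>))"
proof -
  define s where "s = N x + e"
  have s: "s > 0" using N_nonneg[of x] e by (simp add: s_def)
  have wle: "\<bar>w k x\<bar> \<le> sqrt s" if "k < n" for k
  proof -
    have "(w k x)\<^sup>2 \<le> s" using w_square_le_N[OF that, of x] e by (simp add: s_def)
    then show ?thesis by (metis real_sqrt_abs real_sqrt_le_iff)
  qed
  have 1: "\<bar>partial j a x * s powr q * w j x\<bar> \<le> \<bar>partial j a x\<bar> * s powr ((p - 1) / 2)"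
  proof -
    have "s powr q * \<bar>w j x\<bar> \<le> s powr q * s powr (1 / 2)"
      using wle[OF j] s by (intro mult_left_mono) (auto simp: powr_half_sqrt)
    also have "\<dots> = s powr ((p - 1) / 2)" by (simp add: powr_add[symmetric] q_def field_simps)
    finally have "\<bar>partial j a x\<bar> * (s powr q * \<bar>w j x\<bar>) \<le> \<bar>partial j a x\<bar> * s powr ((p - 1) / 2)"
      by (intro mult_left_mono) auto
    then show ?thesis by (simp add: abs_mult mult.assoc)
  qed
  define T where "T = (\<Sum>k<n. s powr q * \<bar>partial j (w k) x\<bar>)"
  have T: "s powr q * \<bar>partial j (w j) x\<bar> \<le> T"
    unfolding T_def using j by (intro member_le_sum[of j "{..<n}" "\<lambda>k. s powr q * \<bar>partial j (w k) x\<bar>"]) auto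
  have ss: "s powr (q - 1) * s = s powr q" using s by (simp add: powr_diff)
  have "\<bar>s powr (q - 1) * (\<Sum>k<n. 2 * w k x * partial j (w k) x) * w j x\<bar>
      = \<bar>\<Sum>k<n. s powr (q - 1) * (2 * w k x * partial j (w k) x * w j x)\<bar>"
    by (simp add: sum_distrib_left sum_distrib_right mult_ac)
  also have "\<dots> \<le> (\<Sum>k<n. \<bar>s powr (q - 1) * (2 * w k x * partial j (w k) x * w j x)\<bar>)" by (rule sum_abs)
  also have "\<dots> \<le> (\<Sum>k<n. 2 * (s powr q * \<bar>partial j (w k) x\<bar>))"
  proof (rule sum_mono)
    fix k assume k: "k \<in> {..<n}"
    have "\<bar>w k x\<bar> * \<bar>w j x\<bar> \<le> sqrt s * sqrt s" using wle[of k] wle[OF j] k s by (intro mult_mono) auto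
    then have "s powr (q - 1) * (\<bar>w k x\<bar> * \<bar>w j x\<bar>) \<le> s powr q"
      using mult_left_mono[of "\<bar>w k x\<bar> * \<bar>w j x\<bar>" s "s powr (q - 1)"] s ss by simp
    from mult_right_mono[OF this, of "2 * \<bar>partial j (w k) x\<bar>"]
    show "\<bar>s powr (q - 1) * (2 * w k x * partial j (w k) x * w j x)\<bar> \<le> 2 * (s powr q * \<bar>partial j (w k) x\<bar>)"
      by (simp add: abs_mult mult_ac)
  qed
  also have "\<dots> = 2 * T" by (simp add: T_def sum_distrib_left)
  finally have 2: "\<bar>s powr (q - 1) * (\<Sum>k<n. 2 * w k x * partial j (w k) x) * w j x\<bar> \<le> 2 * T" .
  have "\<bar>a x * (q * s powr (q - 1) * (\<Sum>k<n. 2 * w k x * partial j (w k) x)) * w j x\<bar>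
      = \<bar>a x\<bar> * (\<bar>q\<bar> * \<bar>s powr (q - 1) * (\<Sum>k<n. 2 * w k x * partial j (w k) x) * w j x\<bar>)"
    by (simp add: abs_mult mult_ac)
  also have "\<dots> \<le> \<bar>a x\<bar> * (\<bar>q\<bar> * (2 * T))" by (intro mult_left_mono 2) auto
  finally have 3: "\<bar>a x * (q * s powr (q - 1) * (\<Sum>k<n. 2 * w k x * partial j (w k) x)) * w j x\<bar> \<le> \<bar>a x\<bar> * (\<bar>q\<bar> * (2 * T))" .
  have 4: "\<bar>a x * s powr q * partial j (w j) x\<bar> \<le> \<bar>a x\<bar> * T"
    using mult_left_mono[OF T, of "\<bar>a x\<bar>"] by (simp add: abs_mult mult.assoc)
  have "\<bar>dflux e j x\<bar> \<le> \<bar>partial j a x\<bar> * s powr ((p - 1) / 2) + \<bar>a x\<bar> * (\<bar>q\<bar> * (2 * T)) + \<bar>a x\<bar> * T"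
    unfolding dflux_def s_def[symmetric] using 1 3 4 by linarith
  then show ?thesis by (simp add: s_def T_def algebra_simps)
qed

lemma flux_tendsto:
  assumes "j < n"
  shows "((\<lambda>e. flux e j x) \<longlongrightarrow> flux 0 j x) (at_right 0)"
proof (cases "N x = 0")
  case True
  then have "w j x = 0" using assms N_zero_iff by blast
  then show ?thesis by (simp add: flux_def)
next
  case False
  then show ?thesis unfolding flux_def by (auto intro!: tendsto_eq_intros)
qed

text \<open>At a zero of the gradient the first two summands contain the factor
  \<open>w j x\<close>, which is 0. The last summand is removed by the assumption, which holds
  almost everywhere.\<close>

lemma dflux_tendsto:
  assumes "j < n" "N x = 0 \<Longrightarrow> partial j (w j) x = 0"
  shows "((\<lambda>e. dflux e j x) \<longlongrightarrow> dflux0 j x) (at_right 0)"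
proof (cases "N x = 0")
  case True
  then have "w j x = 0" using assms N_zero_iff by blast
  then show ?thesis using True assms(2) by (simp add: dflux_def dflux0_def)
next
  case False
  then show ?thesis unfolding dflux_def dflux0_def by (auto intro!: tendsto_eq_intros)
qed

section \<open>Derivatives on the zero set of the gradient\<close>

lemma AE_partial_w_zero:
  assumes j: "j < n" and k: "k < n"
  shows "AE x in lebesgue_coords n. x \<in> \<Omega> \<and> w k x = 0 \<longrightarrow> partial j (w k) x = 0"
proof -
  define Z where "Z = {x \<in> closure \<Omega>. w k x = 0}"
  have "closedin (top_of_set (closure \<Omega>)) Z"
    unfolding Z_def using continuous_closedin_preimage_constant[OF continuous_on_subset[OF C1_onD(2)[OF w_C1[OF k]] V(2)], of 0] by simp
  then have Z: "compact Z" by (rule closedin_compact[OF compact_K])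
  show ?thesis
    using AE_islimpt_line[OF Z j]
  proof eventually_elim
    case (elim x)
    show ?case
    proof
      assume x: "x \<in> \<Omega> \<and> w k x = 0"
      then have "x \<in> Z" using closure_subset by (auto simp: Z_def)
      then have lim: "x j islimpt {t. x(j := t) \<in> Z}" using elim by simp
      have deriv: "((\<lambda>t. w k (x(j := t))) has_real_derivative partial j (w k) x) (at (x j))"
        using x \<Omega>_V by (intro C1_onD(3)[OF w_C1[OF k] j]) auto
      show "partial j (w k) x = 0"
        by (rule DERIV_zero_if_islimpt[OF deriv lim]) (use x in \<open>simp_all add: Z_def\<close>)
    qed
  qed
qed

text \<open>Off the zero set of the gradient the flux is differentiable by the product and chain
  rules. On it the flux vanishes, and almost every point is a limit point of the set along the line;
  a classical derivative, if there is one, must then be 0. This links the hypothesis on the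
  divergence to the limit of the regularised problems.\<close>

lemma AE_dflux0:
  assumes j: "j < n"
  shows "AE x in lebesgue_coords n. x \<in> \<Omega> \<and> has_partial j (p_flux p n a u j) x \<longrightarrow>
    partial j (p_flux p n a u j) x = dflux0 j x"
proof -
  define Z where "Z = {x \<in> closure \<Omega>. N x = 0}"
  have "closedin (top_of_set (closure \<Omega>)) Z"
    unfolding Z_def using continuous_closedin_preimage_constant[OF continuous_on_subset[OF C1_onD(2)[OF N_C1] V(2)], of 0] by simp
  then have Z: "compact Z" by (rule closedin_compact[OF compact_K])
  show ?thesis
    using AE_islimpt_line[OF Z j]
  proof eventually_elim
    case (elim x)
    show ?case
    proof
      assume x: "x \<in> \<Omega> \<and> has_partial j (p_flux p n a u j) x"
      show "partial j (p_flux p n a u j) x = dflux0 j x"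
      proof (cases "N x = 0")
        case False
        then have "N x + 0 > 0" using N_nonneg[of x] by simp
        from has_partial_flux[OF j _ this] x \<Omega>_V False show ?thesis
          unfolding p_flux_eq dflux0_def by (auto intro: partial_eqI)
      next
        case True
        then have xZ: "x \<in> Z" using x closure_subset by (auto simp: Z_def)
        then have lim: "x j islimpt {t. x(j := t) \<in> Z}" using elim by simp
        have deriv: "((\<lambda>t. flux 0 j (x(j := t))) has_real_derivative partial j (flux 0 j) x) (at (x j))"
          using has_partial_deriv x unfolding p_flux_eq by blast
        have zero: "flux 0 j y = 0" if "y \<in> Z" for y
          using that j N_zero_iff[of y] by (auto simp: Z_def flux_def)
        have "partial j (flux 0 j) x = 0"
          by (rule DERIV_zero_if_islimpt[OF deriv lim]) (use xZ zero in simp_all)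
        then show ?thesis using True by (simp add: p_flux_eq dflux0_def)
      qed
    qed
  qed
qed

end

section \<open>Integration by parts against the flux\<close>

context flux_domain
begin

abbreviation "F \<equiv> closure \<Omega> - \<Omega>"

abbreviation "\<nu> \<equiv> exterior_normal n \<Omega>"

lemma F_V: "F \<subseteq> V" using V(2) by blast

lemma F_borel [measurable]: "F \<in> sets borel" using \<Omega>_borel by auto

lemma sets_\<sigma> [simp, measurable_cong]: "sets \<sigma> = sets borel" using \<sigma> by (simp add: is_surface_measure_def)

lemma bounded_on_closure:
  fixes f :: "(nat \<Rightarrow> real) \<Rightarrow> real"
  assumes "continuous_on V f"
  obtains B where "B \<ge> 0" "\<And>x. x \<in> closure \<Omega> \<Longrightarrow> \<bar>f x\<bar> \<le> B"
  using bounded_on_compact[OF compact_K continuous_on_subset[OF assms V(2)]] by blast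

lemma set_integrable_continuous:
  fixes f :: "(nat \<Rightarrow> real) \<Rightarrow> real"
  assumes "continuous_on V f"
  shows "set_integrable (lebesgue_coords n) \<Omega> f"
proof -
  obtain B where "\<And>x. x \<in> closure \<Omega> \<Longrightarrow> \<bar>f x\<bar> \<le> B" using bounded_on_closure[OF assms] by blast
  then have B: "\<And>x. x \<in> \<Omega> \<Longrightarrow> \<bar>f x\<bar> \<le> B" using closure_subset by blast
  obtain R where "closure \<Omega> \<subseteq> closed_box n (\<lambda>_. 0) R" using compact_closure_bounded_domain[OF \<Omega>] by blast
  then have "\<Omega> \<subseteq> closed_box n (\<lambda>_. 0) R" using closure_subset by blast
  then show ?thesis
    by (rule set_integrable_bounded[OF \<Omega>_borel _ continuous_on_subset[OF assms \<Omega>_V] B])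
qed

lemma set_integrable_const: "set_integrable (lebesgue_coords n) \<Omega> (\<lambda>_. C :: real)"
  by (rule set_integrable_continuous) (rule continuous_on_const)

text \<open>For p < 2 the exponent q is negative, so (N + e)^q \<le> |w_k|^(p-2) wherever w_k is
  nonzero, and the one-variable estimate applies with exponent p - 1 between 0 and 1. Where w_k = 0,
  almost everywhere also d_j w_k = 0 and there is nothing to bound. For p \<ge> 2 the power is
  bounded by a constant.\<close>

lemma dflux_dominated:
  assumes j: "j < n"
  obtains G where "set_integrable (lebesgue_coords n) \<Omega> G"
    "\<And>e. 0 < e \<Longrightarrow> e \<le> 1 \<Longrightarrow> AE x in lebesgue_coords n. x \<in> \<Omega> \<longrightarrow> \<bar>dflux e j x\<bar> \<le> G x"
proof -
  obtain BN where BN: "BN \<ge> 0" "\<And>x. x \<in> closure \<Omega> \<Longrightarrow> \<bar>N x\<bar> \<le> BN"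
    using bounded_on_closure[OF C1_onD(2)[OF N_C1]] by blast
  obtain Ba where Ba: "Ba \<ge> 0" "\<And>x. x \<in> closure \<Omega> \<Longrightarrow> \<bar>a x\<bar> \<le> Ba"
    using bounded_on_closure[OF C1_onD(2)[OF a]] by blast
  obtain Bd where Bd: "Bd \<ge> 0" "\<And>x. x \<in> closure \<Omega> \<Longrightarrow> \<bar>partial j a x\<bar> \<le> Bd"
    using bounded_on_closure[OF C1_onD(4)[OF a j]] by blast
  \<comment> \<open>The exponent \<open>p - 1 - 1\<close> is left in the form \<alpha> - 1 with
    \<alpha> = p - 1, as in the integrability lemma.\<close>
  define H where "H k x = \<bar>partial j (w k) x\<bar> * (if p < 2 then \<bar>w k x\<bar> powr (p - 1 - 1) else (BN + 1) powr q)" for k x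
  have H_int: "set_integrable (lebesgue_coords n) \<Omega> (H k)" if k: "k < n" for k
  proof (cases "p < 2")
    case True
    then have "set_integrable (lebesgue_coords n) \<Omega> (\<lambda>x. \<bar>partial j (w k) x\<bar> * \<bar>w k x\<bar> powr (p - 1 - 1))"
      using p by (intro set_integrable_partial_powr[OF V(1) w_smooth[OF k] compact_K V(2) \<Omega>_borel closure_subset _ _ j]) auto
    with True show ?thesis by (simp add: H_def[abs_def])
  next
    case False
    then show ?thesis unfolding H_def[abs_def]
      by (auto intro!: set_integrable_continuous continuous_on_mult continuous_on_rabs continuous_on_const C1_onD(4)[OF w_C1[OF k] j])
  qed
  have H_nonneg: "H k x \<ge> 0" for k x by (simp add: H_def)
  have H_bound: "AE x in lebesgue_coords n. x \<in> \<Omega> \<longrightarrow> (N x + e) powr q * \<bar>partial j (w k) x\<bar> \<le> H k x"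
    if k: "k < n" and e: "0 < e" "e \<le> 1" for k e
    using AE_partial_w_zero[OF j k]
  proof eventually_elim
    case (elim x)
    show ?case
    proof
      assume x: "x \<in> \<Omega>"
      then have xc: "x \<in> closure \<Omega>" using closure_subset by blast
      show "(N x + e) powr q * \<bar>partial j (w k) x\<bar> \<le> H k x"
      proof (cases "w k x = 0")
        case True
        then show ?thesis using elim x H_nonneg by simp
      next
        case False
        have "(N x + e) powr q \<le> (if p < 2 then \<bar>w k x\<bar> powr (p - 1 - 1) else (BN + 1) powr q)"
        proof (cases "p < 2")
          case True
          have "(w k x)\<^sup>2 \<le> N x + e" using w_square_le_N[OF k, of x] e by simp
          then have "(N x + e) powr q \<le> (\<bar>w k x\<bar>\<^sup>2) powr q"
            using True False by (intro powr_mono2') (auto simp: q_def)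
          also have "\<dots> = \<bar>w k x\<bar> powr (p - 2)" unfolding q_def by (rule power2_powr_half) simp
          finally show ?thesis using True by simp
        next
          case False
          then show ?thesis using BN(2)[OF xc] e N_nonneg[of x]
            by (auto simp: q_def intro!: powr_mono2)
        qed
        then show ?thesis unfolding H_def by (simp add: mult.commute mult_left_mono)
      qed
    qed
  qed
  define G where "G x = Bd * (BN + 1) powr ((p - 1) / 2) + Ba * ((2 * \<bar>q\<bar> + 1) * (\<Sum>k<n. H k x))" for x
  show ?thesis
  proof (rule that[of G])
    have "set_integrable (lebesgue_coords n) \<Omega> (\<lambda>x. \<Sum>k<n. H k x)"
      using H_int unfolding set_integrable_def scaleR_sum_right
      by (intro Bochner_Integration.integrable_sum) auto
    then show "set_integrable (lebesgue_coords n) \<Omega> G"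
      unfolding G_def[abs_def] by (intro set_integral_add(1) set_integrable_const set_integrable_mult_right)
    fix e :: real assume e: "0 < e" "e \<le> 1"
    have "AE x in lebesgue_coords n. \<forall>k\<in>{..<n}. x \<in> \<Omega> \<longrightarrow> (N x + e) powr q * \<bar>partial j (w k) x\<bar> \<le> H k x"
      using H_bound e by (intro AE_finite_allI) auto
    then show "AE x in lebesgue_coords n. x \<in> \<Omega> \<longrightarrow> \<bar>dflux e j x\<bar> \<le> G x"
    proof eventually_elim
      case (elim x)
      show ?case
      proof
        assume x: "x \<in> \<Omega>"
        then have xc: "x \<in> closure \<Omega>" using closure_subset by blast
        have "(N x + e) powr ((p - 1) / 2) \<le> (BN + 1) powr ((p - 1) / 2)"
          using BN(2)[OF xc] e p N_nonneg[of x] by (intro powr_mono2) auto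
        then have 1: "\<bar>partial j a x\<bar> * (N x + e) powr ((p - 1) / 2) \<le> Bd * (BN + 1) powr ((p - 1) / 2)"
          using Bd(1) Bd(2)[OF xc] by (intro mult_mono) auto
        have "(\<Sum>k<n. (N x + e) powr q * \<bar>partial j (w k) x\<bar>) \<le> (\<Sum>k<n. H k x)"
          using elim x by (intro sum_mono) auto
        then have 2: "\<bar>a x\<bar> * ((2 * \<bar>q\<bar> + 1) * (\<Sum>k<n. (N x + e) powr q * \<bar>partial j (w k) x\<bar>))
            \<le> Ba * ((2 * \<bar>q\<bar> + 1) * (\<Sum>k<n. H k x))"
          using Ba(1) Ba(2)[OF xc] by (intro mult_mono) (auto intro!: mult_nonneg_nonneg sum_nonneg)
        show "\<bar>dflux e j x\<bar> \<le> G x"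
          using abs_dflux_le[OF j e(1), of x] 1 2 unfolding G_def by linarith
      qed
    qed
  qed
qed

lemma flux_bounded:
  assumes j: "j < n"
  obtains B where "B \<ge> 0" "\<And>e x. 0 \<le> e \<Longrightarrow> e \<le> 1 \<Longrightarrow> x \<in> closure \<Omega> \<Longrightarrow> \<bar>flux e j x\<bar> \<le> B"
proof -
  obtain BN where BN: "BN \<ge> 0" "\<And>x. x \<in> closure \<Omega> \<Longrightarrow> \<bar>N x\<bar> \<le> BN"
    using bounded_on_closure[OF C1_onD(2)[OF N_C1]] by blast
  obtain Ba where Ba: "Ba \<ge> 0" "\<And>x. x \<in> closure \<Omega> \<Longrightarrow> \<bar>a x\<bar> \<le> Ba"
    using bounded_on_closure[OF C1_onD(2)[OF a]] by blast
  show ?thesis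
  proof (rule that[of "Ba * (BN + 1) powr ((p - 1) / 2)"])
    show "0 \<le> Ba * (BN + 1) powr ((p - 1) / 2)" using Ba by simp
    fix e x assume e: "0 \<le> e" "e \<le> (1 :: real)" and x: "x \<in> closure \<Omega>"
    have "(N x + e) powr ((p - 1) / 2) \<le> (BN + 1) powr ((p - 1) / 2)"
      using BN(2)[OF x] e p N_nonneg[of x] by (intro powr_mono2) auto
    then have "\<bar>a x\<bar> * (N x + e) powr ((p - 1) / 2) \<le> Ba * (BN + 1) powr ((p - 1) / 2)"
      using Ba(1) Ba(2)[OF x] by (intro mult_mono) auto
    with abs_flux_le[OF j e(1)] show "\<bar>flux e j x\<bar> \<le> Ba * (BN + 1) powr ((p - 1) / 2)" by (rule order_trans)
  qed
qed

text \<open>The divergence theorem holds for \<Psi> times the regularised flux, and each of the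
  three integrals passes to the limit by dominated convergence. The majorants are a constant on
  \<Omega>, the majorant of the regularised derivatives, and a multiple of |\<nu>_j| on the
  boundary.\<close>

theorem flux_integration_by_parts:
  assumes \<Psi>: "C1_on n V \<Psi>" and j: "j < n"
  shows "set_integrable (lebesgue_coords n) \<Omega> (\<lambda>x. partial j \<Psi> x * flux 0 j x)"
    "set_integrable (lebesgue_coords n) \<Omega> (\<lambda>x. \<Psi> x * dflux0 j x)"
    "set_integrable \<sigma> F (\<lambda>x. \<Psi> x * flux 0 j x * \<nu> x j)"
    "(LINT x:\<Omega>|lebesgue_coords n. partial j \<Psi> x * flux 0 j x) + (LINT x:\<Omega>|lebesgue_coords n. \<Psi> x * dflux0 j x)
      = (LINT x:F|\<sigma>. \<Psi> x * flux 0 j x * \<nu> x j)"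
proof -
  define e where "e m = inverse (real (Suc m))" for m
  have e: "0 < e m" "e m \<le> 1" for m by (auto simp: e_def field_simps)
  have "e \<longlonglongrightarrow> 0" unfolding e_def by (rule LIMSEQ_inverse_real_of_nat)
  then have e_lim: "filterlim e (at_right 0) sequentially"
    using e by (auto simp: filterlim_at less_imp_neq[OF e(1), THEN not_sym] intro!: always_eventually)
  obtain B\<Psi> where B\<Psi>: "B\<Psi> \<ge> 0" "\<And>x. x \<in> closure \<Omega> \<Longrightarrow> \<bar>\<Psi> x\<bar> \<le> B\<Psi>"
    using bounded_on_closure[OF C1_onD(2)[OF \<Psi>]] by blast
  obtain Bd where Bd: "Bd \<ge> 0" "\<And>x. x \<in> closure \<Omega> \<Longrightarrow> \<bar>partial j \<Psi> x\<bar> \<le> Bd"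
    using bounded_on_closure[OF C1_onD(4)[OF \<Psi> j]] by blast
  obtain BF where BF: "BF \<ge> 0" "\<And>e x. 0 \<le> e \<Longrightarrow> e \<le> 1 \<Longrightarrow> x \<in> closure \<Omega> \<Longrightarrow> \<bar>flux e j x\<bar> \<le> BF"
    using flux_bounded[OF j] by blast
  obtain G where G: "set_integrable (lebesgue_coords n) \<Omega> G"
    "\<And>e. 0 < e \<Longrightarrow> e \<le> 1 \<Longrightarrow> AE x in lebesgue_coords n. x \<in> \<Omega> \<longrightarrow> \<bar>dflux e j x\<bar> \<le> G x"
    using dflux_dominated[OF j] by blast
  define S1 where "S1 m x = indicator \<Omega> x *\<^sub>R (partial j \<Psi> x * flux (e m) j x)" for m x
  define S2 where "S2 m x = indicator \<Omega> x *\<^sub>R (\<Psi> x * dflux (e m) j x)" for m x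
  define S3 where "S3 m x = indicator F x *\<^sub>R (\<Psi> x * flux (e m) j x * \<nu> x j)" for m x
  define T1 where "T1 x = indicator \<Omega> x *\<^sub>R (partial j \<Psi> x * flux 0 j x)" for x
  define T2 where "T2 x = indicator \<Omega> x *\<^sub>R (\<Psi> x * dflux0 j x)" for x
  define T3 where "T3 x = indicator F x *\<^sub>R (\<Psi> x * flux 0 j x * \<nu> x j)" for x
  have flux_cont: "continuous_on V (flux (e m) j)" for m by (rule C1_onD(2)[OF flux_C1[OF e(1) j]])
  have dflux_cont: "continuous_on V (dflux (e m) j)" for m
    using C1_onD(4)[OF flux_C1[OF e(1) j] j] partial_flux[OF e(1) j] by (simp cong: continuous_on_cong)
  have S1_int: "integrable (lebesgue_coords n) (S1 m)" for m
    using set_integrable_continuous[OF continuous_on_mult[OF C1_onD(4)[OF \<Psi> j] flux_cont[of m]]]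
    by (simp add: set_integrable_def S1_def[abs_def])
  have S2_int: "integrable (lebesgue_coords n) (S2 m)" for m
    using set_integrable_continuous[OF continuous_on_mult[OF C1_onD(2)[OF \<Psi>] dflux_cont[of m]]]
    by (simp add: set_integrable_def S2_def[abs_def])
  have prod_C1: "C1_on n V (\<lambda>x. \<Psi> x * flux (e m) j x)" for m by (rule C1_on_mult[OF \<Psi> flux_C1[OF e(1) j]])
  note div = divergence_theorem[OF \<Omega> \<sigma> prod_C1 V(2) j]
  have S3_int: "integrable \<sigma> (S3 m)" for m
    using div(2)[of m] by (simp add: set_integrable_def S3_def[abs_def])
  have eq: "(\<integral>x. S1 m x \<partial>lebesgue_coords n) + (\<integral>x. S2 m x \<partial>lebesgue_coords n) = (\<integral>x. S3 m x \<partial>\<sigma>)" for m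
  proof -
    have "(\<integral>x. S1 m x \<partial>lebesgue_coords n) + (\<integral>x. S2 m x \<partial>lebesgue_coords n) = (\<integral>x. S1 m x + S2 m x \<partial>lebesgue_coords n)"
      by (rule Bochner_Integration.integral_add[OF S1_int S2_int, symmetric])
    also have "\<dots> = (LINT x:\<Omega>|lebesgue_coords n. partial j (\<lambda>x. \<Psi> x * flux (e m) j x) x)"
      unfolding set_lebesgue_integral_def
    proof (rule Bochner_Integration.integral_cong[OF refl])
      fix x
      show "S1 m x + S2 m x = indicator \<Omega> x *\<^sub>R partial j (\<lambda>x. \<Psi> x * flux (e m) j x) x"
      proof (cases "x \<in> \<Omega>")
        case True
        then have x: "x \<in> V" using \<Omega>_V by auto
        from partial_eqI[OF partial_mult[OF \<Psi> flux_C1[OF e(1) j] j x], of m] True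
        show ?thesis by (simp add: S1_def S2_def partial_flux[OF e(1) j x])
      qed (simp add: S1_def S2_def)
    qed
    also have "\<dots> = (\<integral>x. S3 m x \<partial>\<sigma>)" using div(3)[of m] by (simp only: set_lebesgue_integral_def S3_def)
    finally show ?thesis .
  qed
  have lim1: "(\<lambda>m. S1 m x) \<longlonglongrightarrow> T1 x" for x
    unfolding S1_def T1_def by (intro tendsto_intros filterlim_compose[OF flux_tendsto[OF j] e_lim])
  have lim3: "(\<lambda>m. S3 m x) \<longlonglongrightarrow> T3 x" for x
    unfolding S3_def T3_def by (intro tendsto_intros filterlim_compose[OF flux_tendsto[OF j] e_lim])
  have lim2: "AE x in lebesgue_coords n. (\<lambda>m. S2 m x) \<longlonglongrightarrow> T2 x"
    using AE_partial_w_zero[OF j j]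
  proof eventually_elim
    case (elim x)
    show ?case
    proof (cases "x \<in> \<Omega>")
      case True
      then have "N x = 0 \<Longrightarrow> partial j (w j) x = 0" using elim j N_zero_iff by blast
      then show ?thesis unfolding S2_def T2_def
        by (intro tendsto_intros filterlim_compose[OF dflux_tendsto[OF j] e_lim])
    qed (simp add: S2_def T2_def)
  qed
  have T1_meas: "T1 \<in> borel_measurable (lebesgue_coords n)"
    by (rule borel_measurable_LIMSEQ_real[OF lim1 borel_measurable_integrable[OF S1_int]])
  have T3_meas: "T3 \<in> borel_measurable \<sigma>"
    by (rule borel_measurable_LIMSEQ_real[OF lim3 borel_measurable_integrable[OF S3_int]])
  \<comment> \<open>\<open>S2\<close> is only known to converge almost everywhere, while Borel
    measurability of the limit calls for convergence at every point. Setting \<open>S2\<close> to 0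
    where N vanishes achieves this, since \<open>dflux0\<close> is 0 there.\<close>
  have T2_meas: "T2 \<in> borel_measurable (lebesgue_coords n)"
  proof (rule borel_measurable_LIMSEQ_real)
    have [measurable]: "(\<lambda>x. N x * indicator \<Omega> x) \<in> borel_measurable borel"
      by (rule borel_measurable_continuous_on_times_indicator[OF \<Omega>_borel continuous_on_subset[OF C1_onD(2)[OF N_C1] \<Omega>_V]])
    have [measurable]: "S2 m \<in> borel_measurable borel" for m
      using borel_measurable_integrable[OF S2_int] by simp
    show "(\<lambda>x. if N x * indicator \<Omega> x = 0 then 0 else S2 m x) \<in> borel_measurable (lebesgue_coords n)" for m
      by measurable
    fix x
    show "(\<lambda>m. if N x * indicator \<Omega> x = 0 then 0 else S2 m x) \<longlonglongrightarrow> T2 x"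
    proof (cases "x \<in> \<Omega> \<and> N x \<noteq> 0")
      case True
      then show ?thesis unfolding S2_def T2_def
        by simp (intro tendsto_intros filterlim_compose[OF dflux_tendsto[OF j] e_lim]; simp)
    next
      case False
      then show ?thesis by (auto simp: T2_def dflux0_def indicator_def)
    qed
  qed
  \<comment> \<open>The divergence theorem for the constant function 1 shows that the normal
    component is integrable over the boundary, which gives the majorant there without discussing the
    total mass of \<sigma>.\<close>
  have \<nu>_int: "integrable \<sigma> (\<lambda>x. indicator F x *\<^sub>R (1 * \<nu> x j))"
    using divergence_theorem(2)[OF \<Omega> \<sigma> C1_on_const[OF V(1), of 1] V(2) j] by (simp add: set_integrable_def)
  have W1: "integrable (lebesgue_coords n) (\<lambda>x. indicator \<Omega> x *\<^sub>R (Bd * BF))"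
    using set_integrable_const by (simp add: set_integrable_def)
  have W2: "integrable (lebesgue_coords n) (\<lambda>x. indicator \<Omega> x *\<^sub>R (B\<Psi> * G x))"
    using set_integrable_mult_right[OF G(1)] unfolding set_integrable_def .
  have W3: "integrable \<sigma> (\<lambda>x. B\<Psi> * BF * \<bar>indicator F x *\<^sub>R (1 * \<nu> x j)\<bar>)"
    using \<nu>_int by (intro integrable_mult_right integrable_abs)
  have cl: "x \<in> \<Omega> \<Longrightarrow> x \<in> closure \<Omega>" for x using closure_subset by blast
  have b1: "AE x in lebesgue_coords n. norm (S1 m x) \<le> indicator \<Omega> x *\<^sub>R (Bd * BF)" for m
    using Bd BF(1) BF(2)[of "e m"] e[of m] cl
    by (intro AE_I2) (auto simp: S1_def abs_mult indicator_def intro!: mult_mono)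
  have b2: "AE x in lebesgue_coords n. norm (S2 m x) \<le> indicator \<Omega> x *\<^sub>R (B\<Psi> * G x)" for m
    using G(2)[OF e]
    by eventually_elim (use B\<Psi> cl in \<open>auto simp: S2_def abs_mult indicator_def intro!: mult_mono\<close>)
  have b3: "AE x in \<sigma>. norm (S3 m x) \<le> B\<Psi> * BF * \<bar>indicator F x *\<^sub>R (1 * \<nu> x j)\<bar>" for m
  proof (rule AE_I2)
    fix x
    show "norm (S3 m x) \<le> B\<Psi> * BF * \<bar>indicator F x *\<^sub>R (1 * \<nu> x j)\<bar>"
    proof (cases "x \<in> F")
      case True
      then have "\<bar>\<Psi> x\<bar> * \<bar>flux (e m) j x\<bar> \<le> B\<Psi> * BF"
        using B\<Psi> BF(1) BF(2)[of "e m" x] e[of m] by (intro mult_mono) auto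
      from mult_right_mono[OF this, of "\<bar>\<nu> x j\<bar>"] True show ?thesis by (simp add: S3_def abs_mult)
    qed (simp add: S3_def)
  qed
  note S_meas = borel_measurable_integrable[OF S1_int] borel_measurable_integrable[OF S2_int] borel_measurable_integrable[OF S3_int]
  have I1: "integrable (lebesgue_coords n) T1"
    by (rule integrable_dominated_convergence[OF T1_meas S_meas(1) W1 AE_I2[OF lim1] b1])
  have I2: "integrable (lebesgue_coords n) T2"
    by (rule integrable_dominated_convergence[OF T2_meas S_meas(2) W2 lim2 b2])
  have I3: "integrable \<sigma> T3"
    by (rule integrable_dominated_convergence[OF T3_meas S_meas(3) W3 AE_I2[OF lim3] b3])
  have L1: "(\<lambda>m. \<integral>x. S1 m x \<partial>lebesgue_coords n) \<longlonglongrightarrow> (\<integral>x. T1 x \<partial>lebesgue_coords n)"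
    by (rule integral_dominated_convergence[OF T1_meas S_meas(1) W1 AE_I2[OF lim1] b1])
  have L2: "(\<lambda>m. \<integral>x. S2 m x \<partial>lebesgue_coords n) \<longlonglongrightarrow> (\<integral>x. T2 x \<partial>lebesgue_coords n)"
    by (rule integral_dominated_convergence[OF T2_meas S_meas(2) W2 lim2 b2])
  have L3: "(\<lambda>m. \<integral>x. S3 m x \<partial>\<sigma>) \<longlonglongrightarrow> (\<integral>x. T3 x \<partial>\<sigma>)"
    by (rule integral_dominated_convergence[OF T3_meas S_meas(3) W3 AE_I2[OF lim3] b3])
  show "set_integrable (lebesgue_coords n) \<Omega> (\<lambda>x. partial j \<Psi> x * flux 0 j x)"
    using I1 by (simp add: set_integrable_def T1_def[abs_def])
  show "set_integrable (lebesgue_coords n) \<Omega> (\<lambda>x. \<Psi> x * dflux0 j x)"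
    using I2 by (simp add: set_integrable_def T2_def[abs_def])
  show "set_integrable \<sigma> F (\<lambda>x. \<Psi> x * flux 0 j x * \<nu> x j)"
    using I3 by (simp add: set_integrable_def T3_def[abs_def])
  have "(\<integral>x. T1 x \<partial>lebesgue_coords n) + (\<integral>x. T2 x \<partial>lebesgue_coords n) = (\<integral>x. T3 x \<partial>\<sigma>)"
    using tendsto_add[OF L1 L2] L3 unfolding eq by (rule LIMSEQ_unique)
  then show "(LINT x:\<Omega>|lebesgue_coords n. partial j \<Psi> x * flux 0 j x) + (LINT x:\<Omega>|lebesgue_coords n. \<Psi> x * dflux0 j x)
      = (LINT x:F|\<sigma>. \<Psi> x * flux 0 j x * \<nu> x j)"
    by (simp add: set_lebesgue_integral_def T1_def T2_def T3_def)
qed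

end

section \<open>The weighted Hardy type inequality\<close>

lemma DERIV_abs_powr:
  fixes t p :: real
  assumes p: "p > 1"
  shows "((\<lambda>t. \<bar>t\<bar> powr p) has_real_derivative p * \<bar>t\<bar> powr (p - 1) * sgn t) (at t)"
proof -
  consider "t > 0" | "t < 0" | "t = 0" by linarith
  then show ?thesis
  proof cases
    case 1
    then have ev: "eventually (\<lambda>s. \<bar>s\<bar> powr p = s powr p) (nhds t)"
      using eventually_nhds_in_open[of "{0<..}" t] by (auto elim!: eventually_mono)
    have "((\<lambda>s. s powr p) has_real_derivative p * \<bar>t\<bar> powr (p - 1) * sgn t) (at t)"
      using 1 by (auto intro!: derivative_eq_intros)
    then show ?thesis by (rule DERIV_cong_ev[OF refl ev refl, THEN iffD2])
  next
    case 2
    then have ev: "eventually (\<lambda>s. \<bar>s\<bar> powr p = (- s) powr p) (nhds t)"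
      using eventually_nhds_in_open[of "{..<0}" t] by (auto elim!: eventually_mono)
    have "((\<lambda>s. (- s) powr p) has_real_derivative p * \<bar>t\<bar> powr (p - 1) * sgn t) (at t)"
      using 2 by (auto intro!: derivative_eq_intros)
    then show ?thesis by (rule DERIV_cong_ev[OF refl ev refl, THEN iffD2])
  next
    case 3
    have "((\<lambda>h. (\<bar>h\<bar> powr p - \<bar>0\<bar> powr p) / (h - 0)) \<longlongrightarrow> 0) (at (0::real))"
    proof (rule Lim_null_comparison)
      show "eventually (\<lambda>h. norm ((\<bar>h\<bar> powr p - \<bar>0\<bar> powr p) / (h - 0)) \<le> \<bar>h\<bar> powr (p - 1)) (at (0::real))"
        by (intro always_eventually) (auto simp: powr_diff abs_divide)
      have "((\<lambda>h. \<bar>h\<bar> powr (p - 1)) \<longlongrightarrow> \<bar>0\<bar> powr (p - 1)) (at (0::real))"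
        using p by (intro tendsto_powr' tendsto_intros) auto
      then show "((\<lambda>h. \<bar>h\<bar> powr (p - 1)) \<longlongrightarrow> 0) (at (0::real))" by simp
    qed
    then show ?thesis using 3 by (simp add: has_field_derivative_iff)
  qed
qed

lemma continuous_on_abs_powr_sgn:
  assumes p: "p > 1"
  shows "continuous_on UNIV (\<lambda>t :: real. p * \<bar>t\<bar> powr (p - 1) * sgn t)"
proof -
  have "isCont (\<lambda>t. p * \<bar>t\<bar> powr (p - 1) * sgn t) t" for t :: real
  proof (cases "t = 0")
    case False
    then show ?thesis by (intro continuous_intros) auto
  next
    case True
    have "((\<lambda>h. p * \<bar>h\<bar> powr (p - 1) * sgn h) \<longlongrightarrow> 0) (at (0::real))"
    proof (rule Lim_null_comparison)
      show "eventually (\<lambda>h. norm (p * \<bar>h\<bar> powr (p - 1) * sgn h) \<le> p * \<bar>h\<bar> powr (p - 1)) (at (0::real))"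
        using p by (intro always_eventually) (auto simp: abs_mult abs_sgn_eq)
      have "((\<lambda>h. p * \<bar>h\<bar> powr (p - 1)) \<longlongrightarrow> p * \<bar>0\<bar> powr (p - 1)) (at (0::real))"
        using p by (intro tendsto_powr' tendsto_intros) auto
      then show "((\<lambda>h. p * \<bar>h\<bar> powr (p - 1)) \<longlongrightarrow> 0) (at (0::real))" by simp
    qed
    then show ?thesis using True by (simp add: isCont_def)
  qed
  then show ?thesis by (simp add: continuous_on_eq_continuous_at)
qed

text \<open>Positive and negative parts are compared separately: that of \<open>f\<close> is smaller
  than that of \<open>g\<close> in the first case and larger in the second. Both parts of
  \<open>g\<close> have finite integrals, so no difference of infinities arises and the left side
  can at worst be minus infinity.\<close>

lemma ext_integral_mono_integrable:
  assumes g: "integrable M (\<lambda>x. indicator S x *\<^sub>R g x)"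
    and le: "AE x in M. x \<in> S \<longrightarrow> f x \<le> g x"
  shows "ext_integral M S f \<le> ereal (LINT x:S|M. g x)"
proof -
  let ?g = "\<lambda>x. indicator S x *\<^sub>R g x"
  have eq: "ennreal (g x) * indicator S x = ennreal (?g x)" "ennreal (- g x) * indicator S x = ennreal (- ?g x)" for x
    by (auto split: split_indicator)
  have 1: "(\<integral>\<^sup>+x\<in>S. ennreal (f x) \<partial>M) \<le> (\<integral>\<^sup>+x. ennreal (?g x) \<partial>M)"
    using le by (intro nn_integral_mono_AE) (auto elim!: eventually_mono simp: ennreal_leI split: split_indicator)
  have 2: "(\<integral>\<^sup>+x. ennreal (- ?g x) \<partial>M) \<le> (\<integral>\<^sup>+x\<in>S. ennreal (- f x) \<partial>M)"
    using le by (intro nn_integral_mono_AE) (auto elim!: eventually_mono simp: ennreal_leI split: split_indicator)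
  have fin: "(\<integral>\<^sup>+x. ennreal (?g x) \<partial>M) \<noteq> \<infinity>" "(\<integral>\<^sup>+x. ennreal (- ?g x) \<partial>M) \<noteq> \<infinity>"
    using real_integrable_def[of M ?g] g by auto
  have "ext_integral M S f \<le> enn2ereal (\<integral>\<^sup>+x. ennreal (?g x) \<partial>M) - enn2ereal (\<integral>\<^sup>+x. ennreal (- ?g x) \<partial>M)"
    unfolding ext_integral_def using 1 2 by (intro ereal_minus_mono) (simp_all add: less_eq_ennreal.rep_eq)
  also have "\<dots> = ereal (enn2real (\<integral>\<^sup>+x. ennreal (?g x) \<partial>M) - enn2real (\<integral>\<^sup>+x. ennreal (- ?g x) \<partial>M))"
    using fin by (cases "\<integral>\<^sup>+x. ennreal (?g x) \<partial>M"; cases "\<integral>\<^sup>+x. ennreal (- ?g x) \<partial>M") (auto simp: enn2ereal_ennreal)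
  also have "enn2real (\<integral>\<^sup>+x. ennreal (?g x) \<partial>M) - enn2real (\<integral>\<^sup>+x. ennreal (- ?g x) \<partial>M) = (LINT x:S|M. g x)"
    unfolding set_lebesgue_integral_def by (rule real_lebesgue_integral_def[OF g, symmetric])
  finally show ?thesis .
qed

text \<open>Here \<open>\<alpha>\<close> stands for \<open>|\<phi>/u| |\<nabla>u|\<close> and \<open>\<beta>\<close> for \<open>u |\<nabla>(\<phi>/u)|\<close>.\<close>

definition remainder :: "real \<Rightarrow> real \<Rightarrow> real \<Rightarrow> real" where
  "remainder p \<alpha> \<beta> = (if p \<ge> 2 then \<beta> powr p else \<beta>\<^sup>2 / (\<alpha> + \<beta>) powr (2 - p))"

text \<open>For p \<ge> 2 this is the smaller of the constants from the regimes \<beta> > C \<alpha>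
  and \<beta> \<le> C \<alpha> with C = 4 p + 2. For p < 2 it is the factor p (p - 1) from the
  second derivative, halved by Taylor's formula.\<close>

definition remainder_const :: "real \<Rightarrow> real" where
  "remainder_const p = (if p \<ge> 2 then min (1 / 2) (p / 2 * (4 * p + 2) powr (2 - p)) else p * (p - 1) / 2)"

lemma remainder_const_pos: "p > 1 \<Longrightarrow> remainder_const p > 0"
  by (auto simp: remainder_const_def)

lemma remainder_nonneg: "remainder p \<alpha> \<beta> \<ge> 0"
  by (simp add: remainder_def)

lemma powr_inequality:
  assumes "p > 1" "\<alpha> \<ge> 0" "\<beta> \<ge> 0" "\<bar>\<gamma>\<bar> \<le> \<alpha> * \<beta>"
  shows "(\<alpha>\<^sup>2 + 2 * \<gamma> + \<beta>\<^sup>2) powr (p / 2)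
    \<ge> \<alpha> powr p + p * \<alpha> powr (p - 2) * \<gamma> + remainder_const p * remainder p \<alpha> \<beta>"
  using powr_inequality_ge_2[of p \<alpha> \<beta> \<gamma>] powr_inequality_less_2[of p \<alpha> \<beta> \<gamma>] assms
  by (cases "p \<ge> 2") (simp_all add: remainder_const_def remainder_def)

section \<open>The test function and the pointwise inequality\<close>

locale positive_flux_domain = flux_domain +
  fixes \<phi> :: "(nat \<Rightarrow> real) \<Rightarrow> real"
  assumes \<phi>: "C1_on n V \<phi>" and u_pos: "\<And>x. x \<in> V \<Longrightarrow> u x > 0" and a_nonneg: "\<And>x. x \<in> \<Omega> \<Longrightarrow> a x \<ge> 0"
begin

definition \<psi> :: "(nat \<Rightarrow> real) \<Rightarrow> real" where "\<psi> x = \<phi> x / u x"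

text \<open>This is \<open>|\<phi>|\<^sup>p u\<^sup>1\<^sup>-\<^sup>p\<close>.\<close>

definition \<Psi> :: "(nat \<Rightarrow> real) \<Rightarrow> real" where "\<Psi> x = \<bar>\<psi> x\<bar> powr p * u x"

definition R :: "(nat \<Rightarrow> real) \<Rightarrow> real" where
  "R x = a x * remainder p (\<bar>\<psi> x\<bar> * grad_norm n u x) (grad_norm n \<psi> x * u x)"

lemma u_C1: "C1_on n V u" by (rule C1_on_if_smooth_on[OF V(1) u])

lemma \<psi>_C1: "C1_on n V \<psi>"
proof -
  have "C1_on n V (\<lambda>x. 1 / u x)"
  proof (rule C1_on_compose[OF u_C1])
    show "((\<lambda>t. 1 / t) has_real_derivative - (1 / (u x * u x))) (at (u x))" if "x \<in> V" for x
      using u_pos[OF that] by (auto intro!: derivative_eq_intros)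
    show "continuous_on (u ` V) (\<lambda>t. - (1 / (t * t)))"
      using u_pos by (intro continuous_intros) (auto simp: less_imp_neq[THEN not_sym])
  qed
  from C1_on_mult[OF \<phi> this] show ?thesis by (rule C1_on_cong) (simp add: \<psi>_def)
qed

lemma partial_\<phi>:
  assumes j: "j < n" and x: "x \<in> V"
  shows "partial j \<phi> x = \<psi> x * w j x + u x * partial j \<psi> x"
proof -
  have "partial j \<phi> x = partial j (\<lambda>x. \<psi> x * u x) x"
    by (rule partial_cong_open[OF V(1) x j]) (use u_pos in \<open>force simp: \<psi>_def\<close>)
  also have "\<dots> = partial j \<psi> x * u x + \<psi> x * w j x"
    by (rule partial_eqI[OF partial_mult[OF \<psi>_C1 u_C1 j x]])
  finally show ?thesis by (simp add: mult.commute)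
qed

lemma abs_\<psi>_powr_C1: "C1_on n V (\<lambda>x. \<bar>\<psi> x\<bar> powr p)"
  by (rule C1_on_compose[OF \<psi>_C1 DERIV_abs_powr[OF p]])
    (rule continuous_on_subset[OF continuous_on_abs_powr_sgn[OF p] subset_UNIV])

lemma \<Psi>_C1: "C1_on n V \<Psi>"
  unfolding \<Psi>_def[abs_def] by (rule C1_on_mult[OF abs_\<psi>_powr_C1 u_C1])

lemma partial_\<Psi>:
  assumes j: "j < n" and x: "x \<in> V"
  shows "partial j \<Psi> x = p * \<bar>\<psi> x\<bar> powr (p - 1) * sgn (\<psi> x) * partial j \<psi> x * u x + \<bar>\<psi> x\<bar> powr p * w j x"
proof -
  have "partial j \<Psi> x = partial j (\<lambda>x. \<bar>\<psi> x\<bar> powr p) x * u x + \<bar>\<psi> x\<bar> powr p * w j x"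
    unfolding \<Psi>_def[abs_def] by (rule partial_eqI[OF partial_mult[OF abs_\<psi>_powr_C1 u_C1 j x]])
  also have "partial j (\<lambda>x. \<bar>\<psi> x\<bar> powr p) x = p * \<bar>\<psi> x\<bar> powr (p - 1) * sgn (\<psi> x) * partial j \<psi> x"
    by (rule partial_eqI[OF partial_compose[OF \<psi>_C1 DERIV_abs_powr[OF p] j x]])
  finally show ?thesis .
qed

text \<open>The product rule for \<phi> = \<psi> u expresses |grad \<phi>|^2 as \<alpha>^2 + 2
  \<gamma> + \<beta>^2, with Cauchy-Schwarz as the constraint on \<gamma>. The part of the power
  inequality that is linear in \<gamma>, multiplied by a, is exactly the flux paired with the
  gradient of \<Psi>.\<close>

lemma pointwise:
  assumes x: "x \<in> \<Omega>"
  shows "a x * grad_norm n \<phi> x powr p \<ge> (\<Sum>j<n. partial j \<Psi> x * flux 0 j x) + remainder_const p * R x"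
proof -
  have xV: "x \<in> V" using x \<Omega>_V by auto
  have ux: "u x > 0" using u_pos[OF xV] .
  define \<alpha> where "\<alpha> = \<bar>\<psi> x\<bar> * grad_norm n u x"
  define \<beta> where "\<beta> = grad_norm n \<psi> x * u x"
  define s where "s = (\<Sum>j<n. w j x * partial j \<psi> x)"
  define \<gamma> where "\<gamma> = \<psi> x * u x * s"
  have gn: "grad_norm n u x \<ge> 0" "grad_norm n \<psi> x \<ge> 0" "grad_norm n \<phi> x \<ge> 0" by (simp_all add: grad_norm_def L2_set_nonneg)
  have N: "(grad_norm n u x)\<^sup>2 = N x" by (simp add: grad_norm_square N_def)
  have sle: "\<bar>s\<bar> \<le> grad_norm n u x * grad_norm n \<psi> x"
  proof -
    have "\<bar>s\<bar> \<le> (\<Sum>j<n. \<bar>w j x\<bar> * \<bar>partial j \<psi> x\<bar>)"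
      unfolding s_def by (rule order_trans[OF sum_abs]) (simp add: abs_mult)
    also have "\<dots> \<le> grad_norm n u x * grad_norm n \<psi> x"
      unfolding grad_norm_def by (rule L2_set_mult_ineq)
    finally show ?thesis .
  qed
  have \<gamma>: "\<bar>\<gamma>\<bar> \<le> \<alpha> * \<beta>"
  proof -
    have "\<bar>\<gamma>\<bar> = \<bar>\<psi> x\<bar> * u x * \<bar>s\<bar>" using ux by (simp add: \<gamma>_def abs_mult)
    also have "\<dots> \<le> \<bar>\<psi> x\<bar> * u x * (grad_norm n u x * grad_norm n \<psi> x)"
      using sle ux by (intro mult_left_mono) auto
    finally show ?thesis by (simp add: \<alpha>_def \<beta>_def mult_ac)
  qed
  have sq: "(grad_norm n \<phi> x)\<^sup>2 = \<alpha>\<^sup>2 + 2 * \<gamma> + \<beta>\<^sup>2"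
  proof -
    have "(grad_norm n \<phi> x)\<^sup>2 = (\<Sum>j<n. (\<psi> x)\<^sup>2 * (w j x)\<^sup>2 + 2 * (\<psi> x * u x) * (w j x * partial j \<psi> x) + (u x)\<^sup>2 * (partial j \<psi> x)\<^sup>2)"
      unfolding grad_norm_square
      by (intro sum.cong refl) (simp add: partial_\<phi>[OF _ xV] power2_eq_square algebra_simps)
    also have "\<dots> = (\<psi> x)\<^sup>2 * (grad_norm n u x)\<^sup>2 + 2 * (\<psi> x * u x) * s + (u x)\<^sup>2 * (grad_norm n \<psi> x)\<^sup>2"
      by (simp add: sum.distrib grad_norm_square s_def sum_distrib_left)
    finally show ?thesis by (simp add: \<alpha>_def \<beta>_def \<gamma>_def power_mult_distrib mult_ac)
  qed
  have flux_sum: "(\<Sum>j<n. partial j \<Psi> x * flux 0 j x) = a x * (\<alpha> powr p + p * \<alpha> powr (p - 2) * \<gamma>)"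
  proof -
    have "(\<Sum>j<n. partial j \<Psi> x * flux 0 j x) =
       (\<Sum>j<n. a x * N x powr q * (p * \<bar>\<psi> x\<bar> powr (p - 1) * sgn (\<psi> x) * u x * (w j x * partial j \<psi> x) + \<bar>\<psi> x\<bar> powr p * (w j x)\<^sup>2))"
      by (intro sum.cong refl) (simp add: partial_\<Psi>[OF _ xV] flux_def power2_eq_square algebra_simps)
    also have "\<dots> = a x * N x powr q * (p * \<bar>\<psi> x\<bar> powr (p - 1) * sgn (\<psi> x) * u x * s + \<bar>\<psi> x\<bar> powr p * N x)"
      by (simp add: sum_distrib_left[symmetric] sum.distrib s_def N_def)
    also have "\<dots> = a x * (\<alpha> powr p + p * \<alpha> powr (p - 2) * \<gamma>)"
    proof -
      have Nq: "N x powr q = grad_norm n u x powr (p - 2)"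
        unfolding N[symmetric] q_def by (rule power2_powr_half[OF gn(1)])
      have 1: "\<alpha> powr p = N x powr q * (\<bar>\<psi> x\<bar> powr p * N x)"
        unfolding Nq \<alpha>_def using gn(1) N[symmetric]
        by (cases "grad_norm n u x = 0") (simp_all add: powr_mult powr_diff)
      \<comment> \<open>Differentiating |\<psi>|^p produces a sign, whereas \<gamma> contains \<psi>
        itself; this identity reconciles the two and holds at \<psi> = 0 by the value of
        \<open>powr\<close> at 0.\<close>
      have "\<bar>\<psi> x\<bar> powr (p - 2) * \<psi> x = \<bar>\<psi> x\<bar> powr (p - 1) * sgn (\<psi> x)"
        by (cases "\<psi> x = 0") (simp_all add: powr_diff power2_eq_square sgn_if)
      then have 2: "p * \<alpha> powr (p - 2) * \<gamma> = N x powr q * (p * \<bar>\<psi> x\<bar> powr (p - 1) * sgn (\<psi> x) * u x * s)"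
        unfolding Nq \<alpha>_def \<gamma>_def using gn(1) by (simp add: powr_mult algebra_simps)
      show ?thesis unfolding 1 2 by (simp add: algebra_simps)
    qed
    finally show ?thesis .
  qed
  have "grad_norm n \<phi> x powr p = (\<alpha>\<^sup>2 + 2 * \<gamma> + \<beta>\<^sup>2) powr (p / 2)"
    unfolding sq[symmetric] by (rule power2_powr_half[OF gn(3), symmetric])
  moreover have "(\<alpha>\<^sup>2 + 2 * \<gamma> + \<beta>\<^sup>2) powr (p / 2) \<ge> \<alpha> powr p + p * \<alpha> powr (p - 2) * \<gamma> + remainder_const p * remainder p \<alpha> \<beta>"
    using p \<gamma> gn ux by (intro powr_inequality) (auto simp: \<alpha>_def \<beta>_def)
  ultimately have "a x * grad_norm n \<phi> x powr p \<ge>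
      a x * (\<alpha> powr p + p * \<alpha> powr (p - 2) * \<gamma> + remainder_const p * remainder p \<alpha> \<beta>)"
    using a_nonneg[OF x] by (simp add: mult_left_mono)
  moreover have "R x = a x * remainder p \<alpha> \<beta>" by (simp add: R_def \<alpha>_def \<beta>_def)
  ultimately show ?thesis
    using flux_sum by (simp add: algebra_simps)
qed

lemma R_nonneg: "x \<in> \<Omega> \<Longrightarrow> R x \<ge> 0"
  using a_nonneg remainder_nonneg by (simp add: R_def)

lemma grad_norm_\<phi>_integrable: "set_integrable (lebesgue_coords n) \<Omega> (\<lambda>x. a x * grad_norm n \<phi> x powr p)"
  using p
  by (intro set_integrable_continuous continuous_on_mult C1_onD(2)[OF a] continuous_on_powr'
      continuous_on_grad_norm[OF \<phi>] continuous_on_const) (auto simp: grad_norm_def L2_set_nonneg)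

section \<open>Integration of the pointwise inequality\<close>

lemma flux_sum_integrable: "set_integrable (lebesgue_coords n) \<Omega> (\<lambda>x. \<Sum>j<n. partial j \<Psi> x * flux 0 j x)"
  using flux_integration_by_parts(1)[OF \<Psi>_C1] unfolding set_integrable_def scaleR_sum_right
  by (intro Bochner_Integration.integrable_sum) auto

text \<open>The pointwise inequality itself bounds a positive multiple of the nonnegative
  \<open>R\<close> by a difference of integrable functions, in both ranges of p at once.\<close>

lemma R_integrable: "set_integrable (lebesgue_coords n) \<Omega> R"
proof -
  have ind: "(\<lambda>x. f x * indicator \<Omega> x) \<in> borel_measurable borel" if "continuous_on V f" for f :: "_ \<Rightarrow> real"
    by (rule borel_measurable_continuous_on_times_indicator[OF \<Omega>_borel continuous_on_subset[OF that \<Omega>_V]])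
  note [measurable] = ind[OF C1_onD(2)[OF a]] ind[OF C1_onD(2)[OF \<psi>_C1]] ind[OF C1_onD(2)[OF u_C1]]
    ind[OF continuous_on_grad_norm[OF u_C1]] ind[OF continuous_on_grad_norm[OF \<psi>_C1]]
  have "(\<lambda>x. indicator \<Omega> x * ((a x * indicator \<Omega> x) * remainder p (\<bar>\<psi> x * indicator \<Omega> x\<bar> * (grad_norm n u x * indicator \<Omega> x))
      ((grad_norm n \<psi> x * indicator \<Omega> x) * (u x * indicator \<Omega> x)))) \<in> borel_measurable borel"
    unfolding remainder_def by measurable
  also have "(\<lambda>x. indicator \<Omega> x * ((a x * indicator \<Omega> x) * remainder p (\<bar>\<psi> x * indicator \<Omega> x\<bar> * (grad_norm n u x * indicator \<Omega> x))
      ((grad_norm n \<psi> x * indicator \<Omega> x) * (u x * indicator \<Omega> x)))) = (\<lambda>x. indicator \<Omega> x *\<^sub>R R x)"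
    by (auto simp: R_def fun_eq_iff split: split_indicator)
  finally have meas: "(\<lambda>x. indicator \<Omega> x *\<^sub>R R x) \<in> borel_measurable (lebesgue_coords n)" by simp
  define c where "c = remainder_const p"
  have c: "c > 0" using remainder_const_pos[OF p] by (simp add: c_def)
  have "integrable (lebesgue_coords n) (\<lambda>x. c * (indicator \<Omega> x *\<^sub>R R x))"
  proof (rule Bochner_Integration.integrable_bound)
    show "integrable (lebesgue_coords n) (\<lambda>x. indicator \<Omega> x *\<^sub>R (a x * grad_norm n \<phi> x powr p - (\<Sum>j<n. partial j \<Psi> x * flux 0 j x)))"
      using set_integral_diff(1)[OF grad_norm_\<phi>_integrable flux_sum_integrable] by (simp add: set_integrable_def)
    show "(\<lambda>x. c * (indicator \<Omega> x *\<^sub>R R x)) \<in> borel_measurable (lebesgue_coords n)"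
      using meas by (intro borel_measurable_times) auto
    show "AE x in lebesgue_coords n. norm (c * (indicator \<Omega> x *\<^sub>R R x)) \<le>
        norm (indicator \<Omega> x *\<^sub>R (a x * grad_norm n \<phi> x powr p - (\<Sum>j<n. partial j \<Psi> x * flux 0 j x)))"
    proof (rule AE_I2)
      fix x
      show "norm (c * (indicator \<Omega> x *\<^sub>R R x)) \<le>
        norm (indicator \<Omega> x *\<^sub>R (a x * grad_norm n \<phi> x powr p - (\<Sum>j<n. partial j \<Psi> x * flux 0 j x)))"
      proof (cases "x \<in> \<Omega>")
        case True
        have "0 \<le> c * R x" using c R_nonneg[OF True] by simp
        then show ?thesis using pointwise[OF True] True by (simp add: c_def)
      qed simp
    qed
  qed
  then have "integrable (lebesgue_coords n) (\<lambda>x. (1 / c) * (c * (indicator \<Omega> x *\<^sub>R R x)))"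
    by (rule integrable_mult_right)
  then show ?thesis using c by (simp add: set_integrable_def)
qed

lemma flux_sum_integral:
  "(LINT x:\<Omega>|lebesgue_coords n. \<Sum>j<n. partial j \<Psi> x * flux 0 j x) =
    (LINT x:\<Omega>|lebesgue_coords n. - (\<Sum>j<n. \<Psi> x * dflux0 j x)) + (LINT x:F|\<sigma>. \<Sum>j<n. \<Psi> x * flux 0 j x * \<nu> x j)"
  "set_integrable (lebesgue_coords n) \<Omega> (\<lambda>x. - (\<Sum>j<n. \<Psi> x * dflux0 j x))"
  "set_integrable \<sigma> F (\<lambda>x. \<Sum>j<n. \<Psi> x * flux 0 j x * \<nu> x j)"
proof -
  note ibp = flux_integration_by_parts[OF \<Psi>_C1]
  have sum: "set_integrable M A (\<lambda>x. \<Sum>j<n. f j x) \<and> (LINT x:A|M. \<Sum>j<n. f j x) = (\<Sum>j<n. LINT x:A|M. f j x)"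
    if "\<And>j. j < n \<Longrightarrow> set_integrable M A (f j)" for M and A :: "(nat \<Rightarrow> real) set" and f :: "nat \<Rightarrow> _ \<Rightarrow> real"
    using that unfolding set_integrable_def set_lebesgue_integral_def scaleR_sum_right
    by (intro conjI Bochner_Integration.integrable_sum Bochner_Integration.integral_sum) simp_all
  note s1 = sum[of "lebesgue_coords n" \<Omega> "\<lambda>j x. partial j \<Psi> x * flux 0 j x", OF ibp(1)]
  note s2 = sum[of "lebesgue_coords n" \<Omega> "\<lambda>j x. \<Psi> x * dflux0 j x", OF ibp(2)]
  note s3 = sum[of \<sigma> F "\<lambda>j x. \<Psi> x * flux 0 j x * \<nu> x j", OF ibp(3)]
  show "set_integrable \<sigma> F (\<lambda>x. \<Sum>j<n. \<Psi> x * flux 0 j x * \<nu> x j)" using s3 by simp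
  show "set_integrable (lebesgue_coords n) \<Omega> (\<lambda>x. - (\<Sum>j<n. \<Psi> x * dflux0 j x))"
    using s2 by (simp add: set_integrable_def)
  have "(LINT x:\<Omega>|lebesgue_coords n. - (\<Sum>j<n. \<Psi> x * dflux0 j x)) = - (LINT x:\<Omega>|lebesgue_coords n. (\<Sum>j<n. \<Psi> x * dflux0 j x))"
    by (simp add: set_lebesgue_integral_def)
  moreover have "(\<Sum>j<n. LINT x:\<Omega>|lebesgue_coords n. partial j \<Psi> x * flux 0 j x) + (\<Sum>j<n. LINT x:\<Omega>|lebesgue_coords n. \<Psi> x * dflux0 j x)
     = (\<Sum>j<n. LINT x:F|\<sigma>. \<Psi> x * flux 0 j x * \<nu> x j)"
    using ibp(4) by (simp add: sum.distrib[symmetric])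
  ultimately show "(LINT x:\<Omega>|lebesgue_coords n. \<Sum>j<n. partial j \<Psi> x * flux 0 j x) =
    (LINT x:\<Omega>|lebesgue_coords n. - (\<Sum>j<n. \<Psi> x * dflux0 j x)) + (LINT x:F|\<sigma>. \<Sum>j<n. \<Psi> x * flux 0 j x * \<nu> x j)"
    using s1 s2 s3 by simp
qed

lemma integral_inequality:
  "(LINT x:\<Omega>|lebesgue_coords n. a x * grad_norm n \<phi> x powr p) \<ge>
    (LINT x:\<Omega>|lebesgue_coords n. - (\<Sum>j<n. \<Psi> x * dflux0 j x)) + remainder_const p * (LINT x:\<Omega>|lebesgue_coords n. R x)
    + (LINT x:F|\<sigma>. \<Sum>j<n. \<Psi> x * flux 0 j x * \<nu> x j)"
proof -
  have R: "set_integrable (lebesgue_coords n) \<Omega> (\<lambda>x. remainder_const p * R x)"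
    using R_integrable by (rule set_integrable_mult_right)
  have "(LINT x:\<Omega>|lebesgue_coords n. (\<Sum>j<n. partial j \<Psi> x * flux 0 j x) + remainder_const p * R x)
     \<le> (LINT x:\<Omega>|lebesgue_coords n. a x * grad_norm n \<phi> x powr p)"
    by (rule set_integral_mono[OF set_integral_add(1)[OF flux_sum_integrable R] grad_norm_\<phi>_integrable pointwise])
  also have "(LINT x:\<Omega>|lebesgue_coords n. (\<Sum>j<n. partial j \<Psi> x * flux 0 j x) + remainder_const p * R x) =
     (LINT x:\<Omega>|lebesgue_coords n. \<Sum>j<n. partial j \<Psi> x * flux 0 j x) + remainder_const p * (LINT x:\<Omega>|lebesgue_coords n. R x)"
    using set_integral_add(2)[OF flux_sum_integrable R] by simp
  finally show ?thesis unfolding flux_sum_integral(1) by simp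
qed

text \<open>Both the differential inequality and the boundary condition carry the factor u^(p-1);
  multiplication by the test function turns it into the weight |\<phi>|^p.\<close>

lemma powr_\<Psi>: "x \<in> V \<Longrightarrow> u x powr (p - 1) * \<Psi> x = \<bar>\<phi> x\<bar> powr p"
  using u_pos[of x] by (simp add: \<Psi>_def \<psi>_def abs_divide powr_divide powr_diff)

text \<open>The final statement uses complete Lebesgue measure, while Fubini and the divergence
  theorem work with its Borel version.\<close>

lemma integral_lebesgue_space:
  fixes f :: "(nat \<Rightarrow> real) \<Rightarrow> real"
  assumes "set_integrable (lebesgue_coords n) \<Omega> f"
  shows "(LINT x:\<Omega>|lebesgue_space n. f x) = (LINT x:\<Omega>|lebesgue_coords n. f x)"
    "set_integrable (lebesgue_space n) \<Omega> f"
proof -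
  have f: "integrable (lebesgue_coords n) (\<lambda>x. indicator \<Omega> x *\<^sub>R f x)"
    using assms by (simp only: set_integrable_def)
  note m = borel_measurable_integrable[OF f]
  show "(LINT x:\<Omega>|lebesgue_space n. f x) = (LINT x:\<Omega>|lebesgue_coords n. f x)"
    unfolding set_lebesgue_integral_def lebesgue_space_def by (rule integral_completion[OF m])
  show "set_integrable (lebesgue_space n) \<Omega> f"
    unfolding set_integrable_def lebesgue_space_def integrable_completion[OF m] by (rule f)
qed

text \<open>Multiplied by \<Psi> \<ge> 0, the differential inequality bounds b |\<phi>|^p above by
  minus \<Psi> times the limit divergence, which is integrable. On the boundary the condition holds
  with equality, so the surface term is reproduced exactly and may have either sign.\<close>

theorem inequality:
  assumes b: "AE x in lebesgue_space n. x \<in> \<Omega> \<longrightarrow>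
      (\<forall>i<n. has_partial i (p_flux p n a u i) x) \<and> - divergence n (p_flux p n a u) x \<ge> b x * u x powr (p - 1)"
    and \<beta>_int: "set_integrable (completion \<sigma>) F \<beta>"
    and \<beta>: "AE x in completion \<sigma>. x \<in> F \<longrightarrow>
       a x * grad_norm n u x powr (p - 2) * normal_derivative n \<Omega> u x = \<beta> x * u x powr (p - 1)"
  shows "ereal (LINT x:\<Omega>|lebesgue_space n. a x * grad_norm n \<phi> x powr p) \<ge>
    ext_integral (lebesgue_space n) \<Omega> (\<lambda>x. b x * \<bar>\<phi> x\<bar> powr p)
    + ereal (remainder_const p * (LINT x:\<Omega>|lebesgue_space n. R x))
    + ereal (LINT x:F|completion \<sigma>. \<beta> x * \<bar>\<phi> x\<bar> powr p)"
proof -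
  have "AE x in lebesgue_coords n. \<forall>j\<in>{..<n}. x \<in> \<Omega> \<and> has_partial j (p_flux p n a u j) x \<longrightarrow>
      partial j (p_flux p n a u j) x = dflux0 j x"
    using AE_dflux0 by (intro AE_finite_allI) auto
  then have "AE x in lebesgue_space n. \<forall>j\<in>{..<n}. x \<in> \<Omega> \<and> has_partial j (p_flux p n a u j) x \<longrightarrow>
      partial j (p_flux p n a u j) x = dflux0 j x"
    unfolding lebesgue_space_def by (rule AE_completion)
  with b have le: "AE x in lebesgue_space n. x \<in> \<Omega> \<longrightarrow> b x * \<bar>\<phi> x\<bar> powr p \<le> - (\<Sum>j<n. \<Psi> x * dflux0 j x)"
  proof eventually_elim
    case (elim x)
    show ?case
    proof
      assume x: "x \<in> \<Omega>"
      then have xV: "x \<in> V" using \<Omega>_V by auto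
      have "divergence n (p_flux p n a u) x = (\<Sum>j<n. dflux0 j x)"
        unfolding divergence_def using elim x by (intro sum.cong) auto
      then have "b x * u x powr (p - 1) \<le> - (\<Sum>j<n. dflux0 j x)" using elim x by simp
      moreover have "\<Psi> x \<ge> 0" using u_pos[OF xV] by (simp add: \<Psi>_def)
      ultimately have "b x * u x powr (p - 1) * \<Psi> x \<le> - (\<Sum>j<n. dflux0 j x) * \<Psi> x" by (rule mult_right_mono)
      then show "b x * \<bar>\<phi> x\<bar> powr p \<le> - (\<Sum>j<n. \<Psi> x * dflux0 j x)"
        using powr_\<Psi>[OF xV] by (simp add: sum_distrib_right sum_distrib_left mult.assoc mult.commute[of "\<Psi> x"])
    qed
  qed
  have ext: "ext_integral (lebesgue_space n) \<Omega> (\<lambda>x. b x * \<bar>\<phi> x\<bar> powr p)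
      \<le> ereal (LINT x:\<Omega>|lebesgue_coords n. - (\<Sum>j<n. \<Psi> x * dflux0 j x))"
    using ext_integral_mono_integrable[OF _ le] integral_lebesgue_space[OF flux_sum_integral(2)]
    by (simp add: set_integrable_def)
  have bd: "(LINT x:F|completion \<sigma>. \<beta> x * \<bar>\<phi> x\<bar> powr p) = (LINT x:F|\<sigma>. \<Sum>j<n. \<Psi> x * flux 0 j x * \<nu> x j)"
  proof -
    have m: "(\<lambda>x. indicator F x *\<^sub>R (\<Sum>j<n. \<Psi> x * flux 0 j x * \<nu> x j)) \<in> borel_measurable \<sigma>"
      using flux_sum_integral(3) unfolding set_integrable_def by (rule borel_measurable_integrable)
    have "(LINT x:F|completion \<sigma>. \<beta> x * \<bar>\<phi> x\<bar> powr p) = (LINT x:F|completion \<sigma>. \<Sum>j<n. \<Psi> x * flux 0 j x * \<nu> x j)"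
      unfolding set_lebesgue_integral_def
    proof (rule integral_cong_AE)
      have "continuous_on F (\<lambda>x. \<bar>\<phi> x\<bar> powr p)"
        using p by (intro continuous_on_powr' continuous_on_rabs continuous_on_const continuous_on_subset[OF C1_onD(2)[OF \<phi>] F_V]) auto
      then have "(\<lambda>x. \<bar>\<phi> x\<bar> powr p * indicator F x) \<in> borel_measurable (completion \<sigma>)"
        using borel_measurable_continuous_on_times_indicator[OF F_borel]
        by (intro measurable_completion) (simp only: measurable_cong_sets[OF sets_\<sigma> refl])
      then have "(\<lambda>x. (indicator F x *\<^sub>R \<beta> x) * (\<bar>\<phi> x\<bar> powr p * indicator F x)) \<in> borel_measurable (completion \<sigma>)"
        using \<beta>_int[unfolded set_integrable_def, THEN borel_measurable_integrable] by (rule borel_measurable_times[rotated])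
      moreover have "(\<lambda>x. (indicator F x *\<^sub>R \<beta> x) * (\<bar>\<phi> x\<bar> powr p * indicator F x)) = (\<lambda>x. indicator F x *\<^sub>R (\<beta> x * \<bar>\<phi> x\<bar> powr p))"
        by (auto simp: fun_eq_iff split: split_indicator)
      ultimately show "(\<lambda>x. indicator F x *\<^sub>R (\<beta> x * \<bar>\<phi> x\<bar> powr p)) \<in> borel_measurable (completion \<sigma>)" by simp
      show "(\<lambda>x. indicator F x *\<^sub>R (\<Sum>j<n. \<Psi> x * flux 0 j x * \<nu> x j)) \<in> borel_measurable (completion \<sigma>)"
        using m by (rule measurable_completion)
      show "AE x in completion \<sigma>. indicator F x *\<^sub>R (\<beta> x * \<bar>\<phi> x\<bar> powr p) = indicator F x *\<^sub>R (\<Sum>j<n. \<Psi> x * flux 0 j x * \<nu> x j)"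
        using \<beta>
      proof eventually_elim
        case (elim x)
        show ?case
        proof (cases "x \<in> F")
          case True
          then have xV: "x \<in> V" using F_V by auto
          have "(\<Sum>j<n. \<Psi> x * flux 0 j x * \<nu> x j) = \<Psi> x * (\<Sum>j<n. p_flux p n a u j x * \<nu> x j)"
            by (simp add: p_flux_eq sum_distrib_left mult.assoc)
          \<comment> \<open>The flux paired with the exterior normal is the left side of the
            boundary condition.\<close>
          also have "(\<Sum>j<n. p_flux p n a u j x * \<nu> x j) = \<beta> x * u x powr (p - 1)"
            using elim True by (simp add: p_flux_def normal_derivative_def sum_distrib_left mult.assoc)
          finally show ?thesis using powr_\<Psi>[OF xV] by (simp add: mult_ac)
        qed simp
      qed
    qed
    also have "\<dots> = (LINT x:F|\<sigma>. \<Sum>j<n. \<Psi> x * flux 0 j x * \<nu> x j)"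
      unfolding set_lebesgue_integral_def by (rule integral_completion[OF m])
    finally show ?thesis .
  qed
  have "ext_integral (lebesgue_space n) \<Omega> (\<lambda>x. b x * \<bar>\<phi> x\<bar> powr p)
    + ereal (remainder_const p * (LINT x:\<Omega>|lebesgue_space n. R x))
    + ereal (LINT x:F|completion \<sigma>. \<beta> x * \<bar>\<phi> x\<bar> powr p)
    \<le> ereal (LINT x:\<Omega>|lebesgue_coords n. - (\<Sum>j<n. \<Psi> x * dflux0 j x))
    + ereal (remainder_const p * (LINT x:\<Omega>|lebesgue_space n. R x))
    + ereal (LINT x:F|completion \<sigma>. \<beta> x * \<bar>\<phi> x\<bar> powr p)"
    by (intro add_right_mono ext)
  also have "\<dots> \<le> ereal (LINT x:\<Omega>|lebesgue_coords n. a x * grad_norm n \<phi> x powr p)"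
    using integral_inequality by (simp add: bd integral_lebesgue_space(1)[OF R_integrable])
  finally show ?thesis by (simp add: integral_lebesgue_space(1)[OF grad_norm_\<phi>_integrable])
qed

end

text \<open>The data a, u and \<phi> are regular on different neighbourhoods of the closure of
  \<Omega>. The proof passes to one open set V on which all of them are regular and u is
  positive.\<close>

lemma weighted_hardy_inequality:
  fixes p :: real
  assumes p: "p > 1" and \<Omega>: "smooth_bounded_domain n \<Omega>" and \<sigma>: "is_surface_measure n \<Omega> \<sigma>"
    and a: "C1_up_to_boundary n \<Omega> a" and a_nonneg: "\<forall>x\<in>\<Omega>. a x \<ge> 0"
    and u: "smooth_up_to_boundary n \<Omega> u" and u_pos: "\<forall>x\<in>Euclidean_space n closure_of \<Omega>. u x > 0"
    and \<beta>_int: "locally_integrable n (completion \<sigma>) (Euclidean_space n frontier_of \<Omega>) \<beta>"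
    and b: "AE x in lebesgue_space n. x \<in> \<Omega> \<longrightarrow>
       (\<forall>i<n. has_partial i (p_flux p n a u i) x) \<and> - divergence n (p_flux p n a u) x \<ge> b x * u x powr (p - 1)"
    and \<beta>: "AE x in completion \<sigma>. x \<in> Euclidean_space n frontier_of \<Omega> \<longrightarrow>
       a x * grad_norm n u x powr (p - 2) * normal_derivative n \<Omega> u x = \<beta> x * u x powr (p - 1)"
    and \<phi>: "smooth_up_to_boundary n \<Omega> \<phi>"
  shows "ereal (LINT x:\<Omega>|lebesgue_space n. a x * grad_norm n \<phi> x powr p) \<ge>
    ext_integral (lebesgue_space n) \<Omega> (\<lambda>x. b x * \<bar>\<phi> x\<bar> powr p)
    + ereal (remainder_const p * (LINT x:\<Omega>|lebesgue_space n. a x * remainder p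
        (\<bar>\<phi> x / u x\<bar> * grad_norm n u x) (grad_norm n (\<lambda>y. \<phi> y / u y) x * u x)))
    + ereal (LINT x:(Euclidean_space n frontier_of \<Omega>)|completion \<sigma>. \<beta> x * \<bar>\<phi> x\<bar> powr p)"
proof -
  have o: "openin (Euclidean_space n) \<Omega>" using \<Omega> by (simp add: smooth_bounded_domain_def)
  note F = frontier_of_coord_space[OF o] and C = closure_of_coord_space[OF openin_coord_space_subset[OF o]]
  obtain Ua where Ua: "openin (Euclidean_space n) Ua" "closure \<Omega> \<subseteq> Ua" "Ck_on n 1 Ua a"
    using a unfolding C1_up_to_boundary_def C by blast
  obtain Uu where Uu: "openin (Euclidean_space n) Uu" "closure \<Omega> \<subseteq> Uu" "smooth_on n Uu u"
    using u unfolding smooth_up_to_boundary_def C by blast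
  obtain U\<phi> where U\<phi>: "openin (Euclidean_space n) U\<phi>" "closure \<Omega> \<subseteq> U\<phi>" "smooth_on n U\<phi> \<phi>"
    using \<phi> unfolding smooth_up_to_boundary_def C by blast
  have u_cont: "continuous_on Uu u" using C1_onD(2)[OF C1_on_if_smooth_on[OF Uu(1,3)]] .
  obtain T where T: "open T" "Uu = coord_space n \<inter> T" using Uu(1) by (auto simp: openin_coord_space_iff)
  have "openin (top_of_set Uu) (Uu \<inter> u -` {0<..})"
    by (rule continuous_openin_preimage_gen[OF u_cont open_greaterThan])
  then obtain T' where T': "open T'" "Uu \<inter> u -` {0<..} = Uu \<inter> T'" by (auto simp: openin_open)
  then have "Uu \<inter> u -` {0<..} = coord_space n \<inter> (T \<inter> T')" using T(2) by auto
  then have oU: "openin (Euclidean_space n) (Uu \<inter> u -` {0<..})"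
    unfolding openin_coord_space_iff using T(1) T'(1) by (intro exI[of _ "T \<inter> T'"]) (auto intro: open_Int)
  \<comment> \<open>Positivity of u on the closure extends to this open set by continuity, which
    makes \<phi>/u a C^1 function up to and across the boundary.\<close>
  define V where "V = Ua \<inter> U\<phi> \<inter> (Uu \<inter> u -` {0<..})"
  have V: "openin (Euclidean_space n) V" unfolding V_def by (rule openin_Int[OF openin_Int[OF Ua(1) U\<phi>(1)] oU])
  have KV: "closure \<Omega> \<subseteq> V" using Ua(2) Uu(2) U\<phi>(2) u_pos unfolding C V_def by auto
  interpret positive_flux_domain n \<Omega> V \<sigma> a u p \<phi>
  proof
    show "C1_on n V a" using Ua by (intro C1_on_subset[OF C1_on_if_Ck_on V]) (auto simp: V_def)
    show "smooth_on n V u" by (rule smooth_on_subset[OF Uu(3)]) (auto simp: V_def)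
    show "C1_on n V \<phi>" using U\<phi> by (intro C1_on_subset[OF C1_on_if_smooth_on V]) (auto simp: V_def)
    show "u x > 0" if "x \<in> V" for x using that by (simp add: V_def)
  qed (use \<Omega> \<sigma> V KV p a_nonneg in auto)
  \<comment> \<open>The boundary is itself compact, so local integrability of \<beta> on it is
    integrability over all of it.\<close>
  have "compactin (Euclidean_space n) (closure \<Omega> - \<Omega>)"
  proof -
    obtain S where S: "open S" "\<Omega> = coord_space n \<inter> S" using o by (auto simp: openin_coord_space_iff)
    have sub: "closure \<Omega> \<subseteq> coord_space n" using KV openin_coord_space_subset[OF V(1)] by auto
    have "closure \<Omega> - \<Omega> = closure \<Omega> \<inter> - S" using S(2) sub by auto
    moreover have "compact (closure \<Omega> \<inter> - S)" using compact_K S(1) by (intro compact_Int_closed) auto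
    ultimately show ?thesis using sub by (auto simp: compactin_coord_space)
  qed
  then have \<beta>F: "set_integrable (completion \<sigma>) (closure \<Omega> - \<Omega>) \<beta>"
    using \<beta>_int unfolding locally_integrable_def F by blast
  have "grad_norm n \<psi> = grad_norm n (\<lambda>y. \<phi> y / u y)" by (simp add: \<psi>_def[abs_def])
  then have "R x = a x * remainder p (\<bar>\<phi> x / u x\<bar> * grad_norm n u x) (grad_norm n (\<lambda>y. \<phi> y / u y) x * u x)" for x
    by (simp add: R_def \<psi>_def)
  then show ?thesis
    using inequality[OF b \<beta>F \<beta>[unfolded F]] unfolding F by simp
qed

theorem theorem2p1:
  fixes p :: real
  assumes "p > 1"
  shows "\<exists>c>0. \<forall>n \<Omega> \<sigma> a u b \<beta>.
    n \<ge> 1 \<and> smooth_bounded_domain n \<Omega> \<and> is_surface_measure n \<Omega> \<sigma> \<and>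
    C1_up_to_boundary n \<Omega> a \<and> (\<forall>x\<in>\<Omega>. a x \<ge> 0) \<and>
    smooth_up_to_boundary n \<Omega> u \<and> (\<forall>x\<in>Euclidean_space n closure_of \<Omega>. u x > 0) \<and>
    locally_integrable n (lebesgue_space n) \<Omega> b \<and>
    locally_integrable n (completion \<sigma>) (Euclidean_space n frontier_of \<Omega>) \<beta> \<and>
    (AE x in lebesgue_space n. x \<in> \<Omega> \<longrightarrow>
       (\<forall>i<n. has_partial i (p_flux p n a u i) x) \<and>
       - divergence n (p_flux p n a u) x \<ge> b x * u x powr (p - 1)) \<and>
    (AE x in completion \<sigma>. x \<in> Euclidean_space n frontier_of \<Omega> \<longrightarrow>
       a x * grad_norm n u x powr (p - 2) * normal_derivative n \<Omega> u x = \<beta> x * u x powr (p - 1))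
    \<longrightarrow>
    (p \<ge> 2 \<longrightarrow> (\<forall>\<phi>. smooth_up_to_boundary n \<Omega> \<phi> \<longrightarrow>
       ereal (LINT x:\<Omega>|lebesgue_space n. a x * grad_norm n \<phi> x powr p)
       \<ge> ext_integral (lebesgue_space n) \<Omega> (\<lambda>x. b x * \<bar>\<phi> x\<bar> powr p)
         + ereal (c * (LINT x:\<Omega>|lebesgue_space n.
                         a x * grad_norm n (\<lambda>y. \<phi> y / u y) x powr p * u x powr p))
         + ereal (LINT x:(Euclidean_space n frontier_of \<Omega>)|completion \<sigma>.
                    \<beta> x * \<bar>\<phi> x\<bar> powr p)))
    \<and>
    (p < 2 \<longrightarrow> (\<forall>\<phi>. smooth_up_to_boundary n \<Omega> \<phi> \<longrightarrow>
       ereal (LINT x:\<Omega>|lebesgue_space n. a x * grad_norm n \<phi> x powr p)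
       \<ge> ext_integral (lebesgue_space n) \<Omega> (\<lambda>x. b x * \<bar>\<phi> x\<bar> powr p)
         + ereal (c * (LINT x:\<Omega>|lebesgue_space n.
                         a x * ((grad_norm n (\<lambda>y. \<phi> y / u y) x)\<^sup>2 * (u x)\<^sup>2
                           / (\<bar>\<phi> x / u x\<bar> * grad_norm n u x
                              + grad_norm n (\<lambda>y. \<phi> y / u y) x * u x) powr (2 - p))))
         + ereal (LINT x:(Euclidean_space n frontier_of \<Omega>)|completion \<sigma>.
                    \<beta> x * \<bar>\<phi> x\<bar> powr p)))"
proof (intro exI[of _ "remainder_const p"] conjI allI impI)
  show "remainder_const p > 0" using assms by (rule remainder_const_pos)
next
  fix n \<Omega> \<sigma> a u b \<beta> \<phi>
  assume A: "n \<ge> 1 \<and> smooth_bounded_domain n \<Omega> \<and> is_surface_measure n \<Omega> \<sigma> \<and>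
    C1_up_to_boundary n \<Omega> a \<and> (\<forall>x\<in>\<Omega>. a x \<ge> 0) \<and>
    smooth_up_to_boundary n \<Omega> u \<and> (\<forall>x\<in>Euclidean_space n closure_of \<Omega>. u x > 0) \<and>
    locally_integrable n (lebesgue_space n) \<Omega> b \<and>
    locally_integrable n (completion \<sigma>) (Euclidean_space n frontier_of \<Omega>) \<beta> \<and>
    (AE x in lebesgue_space n. x \<in> \<Omega> \<longrightarrow>
       (\<forall>i<n. has_partial i (p_flux p n a u i) x) \<and>
       - divergence n (p_flux p n a u) x \<ge> b x * u x powr (p - 1)) \<and>
    (AE x in completion \<sigma>. x \<in> Euclidean_space n frontier_of \<Omega> \<longrightarrow>
       a x * grad_norm n u x powr (p - 2) * normal_derivative n \<Omega> u x = \<beta> x * u x powr (p - 1))"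
    and \<phi>: "smooth_up_to_boundary n \<Omega> \<phi>"
  have u: "0 < u x" if "x \<in> \<Omega>" for x
  proof -
    have "\<Omega> \<subseteq> coord_space n"
      using A by (auto simp: smooth_bounded_domain_def dest: openin_coord_space_subset)
    then have "x \<in> Euclidean_space n closure_of \<Omega>"
      using that closure_of_subset[of \<Omega> "Euclidean_space n"] by auto
    then show ?thesis using A by blast
  qed
  note main = weighted_hardy_inequality[OF assms, of n \<Omega> \<sigma> a u \<beta> b \<phi>]
  {
    assume p: "p \<ge> 2"
    \<comment> \<open>Splitting the power of the product requires nonnegative factors; u is positive
      on \<Omega>, and outside of \<Omega> the indicator vanishes.\<close>
    have eq: "(LINT x:\<Omega>|lebesgue_space n. a x * remainder p
        (\<bar>\<phi> x / u x\<bar> * grad_norm n u x) (grad_norm n (\<lambda>y. \<phi> y / u y) x * u x)) =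
      (LINT x:\<Omega>|lebesgue_space n. a x * grad_norm n (\<lambda>y. \<phi> y / u y) x powr p * u x powr p)"
      unfolding set_lebesgue_integral_def
      by (intro Bochner_Integration.integral_cong refl)
        (use p u in \<open>auto simp: remainder_def powr_mult grad_norm_def L2_set_nonneg less_imp_le split: split_indicator\<close>)
    show "ereal (LINT x:\<Omega>|lebesgue_space n. a x * grad_norm n \<phi> x powr p)
       \<ge> ext_integral (lebesgue_space n) \<Omega> (\<lambda>x. b x * \<bar>\<phi> x\<bar> powr p)
         + ereal (remainder_const p * (LINT x:\<Omega>|lebesgue_space n.
                         a x * grad_norm n (\<lambda>y. \<phi> y / u y) x powr p * u x powr p))
         + ereal (LINT x:(Euclidean_space n frontier_of \<Omega>)|completion \<sigma>.
                    \<beta> x * \<bar>\<phi> x\<bar> powr p)"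
      using main A \<phi> unfolding eq by blast
  }
  {
    assume p: "p < 2"
    then have eq: "a x * remainder p (\<bar>\<phi> x / u x\<bar> * grad_norm n u x) (grad_norm n (\<lambda>y. \<phi> y / u y) x * u x) =
        a x * ((grad_norm n (\<lambda>y. \<phi> y / u y) x)\<^sup>2 * (u x)\<^sup>2
                           / (\<bar>\<phi> x / u x\<bar> * grad_norm n u x
                              + grad_norm n (\<lambda>y. \<phi> y / u y) x * u x) powr (2 - p))" for x
      by (simp add: remainder_def power_mult_distrib)
    show "ereal (LINT x:\<Omega>|lebesgue_space n. a x * grad_norm n \<phi> x powr p)
       \<ge> ext_integral (lebesgue_space n) \<Omega> (\<lambda>x. b x * \<bar>\<phi> x\<bar> powr p)
         + ereal (remainder_const p * (LINT x:\<Omega>|lebesgue_space n.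
                         a x * ((grad_norm n (\<lambda>y. \<phi> y / u y) x)\<^sup>2 * (u x)\<^sup>2
                           / (\<bar>\<phi> x / u x\<bar> * grad_norm n u x
                              + grad_norm n (\<lambda>y. \<phi> y / u y) x * u x) powr (2 - p))))
         + ereal (LINT x:(Euclidean_space n frontier_of \<Omega>)|completion \<sigma>.
                    \<beta> x * \<bar>\<phi> x\<bar> powr p)"
      using main A \<phi> unfolding eq by blast
  }
qed

end
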